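(* There is an algorithm that, given a set $\mathcal T$ of $m$ state sequences of length $n$ and a set $\mathcal C$ of $k$ monotone decreasing criteria (which may be dependent), computes a valid flow diagram for $\mathcal T$ with the minimum possible number of nodes in $O(k(n+1)^{2m-1}\cdot T(m,n)+m(n+1)^m)$ time, where $T(m,n)$ is the time required to check whether a set of at most $m$ subsequences, each of length at most $n$, fulfils a criterion.
   Context: A state sequence is a finite sequence of states. A criterion is a Boolean predicate evaluated on a set of contiguous subsequences (segments) taken from the input state sequences; a set of segments fulfils $C$ if $C$ evaluates to true on it. A criterion is dependent if fulfilment of a segment of one sequence may depend on segments of other sequences. A criterion $C$ is monotone decreasing if whenever a set of subsequences fulfils $C$, the set obtained by replacing each of them by a contiguous subsequence of it also fulfils $C$. A segmentation of a state sequence $\tau$ is a partition of $\tau$ into consecutive nonempty contiguous subsequences, called segments. A flow diagram is a node-labelled directed acyclic graph with a source node $s$ and a sink node $t$, in which every other node is labelled by a criterion from $\mathcal C$; its size is its number of nodes. A flow diagram $F$ is valid for $\mathcal T=\{\tau_1,\dots,\tau_m\}$ if for each $\tau_i$ there is a segmentation $(\sigma_{i,1},\dots,\sigma_{i,r_i})$ of $\tau_i$ and an $s$–$t$ path $s,v_{i,1},\dots,v_{i,r_i},t$ in $F$ such that for every node $v\neq s,t$ of $F$, the set of all segments $\sigma_{i,j}$ with $v_{i,j}=v$ jointly fulfils the criterion labelling $v$. *)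

theory Defs
  imports Complex_Main
begin

section \<open>State sequences, criteria, flow diagrams\<close>

text \<open>
  A segment is a subsequence \<^emph>\<open>of an input sequence\<close>, so \<open>(i, a, w)\<close> records the index \<open>i\<close> of its
  sequence and its starting position \<open>a\<close> in addition to its states \<open>w\<close>. In particular, equal lists
  of states taken from different sequences are different elements of a set of segments.
\<close>

type_synonym 's segment = "nat \<times> nat \<times> 's list"

type_synonym 's criterion = "'s segment set \<Rightarrow> bool"

definition segments_of :: "'s list list \<Rightarrow> 's segment set" where
  "segments_of \<tau>s = {(i, a, w). i < length \<tau>s \<and> w \<noteq> [] \<and> (\<exists>p q. \<tau>s ! i = p @ w @ q \<and> a = length p)}"

definition subsegment :: "'s segment \<Rightarrow> 's segment \<Rightarrow> bool" where
  "subsegment \<sigma>' \<sigma> \<longleftrightarrow> (case (\<sigma>', \<sigma>) of ((i', a', w'), (i, a, w)) \<Rightarrow>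
     i' = i \<and> w' \<noteq> [] \<and> (\<exists>p q. w = p @ w' @ q \<and> a' = a + length p))"

definition monotone_decreasing :: "'s list list \<Rightarrow> 's criterion \<Rightarrow> bool" where
  "monotone_decreasing \<tau>s C \<longleftrightarrow>
     (\<forall>S f. S \<subseteq> segments_of \<tau>s \<and> (\<forall>\<sigma>\<in>S. subsegment (f \<sigma>) \<sigma>) \<and> C S \<longrightarrow> C (f ` S))"

definition segmentation :: "'s list \<Rightarrow> 's list list \<Rightarrow> bool" where
  "segmentation \<tau> ws \<longleftrightarrow> concat ws = \<tau> \<and> [] \<notin> set ws"

definition located :: "nat \<Rightarrow> 's list list \<Rightarrow> nat \<Rightarrow> 's segment" where
  "located i ws j = (i, length (concat (take j ws)), ws ! j)"

text \<open>The label of a node is the index of its criterion in the list of criteria.\<close>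

record flow_diagram =
  nodes :: "nat set"
  arcs :: "(nat \<times> nat) set"
  source :: nat
  sink :: nat
  label :: "nat \<Rightarrow> nat"

definition inner_nodes :: "flow_diagram \<Rightarrow> nat set" where
  "inner_nodes F = nodes F - {source F, sink F}"

definition is_flow_diagram :: "'s criterion list \<Rightarrow> flow_diagram \<Rightarrow> bool" where
  "is_flow_diagram Cs F \<longleftrightarrow>
     finite (nodes F) \<and> arcs F \<subseteq> nodes F \<times> nodes F \<and> acyclic (arcs F) \<and>
     source F \<in> nodes F \<and> sink F \<in> nodes F \<and> source F \<noteq> sink F \<and>
     (\<forall>u. (u, source F) \<notin> arcs F) \<and> (\<forall>u. (sink F, u) \<notin> arcs F) \<and>
     (\<forall>v\<in>inner_nodes F. label F v < length Cs)"

definition size_of :: "flow_diagram \<Rightarrow> nat" where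
  "size_of F = card (nodes F)"

definition st_path :: "flow_diagram \<Rightarrow> nat list \<Rightarrow> bool" where
  "st_path F vs \<longleftrightarrow> successively (\<lambda>u v. (u, v) \<in> arcs F) (source F # vs @ [sink F])"

definition valid_for :: "'s list list \<Rightarrow> 's criterion list \<Rightarrow> flow_diagram \<Rightarrow> bool" where
  "valid_for \<tau>s Cs F \<longleftrightarrow>
     (\<exists>(ws :: nat \<Rightarrow> 's list list) (vs :: nat \<Rightarrow> nat list).
        (\<forall>i<length \<tau>s. segmentation (\<tau>s ! i) (ws i) \<and> length (vs i) = length (ws i) \<and>
           st_path F (vs i)) \<and>
        (\<forall>v\<in>inner_nodes F.
           (Cs ! label F v)
             {located i (ws i) j | i j. i < length \<tau>s \<and> j < length (ws i) \<and> vs i ! j = v}))"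

definition valid_flow_diagram :: "'s list list \<Rightarrow> 's criterion list \<Rightarrow> flow_diagram \<Rightarrow> bool" where
  "valid_flow_diagram \<tau>s Cs F \<longleftrightarrow> is_flow_diagram Cs F \<and> valid_for \<tau>s Cs F"

definition minimum_flow_diagram :: "'s list list \<Rightarrow> 's criterion list \<Rightarrow> flow_diagram \<Rightarrow> bool" where
  "minimum_flow_diagram \<tau>s Cs F \<longleftrightarrow>
     valid_flow_diagram \<tau>s Cs F \<and> (\<forall>F'. valid_flow_diagram \<tau>s Cs F' \<longrightarrow> size_of F \<le> size_of F')"


section \<open>Algorithms and their running time\<close>

text \<open>
  Programs run on a unit-cost random access machine with addition and (truncated) subtraction as
  the only arithmetic operations. Every operator, variable, constant and array access in an
  expression or test costs one unit, and so does every write. States and criteria are opaque to a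
  program: its only access to them is the command \<open>Check x e lo hi\<close>. It asks whether criterion
  number \<open>e\<close> is fulfilled by the set that contains, for each \<open>i < m\<close> with \<open>lo[i] < hi[i]\<close>, the
  segment of sequence \<open>i\<close> from position \<open>lo[i]\<close> (inclusive) to \<open>hi[i]\<close> (exclusive); sequences with
  \<open>lo[i] = hi[i]\<close> contribute nothing. The set thus has at most \<open>m\<close> elements, and the check itself
  costs \<open>q\<close> units. Malformed checks have no semantics, so a program that makes one does not
  terminate properly.
\<close>

type_synonym name = string

datatype aexp = N nat | V name | Get name aexp | Plus aexp aexp | Minus aexp aexp

datatype bexp = Less aexp aexp | Equal aexp aexp | Neg bexp | Conj bexp bexp

datatype com =
    Skip
  | Assign name aexp
  | Put name aexp aexp
  | Check name aexp name name
  | Seq com com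
  | Cond bexp com com
  | While bexp com

record store =
  vars :: "name \<Rightarrow> nat"
  arrs :: "name \<Rightarrow> nat \<Rightarrow> nat"

fun aval :: "aexp \<Rightarrow> store \<Rightarrow> nat" where
  "aval (N c) s = c"
| "aval (V x) s = vars s x"
| "aval (Get a e) s = arrs s a (aval e s)"
| "aval (Plus e1 e2) s = aval e1 s + aval e2 s"
| "aval (Minus e1 e2) s = aval e1 s - aval e2 s"

fun acost :: "aexp \<Rightarrow> nat" where
  "acost (N c) = 1"
| "acost (V x) = 1"
| "acost (Get a e) = acost e + 1"
| "acost (Plus e1 e2) = acost e1 + acost e2 + 1"
| "acost (Minus e1 e2) = acost e1 + acost e2 + 1"

fun bval :: "bexp \<Rightarrow> store \<Rightarrow> bool" where
  "bval (Less e1 e2) s \<longleftrightarrow> aval e1 s < aval e2 s"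
| "bval (Equal e1 e2) s \<longleftrightarrow> aval e1 s = aval e2 s"
| "bval (Neg b) s \<longleftrightarrow> \<not> bval b s"
| "bval (Conj b1 b2) s \<longleftrightarrow> bval b1 s \<and> bval b2 s"

fun bcost :: "bexp \<Rightarrow> nat" where
  "bcost (Less e1 e2) = acost e1 + acost e2 + 1"
| "bcost (Equal e1 e2) = acost e1 + acost e2 + 1"
| "bcost (Neg b) = bcost b + 1"
| "bcost (Conj b1 b2) = bcost b1 + bcost b2 + 1"

definition set_var :: "name \<Rightarrow> nat \<Rightarrow> store \<Rightarrow> store" where
  "set_var x c s = s\<lparr>vars := (vars s)(x := c)\<rparr>"

definition set_arr :: "name \<Rightarrow> nat \<Rightarrow> nat \<Rightarrow> store \<Rightarrow> store" where
  "set_arr a j c s = s\<lparr>arrs := (arrs s)(a := (arrs s a)(j := c))\<rparr>"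

definition well_formed_check :: "'s list list \<Rightarrow> (nat \<Rightarrow> nat) \<Rightarrow> (nat \<Rightarrow> nat) \<Rightarrow> bool" where
  "well_formed_check \<tau>s lo hi \<longleftrightarrow> (\<forall>i<length \<tau>s. lo i \<le> hi i \<and> hi i \<le> length (\<tau>s ! i))"

definition checked_set :: "'s list list \<Rightarrow> (nat \<Rightarrow> nat) \<Rightarrow> (nat \<Rightarrow> nat) \<Rightarrow> 's segment set" where
  "checked_set \<tau>s lo hi =
     {(i, lo i, take (hi i - lo i) (drop (lo i) (\<tau>s ! i))) | i. i < length \<tau>s \<and> lo i < hi i}"

text \<open>
  \<open>exec \<tau>s Cs q c s t s'\<close>: on sequences \<open>\<tau>s\<close> and criteria \<open>Cs\<close>, where each check costs \<open>q\<close>,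
  program \<open>c\<close> started in \<open>s\<close> terminates in \<open>s'\<close> after time \<open>t\<close>.
\<close>

inductive exec :: "'s list list \<Rightarrow> 's criterion list \<Rightarrow> nat \<Rightarrow> com \<Rightarrow> store \<Rightarrow> nat \<Rightarrow> store \<Rightarrow> bool"
  for \<tau>s :: "'s list list" and Cs :: "'s criterion list" and q :: nat where
  Skip: "exec \<tau>s Cs q Skip s 1 s"
| Assign: "exec \<tau>s Cs q (Assign x e) s (acost e + 1) (set_var x (aval e s) s)"
| Put: "exec \<tau>s Cs q (Put a e1 e2) s (acost e1 + acost e2 + 1)
         (set_arr a (aval e1 s) (aval e2 s) s)"
| Check: "aval e s < length Cs \<Longrightarrow> well_formed_check \<tau>s (arrs s lo) (arrs s hi) \<Longrightarrow>
    exec \<tau>s Cs q (Check x e lo hi) s (acost e + q + 1)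
      (set_var x (of_bool ((Cs ! aval e s) (checked_set \<tau>s (arrs s lo) (arrs s hi)))) s)"
| Seq: "exec \<tau>s Cs q c1 s t1 s' \<Longrightarrow> exec \<tau>s Cs q c2 s' t2 s'' \<Longrightarrow>
    exec \<tau>s Cs q (Seq c1 c2) s (t1 + t2) s''"
| CondTrue: "bval b s \<Longrightarrow> exec \<tau>s Cs q c1 s t s' \<Longrightarrow> exec \<tau>s Cs q (Cond b c1 c2) s (bcost b + t) s'"
| CondFalse: "\<not> bval b s \<Longrightarrow> exec \<tau>s Cs q c2 s t s' \<Longrightarrow> exec \<tau>s Cs q (Cond b c1 c2) s (bcost b + t) s'"
| WhileFalse: "\<not> bval b s \<Longrightarrow> exec \<tau>s Cs q (While b c) s (bcost b) s"
| WhileTrue: "bval b s \<Longrightarrow> exec \<tau>s Cs q c s t1 s' \<Longrightarrow> exec \<tau>s Cs q (While b c) s' t2 s'' \<Longrightarrow>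
    exec \<tau>s Cs q (While b c) s (bcost b + t1 + t2) s''"

inductive_cases exec_SkipE: "exec \<tau>s Cs q Skip s t s'"
inductive_cases exec_AssignE: "exec \<tau>s Cs q (Assign x e) s t s'"
inductive_cases exec_PutE: "exec \<tau>s Cs q (Put a e1 e2) s t s'"
inductive_cases exec_CheckE: "exec \<tau>s Cs q (Check x e lo hi) s t s'"
inductive_cases exec_SeqE: "exec \<tau>s Cs q (Seq c1 c2) s t s'"
inductive_cases exec_CondE: "exec \<tau>s Cs q (Cond b c1 c2) s t s'"
inductive_cases exec_WhileE: "exec \<tau>s Cs q (While b c) s t s'"

lemma exec_deterministic:
  "exec \<tau>s Cs q c s t s' \<Longrightarrow> exec \<tau>s Cs q c s u s'' \<Longrightarrow> t = u \<and> s' = s''"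
proof (induction arbitrary: u s'' rule: exec.induct)
  case (Seq c1 s t1 s1 c2 t2 s2)
  then show ?case by (metis exec_SeqE)
next
  case (CondTrue b s c1 t s' c2)
  then show ?case by (metis exec_CondE)
next
  case (CondFalse b s c2 t s' c1)
  then show ?case by (metis exec_CondE)
next
  case (WhileFalse b s c)
  then show ?case by (metis exec_WhileE)
next
  case (WhileTrue b s c t1 s' t2 s2)
  then show ?case by (metis exec_WhileE)
qed (auto elim: exec_SkipE exec_AssignE exec_PutE exec_CheckE)

definition input_store :: "nat \<Rightarrow> nat \<Rightarrow> nat \<Rightarrow> store" where
  "input_store m n k =
     \<lparr>vars = (\<lambda>_. 0)(''m'' := m, ''n'' := n, ''k'' := k), arrs = (\<lambda>_ _. 0)\<rparr>"

text \<open>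
  A program answers with \<open>found = 0\<close> if it claims that there is no valid flow diagram. Otherwise
  the output is the diagram with nodes \<open>0, \<dots>, nodes - 1\<close>, source \<open>0\<close> and sink \<open>1\<close>,
  whose arcs are the pairs \<open>(tail[j], head[j])\<close> for \<open>j < arcs\<close>.
\<close>

definition found :: "store \<Rightarrow> bool" where
  "found s \<longleftrightarrow> vars s ''found'' \<noteq> 0"

definition output_diagram :: "store \<Rightarrow> flow_diagram" where
  "output_diagram s =
     \<lparr>nodes = {..<vars s ''nodes''},
      arcs = {(arrs s ''tail'' j, arrs s ''head'' j) | j. j < vars s ''arcs''},
      source = 0, sink = 1, label = arrs s ''label''\<rparr>"

definition correct_answer :: "'s list list \<Rightarrow> 's criterion list \<Rightarrow> store \<Rightarrow> bool" where
  "correct_answer \<tau>s Cs s \<longleftrightarrow>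
     (if \<exists>F. valid_flow_diagram \<tau>s Cs F
      then found s \<and> minimum_flow_diagram \<tau>s Cs (output_diagram s)
      else \<not> found s)"

end

theory Submission
  imports Defs "HOL-Library.Nat_Bijection"
begin

text \<open>
  Cutting every sequence after a prefix gives a vector in \<open>{0..n}\<^sup>m\<close>. Ordering the inner nodes of a
  valid flow diagram topologically turns it into a path from the zero vector to \<open>(n, \<dots>, n)\<close>
  with one step per node, a step from \<open>x\<close> to \<open>y\<close> being allowed if some criterion is fulfilled
  by the segments between \<open>x\<close> and \<open>y\<close>; conversely every such path yields a flow diagram. So a
  minimum flow diagram is a shortest path.

  There are too many pairs \<open>(x, y)\<close> to check all of them. Fix all coordinates of \<open>x\<close> and \<open>y\<close>
  except number \<open>0\<close> (a pair of rows). By monotonicity the columns \<open>a < b\<close> from which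
  column \<open>b\<close> can be reached form an interval \<open>{l..<b}\<close> whose left end \<open>l\<close> grows with \<open>b\<close>, so two
  pointers find all intervals with \<open>O(n)\<close> checks per criterion. Since a segment must not shrink
  to the empty one, the distance is not monotone in \<open>a\<close>; its minimum over the moving interval is
  maintained in a monotone deque. Columns \<open>a = b\<close> are checked separately.

  The pairs of rows are enumerated by an odometer with amortised constant cost per step, in an order
  in which the steps into a row precede the steps out of it.
\<close>

text \<open>A single sweep suffices because a vector is never improved after a nontrivial step out
  of it has been processed. Each pair of entries \<open>a \<le> b\<close> is the digit
  \<open>triangle b + a\<close>; for \<open>x \<le> y \<le> z\<close> the digits of
  \<open>(x, y)\<close> are at most those of \<open>(y, z)\<close>, and within one pair of rows the
  target column breaks ties. So this is dynamic programming on an acyclic graph whose edges are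
  found on the way. The first term of the time bound counts
  \<open>triangle (n + 1) ^ (m - 1) \<le> (n + 1) ^ (2 * m - 2)\<close> pairs of rows, each with
  \<open>O(n + 1)\<close> searches through \<open>k\<close> criteria. Pointers and odometer are paid
  for by potentials, which appear in the specifications as additive terms on both sides of an
  inequality between times. The second term pays for the output: codes strictly increase along a
  shortest path, so it has fewer than \<open>(n + 1) ^ m\<close> steps, each costing
  \<open>O(m)\<close> plus digit extractions that telescope to \<open>m * n\<close>.\<close>

section \<open>Positional numerals and triangular numbers\<close>

lemma sum_upd:
  fixes f g :: "nat \<Rightarrow> nat"
  assumes "i < r" and "\<And>j. j < r \<Longrightarrow> j \<noteq> i \<Longrightarrow> f j = g j"
  shows "(\<Sum>j<r. f j) + g i = (\<Sum>j<r. g j) + f i"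
proof -
  have "(\<Sum>j<r. f j) = f i + (\<Sum>j\<in>{..<r}-{i}. f j)" "(\<Sum>j<r. g j) = g i + (\<Sum>j\<in>{..<r}-{i}. g j)"
    using assms(1) by (simp_all add: sum.remove)
  moreover have "(\<Sum>j\<in>{..<r}-{i}. f j) = (\<Sum>j\<in>{..<r}-{i}. g j)"
    using assms(2) by (intro sum.cong) auto
  ultimately show ?thesis by simp
qed

lemma positional_less:
  fixes d :: "nat \<Rightarrow> nat"
  assumes "\<And>i. i < r \<Longrightarrow> d i < b"
  shows "(\<Sum>i<r. d i * b ^ i) < b ^ r"
  using assms
proof (induction r)
  case (Suc r)
  have "d r \<le> b - 1" using Suc.prems[of r] by simp
  then have "d r * b ^ r \<le> (b - 1) * b ^ r" by (rule mult_right_mono) simp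
  moreover have "(\<Sum>i<r. d i * b ^ i) < b ^ r" using Suc by simp
  moreover have "b ^ r + (b - 1) * b ^ r = b ^ Suc r" using Suc.prems[of r] by (cases b) auto
  ultimately show ?case unfolding sum.lessThan_Suc by linarith
qed simp

lemma positional_inj:
  fixes d e :: "nat \<Rightarrow> nat"
  assumes "\<And>i. i < r \<Longrightarrow> d i < b" and "\<And>i. i < r \<Longrightarrow> e i < b"
    and "(\<Sum>i<r. d i * b ^ i) = (\<Sum>i<r. e i * b ^ i)" and "i < r"
  shows "d i = e i"
  using assms
proof (induction r arbitrary: i)
  case (Suc r)
  have l: "(\<Sum>i<r. d i * b ^ i) < b ^ r" "(\<Sum>i<r. e i * b ^ i) < b ^ r"
    using Suc.prems(1,2) by (auto intro!: positional_less)
  have eq: "(\<Sum>i<r. d i * b ^ i) + d r * b ^ r = (\<Sum>i<r. e i * b ^ i) + e r * b ^ r"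
    using Suc.prems(3) by simp
  have "((\<Sum>i<r. d i * b ^ i) + d r * b ^ r) div b ^ r = d r"
    "((\<Sum>i<r. e i * b ^ i) + e r * b ^ r) div b ^ r = e r"
    using l Suc.prems(1,2)[of r] by (simp_all add: div_plus_div_distrib_dvd_right)
  then have "d r = e r" using eq by simp
  show ?case
  proof (cases "i = r")
    case False
    have "(\<Sum>i<r. d i * b ^ i) = (\<Sum>i<r. e i * b ^ i)" using eq \<open>d r = e r\<close> by simp
    then show ?thesis using Suc.IH[of i] Suc.prems False by simp
  qed (use \<open>d r = e r\<close> in simp)
qed simp

lemma positional_max: "(\<Sum>i<r. n * Suc n ^ i) + 1 = Suc n ^ r"
  by (induction r) auto

lemma triangle_mono: "a \<le> b \<Longrightarrow> triangle a \<le> triangle b"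
  by (induction rule: dec_induct) auto

text \<open>In the coordinates \<open>(a, b - a)\<close> the formula is Cantor's pairing function
  \<open>prod_encode\<close>.\<close>

lemma triangle_pair_inj:
  assumes "a \<le> b" "a' \<le> b'" "triangle b + a = triangle b' + a'"
  shows "a = a' \<and> b = b'"
proof -
  have "prod_encode (a, b - a) = prod_encode (a', b' - a')"
    using assms by (simp add: prod_encode_def)
  then show ?thesis using assms(1,2) by (auto dest!: inj_onD[OF inj_prod_encode])
qed

section \<open>Frame conditions for programs\<close>

fun modified_vars :: "com \<Rightarrow> name set" where
  "modified_vars (Assign x e) = {x}"
| "modified_vars (Check x e lo hi) = {x}"
| "modified_vars (Seq c d) = modified_vars c \<union> modified_vars d"
| "modified_vars (Cond b c d) = modified_vars c \<union> modified_vars d"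
| "modified_vars (While b c) = modified_vars c"
| "modified_vars _ = {}"

fun modified_arrs :: "com \<Rightarrow> name set" where
  "modified_arrs (Put a e e') = {a}"
| "modified_arrs (Seq c d) = modified_arrs c \<union> modified_arrs d"
| "modified_arrs (Cond b c d) = modified_arrs c \<union> modified_arrs d"
| "modified_arrs (While b c) = modified_arrs c"
| "modified_arrs _ = {}"

lemma vars_set_var[simp]: "vars (set_var x c s) = (vars s)(x := c)"
  and arrs_set_var[simp]: "arrs (set_var x c s) = arrs s"
  by (auto simp: set_var_def)

lemma vars_set_arr[simp]: "vars (set_arr a i c s) = vars s"
  and arrs_set_arr[simp]: "arrs (set_arr a i c s) = (arrs s)(a := (arrs s a)(i := c))"
  by (auto simp: set_arr_def)

text \<open>Frame rule: fed into \<open>wp_unmodified\<close> and \<open>wp_While\<close>, it lets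
  an invariant speak only about what a program writes.\<close>

lemma exec_unmodified:
  assumes "exec \<tau>s Cs q c s t s'"
  shows "(\<forall>x. x \<notin> modified_vars c \<longrightarrow> vars s' x = vars s x) \<and>
    (\<forall>a. a \<notin> modified_arrs c \<longrightarrow> arrs s' a = arrs s a)"
  using assms by induction auto

declare triangle_Suc[simp del]

text \<open>Used to locate the \<open>j\<close>-th segment of a sequence: the segments before it are
  precisely those cut off by earlier steps of the path, so its starting position can be read off
  from the path.\<close>

lemma take_filter_upt:
  assumes "j < length (filter P [0..<r])"
  shows "take j (filter P [0..<r]) = filter P [0..<filter P [0..<r] ! j] \<and>
    filter P [0..<r] ! j < r \<and> P (filter P [0..<r] ! j)"
  using assms
proof (induction r)
  case (Suc r)
  show ?case
  proof (cases "j < length (filter P [0..<r])")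
    case True
    then show ?thesis using Suc.IH by (auto simp: nth_append)
  next
    case False
    then show ?thesis using Suc.prems by (auto simp: nth_append split: if_splits)
  qed
qed simp

lemma length_concat_take:
  "l \<le> length xs \<Longrightarrow> length (concat (take l xs)) = (\<Sum>e<l. length (xs ! e))"
  by (induction l) (simp_all add: take_Suc_conv_app_nth)

section \<open>The program\<close>

text \<open>
  A vector \<open>x\<close> is stored as the number \<open>\<Sum>i<m. x i * (n + 1) ^ i\<close>, with the powers in \<open>st\<close>. \<open>D\<close> is one
  more than the distance from the origin and \<open>0\<close> if no path has been found; \<open>pr\<close> and \<open>lb\<close>
  hold the predecessor and the criterion of the last step. \<open>lo\<close> and \<open>hi\<close> are the two current rows,
  \<open>bs\<close> and \<open>bt\<close> the codes of their columns \<open>0\<close>, and \<open>off[i]\<close> is \<open>lo[i] * st[i]\<close>. The deque occupies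
  \<open>q[h], \<dots>, q[t - 1]\<close>. The output numbers the node of the step into \<open>x\<close> by \<open>D x\<close>, and
  \<open>nx[i]\<close> is the earliest node found so far on the path of sequence \<open>i\<close>.
\<close>

definition search_cmd :: com where
  "search_cmd = Seq (Assign ''ok'' (N 0)) (Seq (Assign ''c'' (N 0))
     (While (Conj (Less (V ''c'') (V ''k'')) (Equal (V ''ok'') (N 0)))
       (Seq (Check ''ok'' (V ''c'') ''lo'' ''hi'')
         (Cond (Equal (V ''ok'') (N 0)) (Assign ''c'' (Plus (V ''c'') (N 1))) Skip))))"

text \<open>Tests have no disjunction, so "the target is unreached or would improve" is a negated
  conjunction. An unreached source has value \<open>0\<close> and must be excluded before
  comparing.\<close>

definition relax_cmd :: com where
  "relax_cmd = Seq (Assign ''v'' (Plus (V ''bt'') (V ''y'')))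
     (Cond (Conj (Neg (Equal (Get ''D'' (V ''u'')) (N 0)))
        (Neg (Conj (Neg (Equal (Get ''D'' (V ''v'')) (N 0)))
           (Neg (Less (Plus (Get ''D'' (V ''u'')) (N 1)) (Get ''D'' (V ''v'')))))))
      (Seq (Put ''D'' (V ''v'') (Plus (Get ''D'' (V ''u'')) (N 1)))
        (Seq (Put ''pr'' (V ''v'') (V ''u'')) (Put ''lb'' (V ''v'') (V ''c''))))
      Skip)"

text \<open>Every round either moves \<open>l\<close> or is the last, so over one pair of rows the
  searches number at most the total movement of \<open>l\<close> plus one per column. On success
  \<open>c\<close> holds a criterion for the step from column \<open>l\<close>.\<close>

definition advance_cmd :: com where
  "advance_cmd = While (Conj (Less (V ''l'') (V ''y'')) (Equal (V ''ok'') (N 0)))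
     (Seq (Put ''lo'' (N 0) (V ''l'')) (Seq (Put ''hi'' (N 0) (V ''y'')) (Seq search_cmd
       (Cond (Equal (V ''ok'') (N 0)) (Assign ''l'' (Plus (V ''l'') (N 1))) Skip))))"

definition pop_front_cmd :: com where
  "pop_front_cmd = While (Conj (Less (V ''h'') (V ''t'')) (Less (Get ''q'' (V ''h'')) (Plus (V ''bs'') (V ''l''))))
     (Assign ''h'' (Plus (V ''h'') (N 1)))"

text \<open>Entries of equal value are removed too, since the newer one stays in the window
  longer.\<close>

definition pop_back_cmd :: com where
  "pop_back_cmd = While (Conj (Less (V ''h'') (V ''t''))
       (Neg (Less (Get ''D'' (Get ''q'' (Minus (V ''t'') (N 1)))) (Get ''D'' (V ''z'')))))
     (Assign ''t'' (Minus (V ''t'') (N 1)))"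

definition push_cmd :: com where
  "push_cmd = Seq (Assign ''z'' (Plus (V ''bs'') (V ''y'')))
     (Cond (Equal (Get ''D'' (V ''z'')) (N 0)) Skip
       (Seq pop_back_cmd (Seq (Put ''q'' (V ''t'') (V ''z'')) (Assign ''t'' (Plus (V ''t'') (N 1))))))"

definition same_column_cmd :: com where
  "same_column_cmd = Seq (Put ''lo'' (N 0) (V ''y'')) (Seq (Put ''hi'' (N 0) (V ''y'')) (Seq search_cmd
     (Cond (Equal (V ''ok'') (N 0)) Skip (Seq (Assign ''u'' (Plus (V ''bs'') (V ''y''))) relax_cmd))))"

definition window_cmd :: com where
  "window_cmd = Seq (Assign ''ok'' (N 0)) (Seq advance_cmd (Seq pop_front_cmd
     (Cond (Less (V ''h'') (V ''t'')) (Seq (Assign ''u'' (Get ''q'' (V ''h''))) relax_cmd) Skip)))"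

text \<open>The order matters. Column \<open>y\<close> is pushed only after it has served as target,
  so the window for target \<open>y\<close> holds columns below \<open>y\<close>; and if the two
  rows coincide, the pushed vector is the target itself, whose value has to be relaxed
  first.\<close>

definition column_cmd :: com where
  "column_cmd = Seq same_column_cmd (Seq window_cmd (Seq push_cmd (Assign ''y'' (Plus (V ''y'') (N 1)))))"

definition process_cmd :: com where
  "process_cmd = Seq (Assign ''y'' (N 0)) (Seq (Assign ''l'' (N 0)) (Seq (Assign ''h'' (N 0)) (Seq (Assign ''t'' (N 0))
     (While (Less (V ''y'') (Plus (V ''n'') (N 1))) column_cmd))))"

text \<open>Since \<open>lo[i] \<le> hi[i] \<le> n\<close>, the test \<open>lo[i] = n\<close>
  recognises the largest digit \<open>(n, n)\<close>, which rolls over to \<open>(0, 0)\<close>. As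
  then \<open>hi[i] = lo[i]\<close>, the same \<open>off[i]\<close> is subtracted from both
  codes.\<close>

definition carry_cmd :: com where
  "carry_cmd = While (Conj (Less (V ''i'') (V ''m'')) (Equal (Get ''lo'' (V ''i'')) (V ''n'')))
     (Seq (Assign ''bs'' (Minus (V ''bs'') (Get ''off'' (V ''i''))))
     (Seq (Assign ''bt'' (Minus (V ''bt'') (Get ''off'' (V ''i''))))
     (Seq (Put ''off'' (V ''i'') (N 0)) (Seq (Put ''lo'' (V ''i'') (N 0)) (Seq (Put ''hi'' (V ''i'') (N 0))
     (Assign ''i'' (Plus (V ''i'') (N 1))))))))"

definition next_pair_cmd :: com where
  "next_pair_cmd = Seq (Assign ''i'' (N 1)) (Seq carry_cmd
     (Cond (Less (V ''i'') (V ''m''))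
       (Cond (Less (Get ''lo'' (V ''i'')) (Get ''hi'' (V ''i'')))
         (Seq (Put ''lo'' (V ''i'') (Plus (Get ''lo'' (V ''i'')) (N 1)))
         (Seq (Put ''off'' (V ''i'') (Plus (Get ''off'' (V ''i'')) (Get ''st'' (V ''i''))))
         (Assign ''bs'' (Plus (V ''bs'') (Get ''st'' (V ''i''))))))
         (Seq (Assign ''bs'' (Minus (V ''bs'') (Get ''off'' (V ''i''))))
         (Seq (Put ''off'' (V ''i'') (N 0)) (Seq (Put ''lo'' (V ''i'') (N 0))
         (Seq (Put ''hi'' (V ''i'') (Plus (Get ''hi'' (V ''i'')) (N 1)))
         (Assign ''bt'' (Plus (V ''bt'') (Get ''st'' (V ''i'')))))))))
       (Assign ''go'' (N 0))))"

text \<open>Without criteria the first term of the time bound vanishes, so the enumeration of row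
  pairs must not even start; the initial table is then already complete because there are no
  steps.\<close>

definition search_all_cmd :: com where
  "search_all_cmd = Cond (Less (N 0) (V ''k''))
     (Seq (Assign ''go'' (N 1)) (While (Equal (V ''go'') (N 1)) (Seq process_cmd next_pair_cmd))) Skip"

definition strides_cmd :: com where
  "strides_cmd = Seq (Put ''st'' (N 0) (N 1)) (Seq (Assign ''i'' (N 0))
     (While (Less (V ''i'') (V ''m''))
       (Seq (Assign ''a'' (N 0)) (Seq (Assign ''j'' (N 0))
       (Seq (While (Less (V ''j'') (Plus (V ''n'') (N 1)))
         (Seq (Assign ''a'' (Plus (V ''a'') (Get ''st'' (V ''i'')))) (Assign ''j'' (Plus (V ''j'') (N 1)))))
       (Seq (Assign ''i'' (Plus (V ''i'') (N 1))) (Put ''st'' (V ''i'') (V ''a''))))))))"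

definition emit_cmd :: "aexp \<Rightarrow> com" where
  "emit_cmd u = Seq (Put ''tail'' (V ''arcs'') u) (Seq (Put ''head'' (V ''arcs'') (Get ''nx'' (V ''i'')))
     (Assign ''arcs'' (Plus (V ''arcs'') (N 1))))"

text \<open>Repeated subtraction reads the digits of \<open>d\<close>, the code of the difference of
  two vectors, from the most significant one down. Its cost is the digit sum. Only sequences with a
  nonzero digit pass through node \<open>w\<close>.\<close>

definition split_step_cmd :: com where
  "split_step_cmd = Seq (Assign ''i'' (V ''m'')) (While (Less (N 0) (V ''i''))
     (Seq (Assign ''i'' (Minus (V ''i'') (N 1)))
       (Cond (Less (V ''d'') (Get ''st'' (V ''i''))) Skip
         (Seq (emit_cmd (V ''w'')) (Seq (Put ''nx'' (V ''i'') (V ''w''))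
           (While (Neg (Less (V ''d'') (Get ''st'' (V ''i'')))) (Assign ''d'' (Minus (V ''d'') (Get ''st'' (V ''i''))))))))))"

definition trace_cmd :: com where
  "trace_cmd = While (Less (N 0) (V ''f''))
     (Seq (Assign ''w'' (Get ''D'' (V ''f''))) (Seq (Assign ''d'' (Minus (V ''f'') (Get ''pr'' (V ''f''))))
     (Seq (Put ''label'' (V ''w'') (Get ''lb'' (V ''f''))) (Seq (Assign ''f'' (Get ''pr'' (V ''f''))) split_step_cmd))))"

text \<open>\<open>st[m] - 1\<close> is the code of \<open>(n, \<dots>, n)\<close>. Since
  \<open>D\<close> exceeds the distance by one, inner nodes are numbered from \<open>2\<close> on,
  which leaves \<open>0\<close> and \<open>1\<close> for source and sink, and \<open>D + 1\<close>
  counts all nodes.\<close>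

definition output_cmd :: com where
  "output_cmd = Seq (Assign ''f'' (Minus (Get ''st'' (V ''m'')) (N 1)))
     (Cond (Equal (Get ''D'' (V ''f'')) (N 0)) Skip
       (Seq (Assign ''found'' (N 1)) (Seq (Assign ''nodes'' (Plus (Get ''D'' (V ''f'')) (N 1)))
       (Seq (Assign ''arcs'' (N 0)) (Seq (Assign ''i'' (N 0))
       (Seq (While (Less (V ''i'') (V ''m'')) (Seq (Put ''nx'' (V ''i'') (N 1)) (Assign ''i'' (Plus (V ''i'') (N 1)))))
       (Seq trace_cmd (Seq (Assign ''i'' (N 0))
       (While (Less (V ''i'') (V ''m'')) (Seq (emit_cmd (N 0)) (Assign ''i'' (Plus (V ''i'') (N 1)))))))))))))"

definition flow_program :: com where
  "flow_program = Seq strides_cmd (Seq (Put ''D'' (N 0) (N 1)) (Seq search_all_cmd output_cmd))"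

lemma mod_search[simp]: "modified_vars search_cmd = {''ok'', ''c''}" "modified_arrs search_cmd = {}"
  by (auto simp: search_cmd_def)

lemma mod_relax[simp]: "modified_vars relax_cmd = {''v''}" "modified_arrs relax_cmd = {''D'', ''pr'', ''lb''}"
  by (auto simp: relax_cmd_def)

lemma mod_advance[simp]: "modified_vars advance_cmd = {''ok'', ''c'', ''l''}" "modified_arrs advance_cmd = {''lo'', ''hi''}"
  by (auto simp: advance_cmd_def)

lemma mod_pop_front[simp]: "modified_vars pop_front_cmd = {''h''}" "modified_arrs pop_front_cmd = {}"
  by (auto simp: pop_front_cmd_def)

lemma mod_pop_back[simp]: "modified_vars pop_back_cmd = {''t''}" "modified_arrs pop_back_cmd = {}"
  by (auto simp: pop_back_cmd_def)

lemma mod_push[simp]: "modified_vars push_cmd = {''t'', ''z''}" "modified_arrs push_cmd = {''q''}"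
  by (auto simp: push_cmd_def)

lemma mod_same_column[simp]: "modified_vars same_column_cmd = {''ok'', ''c'', ''u'', ''v''}"
  "modified_arrs same_column_cmd = {''lo'', ''hi'', ''D'', ''pr'', ''lb''}"
  by (auto simp: same_column_cmd_def)

lemma mod_window[simp]: "modified_vars window_cmd = {''ok'', ''c'', ''l'', ''h'', ''u'', ''v''}"
  "modified_arrs window_cmd = {''lo'', ''hi'', ''D'', ''pr'', ''lb''}"
  by (auto simp: window_cmd_def)

lemma mod_column[simp]:
  "modified_vars column_cmd = {''ok'', ''c'', ''l'', ''u'', ''v'', ''h'', ''t'', ''z'', ''y''}"
  "modified_arrs column_cmd = {''lo'', ''hi'', ''D'', ''pr'', ''lb'', ''q''}"
  by (auto simp: column_cmd_def)

lemma mod_process[simp]: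
  "modified_vars process_cmd = {''ok'', ''c'', ''l'', ''u'', ''v'', ''h'', ''t'', ''z'', ''y''}"
  "modified_arrs process_cmd = {''lo'', ''hi'', ''D'', ''pr'', ''lb'', ''q''}"
  by (auto simp: process_cmd_def)

lemma mod_carry[simp]: "modified_vars carry_cmd = {''bs'', ''bt'', ''i''}" "modified_arrs carry_cmd = {''off'', ''lo'', ''hi''}"
  by (auto simp: carry_cmd_def)

lemma mod_next_pair[simp]: "modified_vars next_pair_cmd = {''bs'', ''bt'', ''i'', ''go''}"
  "modified_arrs next_pair_cmd = {''off'', ''lo'', ''hi''}"
  by (auto simp: next_pair_cmd_def)

lemma mod_strides[simp]: "modified_vars strides_cmd = {''i'', ''a'', ''j''}" "modified_arrs strides_cmd = {''st''}"
  by (auto simp: strides_cmd_def)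

lemma mod_emit[simp]: "modified_vars (emit_cmd u) = {''arcs''}" "modified_arrs (emit_cmd u) = {''tail'', ''head''}"
  by (auto simp: emit_cmd_def)

lemma mod_split_step[simp]: "modified_vars split_step_cmd = {''i'', ''arcs'', ''d''}"
  "modified_arrs split_step_cmd = {''tail'', ''head'', ''nx''}"
  by (auto simp: split_step_cmd_def)

lemma mod_trace[simp]: "modified_vars trace_cmd = {''w'', ''d'', ''f'', ''i'', ''arcs''}"
  "modified_arrs trace_cmd = {''label'', ''tail'', ''head'', ''nx''}"
  by (auto simp: trace_cmd_def)

section \<open>The monotone deque\<close>

text \<open>The last clause allows domination by a value \<open>w > 0\<close> that is about to be appended.\<close>

definition deque :: "(nat \<Rightarrow> nat) \<Rightarrow> (nat \<Rightarrow> nat) \<Rightarrow> nat \<Rightarrow> nat \<Rightarrow> nat \<Rightarrow> nat \<Rightarrow> nat \<Rightarrow> nat \<Rightarrow> bool" where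
  "deque D p h t b l y w \<longleftrightarrow> h \<le> t \<and>
     (\<forall>j. h \<le> j \<and> j < t \<longrightarrow> p j < b + y \<and> D (p j) \<noteq> 0) \<and>
     (\<forall>i j. h \<le> i \<and> i < j \<and> j < t \<longrightarrow> D (p i) \<le> D (p j)) \<and>
     (\<forall>a. l \<le> a \<and> a < y \<and> D (b + a) \<noteq> 0 \<longrightarrow>
        (\<exists>j. h \<le> j \<and> j < t \<and> b + a \<le> p j \<and> D (p j) \<le> D (b + a)) \<or> 0 < w \<and> w \<le> D (b + a))"

lemma dequeI:
  assumes "h \<le> t" "\<And>j. h \<le> j \<Longrightarrow> j < t \<Longrightarrow> p j < b + y \<and> D (p j) \<noteq> 0"
    and "\<And>i j. h \<le> i \<Longrightarrow> i < j \<Longrightarrow> j < t \<Longrightarrow> D (p i) \<le> D (p j)"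
    and "\<And>a. l \<le> a \<Longrightarrow> a < y \<Longrightarrow> D (b + a) \<noteq> 0 \<Longrightarrow>
      (\<exists>j. h \<le> j \<and> j < t \<and> b + a \<le> p j \<and> D (p j) \<le> D (b + a)) \<or> 0 < w \<and> w \<le> D (b + a)"
  shows "deque D p h t b l y w"
  using assms unfolding deque_def by simp

lemma dequeD:
  assumes "deque D p h t b l y w"
  shows "h \<le> t" "\<And>j. h \<le> j \<Longrightarrow> j < t \<Longrightarrow> p j < b + y \<and> D (p j) \<noteq> 0"
    and "\<And>i j. h \<le> i \<Longrightarrow> i < j \<Longrightarrow> j < t \<Longrightarrow> D (p i) \<le> D (p j)"
    and "\<And>a. l \<le> a \<Longrightarrow> a < y \<Longrightarrow> D (b + a) \<noteq> 0 \<Longrightarrow>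
      (\<exists>j. h \<le> j \<and> j < t \<and> b + a \<le> p j \<and> D (p j) \<le> D (b + a)) \<or> 0 < w \<and> w \<le> D (b + a)"
  using assms unfolding deque_def by simp_all

lemma deque_advance:
  assumes "deque D p h t b l y w" "l \<le> l'"
  shows "deque D p h t b l' y w"
  using assms(2) by (intro dequeI dequeD[OF assms(1)]) simp_all

text \<open>A column of the window is dominated only by entries at or after it, and the removed
  entry lies before the window.\<close>

lemma deque_pop_front:
  assumes d: "deque D p h t b l y w" and "h < t" "p h < b + l"
  shows "deque D p (Suc h) t b l y w"
proof (rule dequeI)
  fix a assume a: "l \<le> a" "a < y" "D (b + a) \<noteq> 0"
  have "\<exists>j. Suc h \<le> j \<and> j < t \<and> b + a \<le> p j \<and> D (p j) \<le> D (b + a)"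
    if "h \<le> j" "j < t" "b + a \<le> p j" "D (p j) \<le> D (b + a)" for j
  proof -
    have "j \<noteq> h" using that a assms(3) by auto
    then show ?thesis using that by (intro exI[of _ j]) auto
  qed
  then show "(\<exists>j. Suc h \<le> j \<and> j < t \<and> b + a \<le> p j \<and> D (p j) \<le> D (b + a)) \<or> 0 < w \<and> w \<le> D (b + a)"
    using dequeD(4)[OF d a] by blast
qed (use assms dequeD(2,3)[OF d] in simp_all)

text \<open>Whatever the removed entry dominated is dominated by the value \<open>w\<close> about to
  be appended; the last clause of \<open>deque\<close> exists for this intermediate state.\<close>

lemma deque_pop_back:
  assumes d: "deque D p h t b l y w" and "h < t" "0 < w" "w \<le> D (p (t - 1))"
  shows "deque D p h (t - 1) b l y w"
proof (rule dequeI)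
  fix a assume a: "l \<le> a" "a < y" "D (b + a) \<noteq> 0"
  have "(\<exists>j. h \<le> j \<and> j < t - 1 \<and> b + a \<le> p j \<and> D (p j) \<le> D (b + a)) \<or> 0 < w \<and> w \<le> D (b + a)"
    if "h \<le> j" "j < t" "b + a \<le> p j" "D (p j) \<le> D (b + a)" for j
  proof (cases "j = t - 1")
    case True then show ?thesis using that assms(3,4) by simp
  next
    case False then show ?thesis using that by (intro disjI1 exI[of _ j]) auto
  qed
  then show "(\<exists>j. h \<le> j \<and> j < t - 1 \<and> b + a \<le> p j \<and> D (p j) \<le> D (b + a)) \<or> 0 < w \<and> w \<le> D (b + a)"
    using dequeD(4)[OF d a] by blast
qed (use assms dequeD(2,3)[OF d] in simp_all)

text \<open>The new entry is the rightmost column and has the value that was promised as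
  \<open>w\<close>, so it takes over from the provisional clause and \<open>w\<close> returns to
  \<open>0\<close>.\<close>

lemma deque_push:
  assumes d: "deque D p h t b l y (D (b + y))" and D: "D (b + y) \<noteq> 0"
    and last: "h = t \<or> D (p (t - 1)) \<le> D (b + y)"
  shows "deque D (p(t := b + y)) h (Suc t) b l (Suc y) 0"
proof (rule dequeI)
  have le: "D (p j) \<le> D (b + y)" if "h \<le> j" "j < t" for j
  proof (cases "j = t - 1")
    case False
    then have "D (p j) \<le> D (p (t - 1))" using dequeD(3)[OF d, of j "t - 1"] that by simp
    then show ?thesis using last that by auto
  qed (use last that in auto)
  show "D ((p(t := b + y)) i) \<le> D ((p(t := b + y)) j)" if "h \<le> i" "i < j" "j < Suc t" for i j
    using dequeD(3)[OF d, of i j] le that by (cases "j = t") simp_all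
  show "(\<exists>j. h \<le> j \<and> j < Suc t \<and> b + a \<le> (p(t := b + y)) j \<and> D ((p(t := b + y)) j) \<le> D (b + a)) \<or>
      0 < (0::nat) \<and> 0 \<le> D (b + a)"
    if a: "l \<le> a" "a < Suc y" "D (b + a) \<noteq> 0" for a
  proof (cases "D (b + y) \<le> D (b + a)")
    case True
    then show ?thesis using a dequeD(1)[OF d] by (intro disjI1 exI[of _ t]) simp
  next
    case False
    then have "a < y" using a by (cases "a = y") auto
    then obtain j where "h \<le> j" "j < t" "b + a \<le> p j" "D (p j) \<le> D (b + a)"
      using dequeD(4)[OF d a(1) _ a(3)] False by blast
    then show ?thesis by (intro disjI1 exI[of _ j]) simp
  qed
  show "(p(t := b + y)) j < b + Suc y \<and> D ((p(t := b + y)) j) \<noteq> 0" if "h \<le> j" "j < Suc t" for j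
    using dequeD(2)[OF d, of j] D that by (cases "j = t") auto
qed (use dequeD(1)[OF d] in simp)

lemma deque_skip:
  assumes d: "deque D p h t b l y 0" and "D (b + y) = 0"
  shows "deque D p h t b l (Suc y) 0"
proof (rule dequeI)
  fix a assume a: "l \<le> a" "a < Suc y" "D (b + a) \<noteq> 0"
  then have "a < y" using assms(2) by (cases "a = y") auto
  then show "(\<exists>j. h \<le> j \<and> j < t \<and> b + a \<le> p j \<and> D (p j) \<le> D (b + a)) \<or> 0 < (0::nat) \<and> 0 \<le> D (b + a)"
    using dequeD(4)[OF d a(1) _ a(3)] by blast
next
  show "p j < b + Suc y \<and> D (p j) \<noteq> 0" if "h \<le> j" "j < t" for j
    using dequeD(2)[OF d that] by simp
qed (use dequeD(1,3)[OF d] in simp_all)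

lemma deque_append_intro: "deque D p h t b l y 0 \<Longrightarrow> deque D p h t b l y w"
  unfolding deque_def by simp

text \<open>Relaxing changes only the value of the target, whose code is at least
  \<open>b + y\<close>, so the deque survives every relaxation.\<close>

lemma deque_cong:
  assumes "deque D p h t b l y w" "\<And>z. z < b + y \<Longrightarrow> D' z = D z"
  shows "deque D' p h t b l y w"
proof (rule dequeI)
  have D': "D' (p j) = D (p j)" if "h \<le> j" "j < t" for j
    using dequeD(2)[OF assms(1) that] assms(2) by blast
  note d = dequeD[OF assms(1)]
  show "h \<le> t" by (rule d)
  show "p j < b + y \<and> D' (p j) \<noteq> 0" if "h \<le> j" "j < t" for j using d(2) D' that by simp
  show "D' (p i) \<le> D' (p j)" if "h \<le> i" "i < j" "j < t" for i j using d(3) D' that by simp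
  show "(\<exists>j. h \<le> j \<and> j < t \<and> b + a \<le> p j \<and> D' (p j) \<le> D' (b + a)) \<or> 0 < w \<and> w \<le> D' (b + a)"
    if "l \<le> a" "a < y" "D' (b + a) \<noteq> 0" for a
  proof -
    have "D' (b + a) = D (b + a)" using assms(2) that by simp
    then show ?thesis using d(4)[of a] D' that by auto
  qed
qed

lemma deque_front:
  assumes d: "deque D p h t b l y 0" and "l \<le> a" "a < y" "D (b + a) \<noteq> 0"
  shows "h < t \<and> D (p h) \<le> D (b + a)"
proof -
  obtain j where j: "h \<le> j" "j < t" "D (p j) \<le> D (b + a)"
    using dequeD(4)[OF d assms(2-)] by blast
  then have "D (p h) \<le> D (p j)" using dequeD(3)[OF d, of h j] by (cases "h = j") auto
  with j show ?thesis by simp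
qed

section \<open>Correctness and running time\<close>

lemma row_le:
  fixes X X' :: "nat \<Rightarrow> nat"
  assumes "\<And>i. i > 0 \<Longrightarrow> X i \<le> X' i" "a \<le> b"
  shows "X(0 := a) \<le> X'(0 := b)"
proof (rule le_funI)
  show "(X(0 := a)) i \<le> (X'(0 := b)) i" for i using assms by (cases "i = 0") simp_all
qed

definition lowered :: "nat \<Rightarrow> (nat \<Rightarrow> nat) \<Rightarrow> (nat \<Rightarrow> nat) \<Rightarrow> bool" where
  "lowered v D D' \<longleftrightarrow> (\<forall>z. z \<noteq> v \<longrightarrow> D' z = D z) \<and> (\<forall>z. D z \<noteq> 0 \<longrightarrow> D' z \<noteq> 0 \<and> D' z \<le> D z)"

lemma lowered_refl: "lowered v D D" by (simp add: lowered_def)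

definition arc_set :: "store \<Rightarrow> (nat \<times> nat) set" where
  "arc_set s = {(arrs s ''tail'' j, arrs s ''head'' j) | j. j < vars s ''arcs''}"

lemma arc_set_emit:
  "arc_set (set_var ''arcs'' (Suc (vars s ''arcs'')) (set_arr ''head'' (vars s ''arcs'') v
      (set_arr ''tail'' (vars s ''arcs'') u s))) = insert (u, v) (arc_set s)"
proof -
  have "{j. j < Suc (vars s ''arcs'')} = insert (vars s ''arcs'') {j. j < vars s ''arcs''}" by auto
  then show ?thesis unfolding arc_set_def setcompr_eq_image by (auto simp: image_iff)
qed

lemma arc_set_cong: "vars s' ''arcs'' = vars s ''arcs'' \<Longrightarrow> arrs s' ''tail'' = arrs s ''tail'' \<Longrightarrow>
    arrs s' ''head'' = arrs s ''head'' \<Longrightarrow> arc_set s' = arc_set s"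
  by (simp add: arc_set_def)

text \<open>\<open>p e i\<close> is the cut of sequence \<open>i\<close> after \<open>e\<close>
  steps of the path, and a sequence visits the node of a step only if it advances there. The shift
  by \<open>2\<close> leaves room for source and sink; the start \<open>j\<close> is a parameter
  because the output is built from the end of the path.\<close>

definition route :: "(nat \<Rightarrow> nat \<Rightarrow> nat) \<Rightarrow> nat \<Rightarrow> nat \<Rightarrow> nat \<Rightarrow> nat list" where
  "route p r i j = map (\<lambda>e. e + 2) (filter (\<lambda>e. p e i < p (Suc e) i) [j..<r])"

lemma route_Suc: "j < r \<Longrightarrow> route p r i j =
    (if p j i < p (Suc j) i then (j + 2) # route p r i (Suc j) else route p r i (Suc j))"
  by (simp add: route_def upt_conv_Cons)

lemma route_set: "set (route p r i j) \<subseteq> {j + 2..<r + 2}"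
  by (auto simp: route_def)

lemma route_end: "route p r i r = []" by (simp add: route_def)

lemma hd_route: "hd (route p r i j @ [1]) = 1 \<or> hd (route p r i j @ [1]) \<in> {j + 2..<r + 2}"
  using route_set[of p r i j] by (cases "route p r i j") auto

lemma successively_superset:
  "successively (\<lambda>u v. (u, v) \<in> A) xs \<Longrightarrow> A \<subseteq> B \<Longrightarrow> successively (\<lambda>u v. (u, v) \<in> B) xs"
  by (erule successively_mono) auto

section \<open>Vectors, codes and admissible steps\<close>

locale flow_input =
  fixes \<tau>s :: "'s list list" and Cs :: "'s criterion list" and n q :: nat
  assumes nonempty: "\<tau>s \<noteq> []" and lengths: "\<And>\<tau>. \<tau> \<in> set \<tau>s \<Longrightarrow> length \<tau> = n"
    and monotone: "\<And>C. C \<in> set Cs \<Longrightarrow> monotone_decreasing \<tau>s C" and cost_pos: "q \<ge> 1"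
begin

abbreviation "m \<equiv> length \<tau>s"

abbreviation "k \<equiv> length Cs"

lemma m_pos: "m > 0" using nonempty by simp

definition vecs :: "(nat \<Rightarrow> nat) set" where
  "vecs = {x. (\<forall>i<m. x i \<le> n) \<and> (\<forall>i\<ge>m. x i = 0)}"

definition code :: "(nat \<Rightarrow> nat) \<Rightarrow> nat" where
  "code x = (\<Sum>i<m. x i * Suc n ^ i)"

definition corner :: "nat \<Rightarrow> nat" where
  "corner = (\<lambda>i. if i < m then n else 0)"

text \<open>The case \<open>x = y\<close> is included on purpose: it is a node visited by no
  sequence, whose criterion must hold for the empty set.\<close>

definition step :: "nat \<Rightarrow> (nat \<Rightarrow> nat) \<Rightarrow> (nat \<Rightarrow> nat) \<Rightarrow> bool" where
  "step c x y \<longleftrightarrow> c < k \<and> x \<in> vecs \<and> y \<in> vecs \<and> x \<le> y \<and> (Cs ! c) (checked_set \<tau>s x y)"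

lemma vecs_le: "x \<in> vecs \<Longrightarrow> x i \<le> n" by (cases "i < m") (auto simp: vecs_def)

lemma vecs_upd: "x \<in> vecs \<Longrightarrow> i < m \<Longrightarrow> a \<le> n \<Longrightarrow> x(i := a) \<in> vecs" by (auto simp: vecs_def)

lemma zero_vecs: "(\<lambda>_. 0) \<in> vecs" by (simp add: vecs_def)

lemma corner_vecs: "corner \<in> vecs" by (simp add: vecs_def corner_def)

lemma code_inj: "x \<in> vecs \<Longrightarrow> y \<in> vecs \<Longrightarrow> code x = code y \<Longrightarrow> x = y"
proof
  fix i assume "x \<in> vecs" "y \<in> vecs" "code x = code y"
  then show "x i = y i"
    using positional_inj[of m x "Suc n" y i]
    by (cases "i < m") (auto simp: code_def vecs_def less_Suc_eq_le)
qed

lemma code_mono: "x \<le> y \<Longrightarrow> code x \<le> code y"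
  by (auto simp: code_def le_fun_def intro!: sum_mono)

lemma code_upd: "i < m \<Longrightarrow> code (x(i := a)) + x i * Suc n ^ i = code x + a * Suc n ^ i"
  using sum_upd[of i m "\<lambda>j. (x(i := a)) j * Suc n ^ j" "\<lambda>j. x j * Suc n ^ j"]
  by (simp add: code_def)

lemma code_upd0: "code (x(0 := a)) = code (x(0 := 0)) + a"
  using code_upd[of 0 "x(0 := 0)" a] m_pos by simp

lemma code_zero: "code (\<lambda>_. 0) = 0" by (simp add: code_def)

lemma code_corner: "code corner + 1 = Suc n ^ m"
proof -
  have "code corner = (\<Sum>i<m. n * Suc n ^ i)" unfolding code_def corner_def by (intro sum.cong) auto
  then show ?thesis using positional_max[of n m] by simp
qed

lemma step_le: "step c x y \<Longrightarrow> x i \<le> y i" by (auto simp: step_def le_fun_def)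

lemma checked_set_subset:
  assumes "x \<in> vecs" "y \<in> vecs"
  shows "checked_set \<tau>s x y \<subseteq> segments_of \<tau>s"
proof -
  have 1: "\<exists>p r. \<tau>s ! i = p @ take (y i - x i) (drop (x i) (\<tau>s ! i)) @ r \<and> x i = length p"
    if "i < m" "x i < y i" for i
  proof -
    have len: "length (\<tau>s ! i) = n" using that lengths by simp
    have "\<tau>s ! i = take (x i) (\<tau>s ! i) @ take (y i - x i) (drop (x i) (\<tau>s ! i)) @
        drop (y i - x i) (drop (x i) (\<tau>s ! i))"
      by (simp only: append_take_drop_id)
    moreover have "x i = length (take (x i) (\<tau>s ! i))"
      using vecs_le[OF assms(1), of i] len by simp
    ultimately show ?thesis by blast
  qed
  have 2: "take (y i - x i) (drop (x i) (\<tau>s ! i)) \<noteq> []" if "i < m" "x i < y i" for i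
    using that lengths[of "\<tau>s ! i"] vecs_le[OF assms(2), of i] by simp
  show ?thesis
  proof
    fix \<sigma> assume "\<sigma> \<in> checked_set \<tau>s x y"
    then obtain i where i: "i < m" "x i < y i" "\<sigma> = (i, x i, take (y i - x i) (drop (x i) (\<tau>s ! i)))"
      unfolding checked_set_def by blast
    then show "\<sigma> \<in> segments_of \<tau>s"
      using 1[OF i(1,2)] 2[OF i(1,2)] unfolding segments_of_def by simp
  qed
qed

lemma checked_set_image: "checked_set \<tau>s x y =
    (\<lambda>i. (i, x i, take (y i - x i) (drop (x i) (\<tau>s ! i)))) ` {i. i < m \<and> x i < y i}"
  unfolding checked_set_def by (rule setcompr_eq_image)

text \<open>Monotonicity is applied with a map that changes only the segment of sequence
  \<open>0\<close>. Both column ranges are nonempty, so the image is exactly the smaller checked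
  set. With \<open>a' = b'\<close> that segment would disappear, which a monotone criterion need not
  tolerate.\<close>

lemma step_shrink:
  assumes st: "step c (x(0 := a)) (y(0 := b))" and "a \<le> a'" "a' < b'" "b' \<le> b"
  shows "step c (x(0 := a')) (y(0 := b'))"
proof -
  let ?S = "checked_set \<tau>s (x(0 := a)) (y(0 := b))" and ?S' = "checked_set \<tau>s (x(0 := a')) (y(0 := b'))"
  let ?w = "take (b' - a') (drop a' (\<tau>s ! 0))"
  define f where "f \<sigma> = (if fst \<sigma> = 0 then (0, a', ?w) else \<sigma>)" for \<sigma> :: "'s segment"
  have v: "x(0 := a) \<in> vecs" "y(0 := b) \<in> vecs" "x(0 := a) \<le> y(0 := b)" "c < k"
    and C: "(Cs ! c) ?S" using st by (auto simp: step_def)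
  have bn: "b \<le> n" using vecs_le[OF v(2), of 0] by simp
  have len: "length (\<tau>s ! 0) = n" using lengths nonempty by simp
  have "subsegment (f \<sigma>) \<sigma>" if "\<sigma> \<in> ?S" for \<sigma>
  proof (cases "fst \<sigma> = 0")
    case True
    with that have \<sigma>: "\<sigma> = (0, a, take (b - a) (drop a (\<tau>s ! 0)))" by (auto simp: checked_set_def)
    let ?v = "take (b - a) (drop a (\<tau>s ! 0))"
    have w: "take (b' - a') (drop (a' - a) ?v) = ?w"
      using assms(2-) by (simp add: drop_take)
    have "?v = take (a' - a) ?v @ take (b' - a') (drop (a' - a) ?v) @ drop (b' - a') (drop (a' - a) ?v)"
      by (simp only: append_take_drop_id)
    moreover have "a' = a + length (take (a' - a) ?v)"
      using assms(2-) bn len by simp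
    ultimately have ex: "\<exists>p r. ?v = p @ ?w @ r \<and> a' = a + length p"
      unfolding w by blast
    have "?w \<noteq> []" using assms(2-) bn len by simp
    with ex show ?thesis unfolding subsegment_def f_def \<sigma> prod.case fst_conv if_P[OF refl] by blast
  next
    case False
    with that have "snd (snd \<sigma>) \<noteq> []"
      using checked_set_subset[OF v(1,2)] by (fastforce simp: segments_of_def)
    with False show ?thesis
      by (auto simp: subsegment_def f_def split: prod.splits intro!: exI[of _ "[]"])
  qed
  moreover have "monotone_decreasing \<tau>s (Cs ! c)" using v monotone by simp
  ultimately have "(Cs ! c) (f ` ?S)"
    using C checked_set_subset[OF v(1,2)] unfolding monotone_decreasing_def by blast
  moreover have "f ` ?S = ?S'"
    unfolding checked_set_image image_image
  proof (rule image_cong)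
    show "{i. i < m \<and> (x(0 := a)) i < (y(0 := b)) i} = {i. i < m \<and> (x(0 := a')) i < (y(0 := b')) i}"
      using assms(2-) by auto
  qed (simp add: f_def)
  moreover have "x(0 := a') \<in> vecs" "y(0 := b') \<in> vecs"
    using vecs_upd[OF v(1), of 0 a'] vecs_upd[OF v(2), of 0 b'] assms(2-) bn m_pos by auto
  moreover have "x(0 := a') \<le> y(0 := b')"
    using v(3) assms(3) unfolding le_fun_def fun_upd_apply by (metis less_imp_le)
  ultimately show ?thesis using v(4) by (simp add: step_def)
qed

subsection \<open>Numbering of row pairs\<close>

text \<open>\<open>triangle b + a\<close> numbers the pairs \<open>a \<le> b\<close> consecutively, so the odometer increases \<open>key\<close> by one.\<close>

definition pair_sum :: "(nat \<Rightarrow> nat) \<Rightarrow> (nat \<Rightarrow> nat) \<Rightarrow> (nat \<Rightarrow> nat) \<Rightarrow> nat" where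
  "pair_sum g x y = (\<Sum>i<m - 1. (triangle (y (Suc i)) + x (Suc i)) * g i)"

abbreviation "key \<equiv> pair_sum (\<lambda>i. triangle (Suc n) ^ i)"

text \<open>The weights \<open>g\<close> stay arbitrary because two instances are needed: powers of
  \<open>triangle (Suc n)\<close> give the position of the odometer, weights \<open>1\<close> the
  potential that pays for its carries.\<close>

lemma pair_sum_upd:
  assumes "Suc i < m"
  shows "pair_sum g (x(Suc i := a)) (y(Suc i := b)) + (triangle (y (Suc i)) + x (Suc i)) * g i =
    pair_sum g x y + (triangle b + a) * g i"
  using sum_upd[of i "m - 1" "\<lambda>j. (triangle ((y(Suc i := b)) (Suc j)) + (x(Suc i := a)) (Suc j)) * g j"
      "\<lambda>j. (triangle (y (Suc j)) + x (Suc j)) * g j"] assms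
  by (simp add: pair_sum_def)

lemma pair_sum_upd0[simp]: "pair_sum g (x(0 := a)) y = pair_sum g x y"
  "pair_sum g x (y(0 := b)) = pair_sum g x y"
  by (auto simp: pair_sum_def)

lemma pair_digit_less: "a \<le> b \<Longrightarrow> b \<le> n \<Longrightarrow> triangle b + a < triangle (Suc n)"
  using triangle_mono[of b n] by (simp add: triangle_Suc)

lemma key_less:
  assumes "y \<in> vecs" "\<And>i. i > 0 \<Longrightarrow> x i \<le> y i"
  shows "key x y < triangle (Suc n) ^ (m - 1)"
  unfolding pair_sum_def
  using assms(2) vecs_le[OF assms(1)] by (intro positional_less pair_digit_less) simp_all

lemma key_inj:
  assumes "x \<in> vecs" "y \<in> vecs" "x' \<in> vecs" "y' \<in> vecs"
    and "\<And>i. i > 0 \<Longrightarrow> x i \<le> y i" "\<And>i. i > 0 \<Longrightarrow> x' i \<le> y' i"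
    and "key x y = key x' y'" "i > 0"
  shows "x i = x' i \<and> y i = y' i"
proof (cases "i < m")
  case True
  have "triangle (y (Suc (i - 1))) + x (Suc (i - 1)) = triangle (y' (Suc (i - 1))) + x' (Suc (i - 1))"
  proof (rule positional_inj[where d = "\<lambda>i. triangle (y (Suc i)) + x (Suc i)"
        and e = "\<lambda>i. triangle (y' (Suc i)) + x' (Suc i)"])
    show "triangle (y (Suc j)) + x (Suc j) < triangle (Suc n)" for j
      using assms(5) vecs_le[OF assms(2)] by (intro pair_digit_less) simp_all
    show "triangle (y' (Suc j)) + x' (Suc j) < triangle (Suc n)" for j
      using assms(6) vecs_le[OF assms(4)] by (intro pair_digit_less) simp_all
    show "i - 1 < m - 1" using True assms(8) by simp
  qed (use assms(7) in \<open>simp add: pair_sum_def\<close>)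
  then show ?thesis
    using triangle_pair_inj[of "x i" "y i" "x' i" "y' i"] assms(5,6,8) by simp
next
  case False
  then show ?thesis using assms(1-4) by (simp add: vecs_def)
qed

text \<open>In each coordinate, \<open>triangle y + x \<le> triangle z + y\<close>. This is what
  puts the steps into a row before the steps out of it.\<close>

lemma key_mono:
  assumes "\<And>i. i > 0 \<Longrightarrow> x i \<le> y i" "\<And>i. i > 0 \<Longrightarrow> y i \<le> z i"
  shows "key x y \<le> key y z"
  unfolding pair_sum_def
  by (intro sum_mono mult_right_mono add_mono triangle_mono) (auto simp: assms)

lemma triangle_le_square: "triangle (Suc n) \<le> Suc n * Suc n"
proof -
  have "Suc n * Suc (Suc n) \<le> 2 * (Suc n * Suc n)" by simp
  then show ?thesis unfolding triangle_def by linarith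
qed

subsection \<open>The table of distances\<close>

definition settled :: "(nat \<Rightarrow> nat) \<Rightarrow> (nat \<Rightarrow> nat) \<Rightarrow> (nat \<Rightarrow> nat) \<Rightarrow> bool" where
  "settled D x y \<longleftrightarrow> D (code x) \<noteq> 0 \<longrightarrow> D (code y) \<noteq> 0 \<and> D (code y) \<le> D (code x) + 1"

text \<open>The predecessor clause asks only for \<open><\<close>, so that it survives a later
  lowering of the predecessor without any argument about the order of steps. That the difference is
  exactly one follows once all steps are settled.\<close>

definition table_ok :: "(nat \<Rightarrow> nat) \<Rightarrow> (nat \<Rightarrow> nat) \<Rightarrow> (nat \<Rightarrow> nat) \<Rightarrow>
    ((nat \<Rightarrow> nat) \<Rightarrow> (nat \<Rightarrow> nat) \<Rightarrow> bool) \<Rightarrow> bool" where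
  "table_ok D pr lb done \<longleftrightarrow> D 0 = 1 \<and>
     (\<forall>y\<in>vecs. D (code y) \<noteq> 0 \<longrightarrow> y = (\<lambda>_. 0) \<or>
        (\<exists>x. step (lb (code y)) x y \<and> pr (code y) = code x \<and> D (code x) \<noteq> 0 \<and> D (code x) < D (code y))) \<and>
     (\<forall>x y c. step c x y \<longrightarrow> done x y \<longrightarrow> settled D x y)"

text \<open>Lowering the value of \<open>y\<close> can unsettle only steps that leave
  \<open>y\<close>. By freshness none of these is done yet, except possibly the step from
  \<open>y\<close> to itself, which is settled trivially.\<close>

lemma table_ok_relax:
  assumes ok: "table_ok D pr lb done" and st: "step c x y" and D: "D (code x) \<noteq> 0"
    and fresh: "\<And>c z. step c y z \<Longrightarrow> done y z \<Longrightarrow> z = y"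
    and better: "D (code y) = 0 \<or> D (code x) + 1 < D (code y)"
  shows "table_ok (D(code y := D (code x) + 1)) (pr(code y := code x)) (lb(code y := c)) done"
proof -
  let ?D = "D(code y := D (code x) + 1)"
  have v: "x \<in> vecs" "y \<in> vecs" using st by (auto simp: step_def)
  have ne: "code x \<noteq> code y" using D better by auto
  have D0: "D 0 = 1" using ok by (simp add: table_ok_def)
  then have "code y \<noteq> 0" using better D by (metis Suc_eq_plus1 less_one not_add_less2 zero_neq_one)
  then have "?D 0 = 1" using D0 by simp
  moreover have "settled ?D a b" if "step c' a b" "done a b" for a b c'
  proof -
    have s: "settled D a b" using ok that by (auto simp: table_ok_def)
    have ab: "a \<in> vecs" "b \<in> vecs" using that by (auto simp: step_def)
    show ?thesis
    proof (cases "a = y")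
      case True
      then have "b = y" using fresh that by blast
      with True show ?thesis by (simp add: settled_def)
    next
      case False
      then have "code a \<noteq> code y" using code_inj v ab by blast
      with s better show ?thesis by (auto simp: settled_def)
    qed
  qed
  moreover have "z = (\<lambda>_. 0) \<or> (\<exists>x'. step ((lb(code y := c)) (code z)) x' z \<and>
      (pr(code y := code x)) (code z) = code x' \<and> ?D (code x') \<noteq> 0 \<and> ?D (code x') < ?D (code z))"
    if z: "z \<in> vecs" "?D (code z) \<noteq> 0" for z
  proof (cases "z = y")
    case True
    with st D ne show ?thesis by (auto intro!: exI[of _ x])
  next
    case False
    then have nz: "code z \<noteq> code y" using code_inj v z by blast
    then have "z = (\<lambda>_. 0) \<or> (\<exists>x. step (lb (code z)) x z \<and> pr (code z) = code x \<and>
        D (code x) \<noteq> 0 \<and> D (code x) < D (code z))"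
      using z ok by (auto simp: table_ok_def)
    then show ?thesis using nz better by fastforce
  qed
  ultimately show ?thesis unfolding table_ok_def by blast
qed

section \<open>Walks and shortest distances\<close>

definition edge :: "(nat \<Rightarrow> nat) \<Rightarrow> (nat \<Rightarrow> nat) \<Rightarrow> bool" where
  "edge x y \<longleftrightarrow> (\<exists>c. step c x y)"

inductive reach :: "nat \<Rightarrow> (nat \<Rightarrow> nat) \<Rightarrow> bool" where
  reach_zero: "reach 0 (\<lambda>_. 0)"
| reach_step: "reach d x \<Longrightarrow> edge x y \<Longrightarrow> reach (Suc d) y"

lemma table_complete:
  assumes "table_ok D pr lb (\<lambda>_ _. True)" "reach d y"
  shows "D (code y) \<noteq> 0 \<and> D (code y) \<le> Suc d"
  using assms(2)
proof (induction rule: reach.induct)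
  case reach_zero
  then show ?case using assms(1) by (simp add: table_ok_def code_zero)
next
  case (reach_step d x y)
  then have "settled D x y" using assms(1) by (auto simp: table_ok_def edge_def)
  with reach_step show ?case by (auto simp: settled_def)
qed

text \<open>Going to the predecessor lowers the value, and by at most one because that step is
  settled. So it falls by exactly one each time, and the path reaches the origin after as many steps
  as the distance says.\<close>

lemma table_path:
  assumes ok: "table_ok D pr lb (\<lambda>_ _. True)" and "y \<in> vecs" "D (code y) \<noteq> 0"
  shows "\<exists>p. p 0 = (\<lambda>_. 0) \<and> p (D (code y) - 1) = y \<and>
    (\<forall>j<D (code y) - 1. step (lb (code (p (Suc j)))) (p j) (p (Suc j)) \<and> pr (code (p (Suc j))) = code (p j)) \<and>
    (\<forall>j\<le>D (code y) - 1. D (code (p j)) = Suc j)"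
  using assms(2,3)
proof (induction "D (code y)" arbitrary: y rule: less_induct)
  case less
  show ?case
  proof (cases "y = (\<lambda>_. 0)")
    case True
    then have "D (code y) = 1" using ok by (simp add: table_ok_def code_zero)
    with True show ?thesis by (intro exI[of _ "\<lambda>_ _. 0"]) auto
  next
    case False
    then obtain x where x: "step (lb (code y)) x y" "pr (code y) = code x" "D (code x) \<noteq> 0"
        "D (code x) < D (code y)" using ok less.prems by (auto simp: table_ok_def)
    have "D (code y) \<le> D (code x) + 1"
      using ok x(1,3) by (auto simp: table_ok_def settled_def)
    with x(4) have Dy: "D (code y) = Suc (D (code x))" by simp
    have xv: "x \<in> vecs" using x(1) by (simp add: step_def)
    obtain p where p: "p 0 = (\<lambda>_. 0)" "p (D (code x) - 1) = x"
      "\<And>j. j<D (code x) - 1 \<Longrightarrow> step (lb (code (p (Suc j)))) (p j) (p (Suc j)) \<and> pr (code (p (Suc j))) = code (p j)"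
      "\<And>j. j\<le>D (code x) - 1 \<Longrightarrow> D (code (p j)) = Suc j"
      using less.hyps[OF x(4) xv x(3)] by blast
    obtain e where e: "D (code x) = Suc e" using x(3) by (cases "D (code x)") auto
    show ?thesis
      using p x e unfolding Dy by (intro exI[of _ "p(Suc e := y)"]) (simp add: Dy less_Suc_eq le_Suc_eq)
  qed
qed

subsection \<open>Reasoning about running time\<close>

text \<open>The last argument of \<open>wp\<close> is the time spent so far, and that of the postcondition the time at the end.\<close>

definition wp :: "com \<Rightarrow> (store \<Rightarrow> nat \<Rightarrow> bool) \<Rightarrow> store \<Rightarrow> nat \<Rightarrow> bool" where
  "wp c Q s t \<longleftrightarrow> (\<exists>t' s'. exec \<tau>s Cs q c s t' s' \<and> Q s' (t + t'))"

lemma wp_Skip[simp]: "wp Skip Q s t \<longleftrightarrow> Q s (t + 1)"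
  unfolding wp_def by (metis exec.Skip exec_deterministic)

lemma wp_Assign[simp]: "wp (Assign x e) Q s t \<longleftrightarrow> Q (set_var x (aval e s) s) (t + (acost e + 1))"
  unfolding wp_def by (metis exec.Assign exec_deterministic)

lemma wp_Put[simp]: "wp (Put a e e') Q s t \<longleftrightarrow>
    Q (set_arr a (aval e s) (aval e' s) s) (t + (acost e + acost e' + 1))"
  unfolding wp_def by (metis exec.Put exec_deterministic)

lemma wp_Check: "aval e s < k \<Longrightarrow> well_formed_check \<tau>s (arrs s lo) (arrs s hi) \<Longrightarrow>
    wp (Check x e lo hi) Q s t \<longleftrightarrow>
    Q (set_var x (of_bool ((Cs ! aval e s) (checked_set \<tau>s (arrs s lo) (arrs s hi)))) s)
      (t + (acost e + q + 1))"
  unfolding wp_def by (metis exec.Check exec_deterministic)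

lemma wp_Seq[simp]: "wp (Seq c d) Q s t \<longleftrightarrow> wp c (wp d Q) s t"
proof
  assume "wp (Seq c d) Q s t"
  then show "wp c (wp d Q) s t"
    unfolding wp_def by (metis exec_SeqE add.assoc)
next
  assume "wp c (wp d Q) s t"
  then show "wp (Seq c d) Q s t"
    unfolding wp_def by (metis exec.Seq add.assoc)
qed

lemma wp_Cond[simp]: "wp (Cond b c d) Q s t \<longleftrightarrow>
    (if bval b s then wp c Q s (t + bcost b) else wp d Q s (t + bcost b))"
proof
  assume "wp (Cond b c d) Q s t"
  then show "if bval b s then wp c Q s (t + bcost b) else wp d Q s (t + bcost b)"
    unfolding wp_def by (metis exec_CondE add.assoc)
next
  assume "if bval b s then wp c Q s (t + bcost b) else wp d Q s (t + bcost b)"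
  then show "wp (Cond b c d) Q s t"
    unfolding wp_def by (metis exec.CondTrue exec.CondFalse add.assoc)
qed

lemma wp_unmodified:
  assumes "wp c Q s t"
    and "\<And>s' t'. Q s' t' \<Longrightarrow> (\<And>x. x \<notin> modified_vars c \<Longrightarrow> vars s' x = vars s x) \<Longrightarrow>
      (\<And>a. a \<notin> modified_arrs c \<Longrightarrow> arrs s' a = arrs s a) \<Longrightarrow> Q' s' t'"
  shows "wp c Q' s t"
  using assms exec_unmodified unfolding wp_def by meson

lemma wp_mono: "wp c Q s t \<Longrightarrow> (\<And>s' t'. Q s' t' \<Longrightarrow> Q' s' t') \<Longrightarrow> wp c Q' s t"
  unfolding wp_def by blast

text \<open>The frame condition is built into the invariant: body and exit may assume that
  everything outside the modified names is as it was on entering the loop. Since \<open>I\<close>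
  also takes the elapsed time, cost bounds are ordinary parts of invariants.\<close>

lemma wp_While:
  fixes \<mu> :: "store \<Rightarrow> nat"
  assumes "I s t"
    and body: "\<And>s' t'. I s' t' \<Longrightarrow> bval b s' \<Longrightarrow>
      (\<And>x. x \<notin> modified_vars c \<Longrightarrow> vars s' x = vars s x) \<Longrightarrow>
      (\<And>a. a \<notin> modified_arrs c \<Longrightarrow> arrs s' a = arrs s a) \<Longrightarrow>
      wp c (\<lambda>s'' t''. I s'' t'' \<and> \<mu> s'' < \<mu> s') s' (t' + bcost b)"
    and exit: "\<And>s' t'. I s' t' \<Longrightarrow> \<not> bval b s' \<Longrightarrow>
      (\<And>x. x \<notin> modified_vars c \<Longrightarrow> vars s' x = vars s x) \<Longrightarrow>
      (\<And>a. a \<notin> modified_arrs c \<Longrightarrow> arrs s' a = arrs s a) \<Longrightarrow> Q s' (t' + bcost b)"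
  shows "wp (While b c) Q s t"
proof -
  define J where "J s' t' \<longleftrightarrow> I s' t' \<and> (\<forall>x. x \<notin> modified_vars c \<longrightarrow> vars s' x = vars s x) \<and>
    (\<forall>a. a \<notin> modified_arrs c \<longrightarrow> arrs s' a = arrs s a)" for s' t'
  have "J s' t' \<Longrightarrow> wp (While b c) Q s' t'" for s' t'
  proof (induction "\<mu> s'" arbitrary: s' t' rule: less_induct)
    case less
    show ?case
    proof (cases "bval b s'")
      case True
      have "wp c (\<lambda>s'' t''. I s'' t'' \<and> \<mu> s'' < \<mu> s') s' (t' + bcost b)"
        using less.prems True by (intro body) (auto simp: J_def)
      then obtain t1 s1 where e: "exec \<tau>s Cs q c s' t1 s1" "I s1 (t' + bcost b + t1)" "\<mu> s1 < \<mu> s'"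
        unfolding wp_def by blast
      have "J s1 (t' + bcost b + t1)"
        using e(2) less.prems exec_unmodified[OF e(1)] by (simp add: J_def)
      with less.hyps e(3) have "wp (While b c) Q s1 (t' + bcost b + t1)" by blast
      with e(1) True show ?thesis
        unfolding wp_def by (metis exec.WhileTrue add.assoc)
    next
      case False
      then show ?thesis using less.prems exit[of s' t']
        unfolding wp_def J_def by (metis exec.WhileFalse)
    qed
  qed
  moreover have "J s t" using assms(1) by (simp add: J_def)
  ultimately show ?thesis by blast
qed

definition "search_cost = k * (q + 20) + 20"

lemma well_formed: "x \<le> y \<Longrightarrow> y \<in> vecs \<Longrightarrow> well_formed_check \<tau>s x y"
  using lengths by (auto simp: well_formed_check_def le_fun_def vecs_def)

lemma wp_search:
  assumes k: "vars s ''k'' = k" and v: "arrs s ''lo'' \<in> vecs" "arrs s ''hi'' \<in> vecs" "arrs s ''lo'' \<le> arrs s ''hi''"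
    and Q: "\<And>s' t'. t' \<le> t + search_cost \<Longrightarrow>
      vars s' ''ok'' = 1 \<and> step (vars s' ''c'') (arrs s ''lo'') (arrs s ''hi'') \<or>
      vars s' ''ok'' = 0 \<and> \<not> edge (arrs s ''lo'') (arrs s ''hi'') \<Longrightarrow>
      (\<And>x. x \<notin> {''ok'', ''c''} \<Longrightarrow> vars s' x = vars s x) \<Longrightarrow> arrs s' = arrs s \<Longrightarrow> Q s' t'"
  shows "wp search_cmd Q s t"
proof -
  let ?P = "\<lambda>c. (Cs ! c) (checked_set \<tau>s (arrs s ''lo'') (arrs s ''hi''))"
  have st: "step c (arrs s ''lo'') (arrs s ''hi'') \<longleftrightarrow> c < k \<and> ?P c" for c
    using v by (simp add: step_def)
  have wf: "well_formed_check \<tau>s (arrs s ''lo'') (arrs s ''hi'')" using v well_formed by blast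
  have *: "wp search_cmd (\<lambda>s' t'. arrs s' = arrs s \<and> t' \<le> t + search_cost \<and>
      (vars s' ''ok'' = 1 \<and> vars s' ''c'' < k \<and> ?P (vars s' ''c'') \<or>
       vars s' ''ok'' = 0 \<and> (\<forall>c<k. \<not> ?P c))) s t"
    unfolding search_cmd_def wp_Seq wp_Assign
  \<comment> \<open>Success leaves \<open>c\<close> in place. Hence the invariant charges one
    further round in that case, and the measure contains \<open>1 - ok\<close> so that it decreases
    there as well.\<close>
  proof (rule wp_While[where I = "\<lambda>s' t'. arrs s' = arrs s \<and>
        (vars s' ''ok'' = 0 \<and> vars s' ''c'' \<le> k \<and> (\<forall>c<vars s' ''c''. \<not> ?P c) \<and>
           t' \<le> t + 5 + vars s' ''c'' * (q + 20) \<or>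
         vars s' ''ok'' = 1 \<and> vars s' ''c'' < k \<and> ?P (vars s' ''c'') \<and>
           t' \<le> t + 5 + Suc (vars s' ''c'') * (q + 20))"
      and \<mu> = "\<lambda>s'. (k - vars s' ''c'') + (1 - vars s' ''ok'')"], goal_cases)
    case 1
    then show ?case by simp
  next
    case (2 s' t')
    have kk: "vars s' ''k'' = k" using 2(3)[of "''k''"] k by simp
    have a: "arrs s' = arrs s" and c: "vars s' ''c'' < k" and ok: "vars s' ''ok'' = 0"
      and i: "\<forall>c<vars s' ''c''. \<not> ?P c" "t' \<le> t + 5 + vars s' ''c'' * (q + 20)"
      using 2(1,2) kk by simp_all
    show ?case
      using c i wf by (cases "?P (vars s' ''c'')") (simp_all add: wp_Check a ok All_less_Suc)
  next
    case (3 s' t')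
    then have kk: "vars s' ''k'' = k" using k by simp
    from 3(1) show ?case
    proof (elim conjE disjE, goal_cases)
      case 1
      then have "vars s' ''c'' = k" using 3(2) kk by simp
      with 1 show ?case by (simp add: search_cost_def)
    next
      case 2
      have "Suc (vars s' ''c'') * (q + 20) \<le> k * (q + 20)" using 2 by (intro mult_right_mono) auto
      with 2 show ?case unfolding search_cost_def by simp
    qed
  qed
  show ?thesis
    by (rule wp_unmodified[OF *]) (rule Q; use st in \<open>auto simp: edge_def\<close>)
qed

subsection \<open>Relaxing the steps between two rows\<close>

text \<open>Processing is lexicographic in the number of the row pair and the target column. Source
  columns are not recorded, since all steps into a column become settled together.\<close>

definition done_before :: "nat \<Rightarrow> nat \<Rightarrow> (nat \<Rightarrow> nat) \<Rightarrow> (nat \<Rightarrow> nat) \<Rightarrow> bool" where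
  "done_before c y a b \<longleftrightarrow> key a b < c \<or> key a b = c \<and> b 0 < y"

lemma step_vecs: "step c x y \<Longrightarrow> x \<in> vecs \<and> y \<in> vecs" by (simp add: step_def)

text \<open>A step out of the target ends at some \<open>z \<ge> X'(0 := y)\<close>: by
  \<open>key_mono\<close> its rows come no earlier than the current ones, and its target column is
  at least \<open>y\<close>.\<close>

lemma not_done_from_target:
  assumes "X \<in> vecs" "X' \<in> vecs" "\<And>i. i > 0 \<Longrightarrow> X i \<le> X' i"
    and st: "step c (X'(0 := y)) z"
  shows "\<not> done_before (key X X') y (X'(0 := y)) z"
proof
  assume d: "done_before (key X X') y (X'(0 := y)) z"
  have le: "X' i \<le> z i" if "i > 0" for i using step_le[OF st, of i] that by simp
  have "y \<le> z 0" using step_le[OF st, of 0] by simp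
  moreover have "key X X' \<le> key X' z" by (rule key_mono) (use assms(3) le in auto)
  ultimately show False using d by (simp add: done_before_def)
qed

lemma wp_relax:
  assumes X: "X \<in> vecs" "X' \<in> vecs" "\<And>i. i > 0 \<Longrightarrow> X i \<le> X' i"
    and ok: "table_ok (arrs s ''D'') (arrs s ''pr'') (arrs s ''lb'') (done_before (key X X') y)"
    and vs: "vars s ''u'' = code x" "vars s ''bt'' = code (X'(0 := 0))" "vars s ''y'' = y"
    and st: "step (vars s ''c'') x (X'(0 := y))"
    and Q: "\<And>s' t'. t' \<le> t + 50 \<Longrightarrow>
      table_ok (arrs s' ''D'') (arrs s' ''pr'') (arrs s' ''lb'') (done_before (key X X') y) \<Longrightarrow>
      settled (arrs s' ''D'') x (X'(0 := y)) \<Longrightarrow>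
      (\<And>z. z \<noteq> code (X'(0 := y)) \<Longrightarrow> arrs s' ''D'' z = arrs s ''D'' z) \<Longrightarrow>
      (\<And>z. arrs s ''D'' z \<noteq> 0 \<Longrightarrow> arrs s' ''D'' z \<noteq> 0 \<and> arrs s' ''D'' z \<le> arrs s ''D'' z) \<Longrightarrow>
      (\<And>x. x \<noteq> ''v'' \<Longrightarrow> vars s' x = vars s x) \<Longrightarrow>
      (\<And>a. a \<notin> {''D'', ''pr'', ''lb''} \<Longrightarrow> arrs s' a = arrs s a) \<Longrightarrow> Q s' t'"
  shows "wp relax_cmd Q s t"
proof -
  let ?y = "X'(0 := y)" and ?D = "arrs s ''D''"
  have v: "code (X'(0 := 0)) + y = code ?y" using code_upd0[of X' y] by simp
  show ?thesis
  proof (cases "?D (code x) \<noteq> 0 \<and> (?D (code ?y) = 0 \<or> ?D (code x) + 1 < ?D (code ?y))")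
    case True
    then have D: "?D (code x) \<noteq> 0" "?D (code ?y) = 0 \<or> ?D (code x) + 1 < ?D (code ?y)" by auto
    have ne: "code x \<noteq> code ?y" using D by auto
    have "table_ok (?D(code ?y := ?D (code x) + 1)) ((arrs s ''pr'')(code ?y := code x))
        ((arrs s ''lb'')(code ?y := vars s ''c'')) (done_before (key X X') y)"
      using not_done_from_target[OF X] by (intro table_ok_relax[OF ok st D(1) _ D(2)]) blast
    then show ?thesis
      unfolding relax_cmd_def using D ne
      by (cases "?D (code ?y) = 0") (simp add: v vs, rule Q; auto simp: settled_def)+
  next
    case False
    then have "settled ?D x ?y" by (auto simp: settled_def)
    then show ?thesis using False
      unfolding relax_cmd_def
      by (cases "?D (code x) = 0") (simp add: v vs, rule Q; use ok in \<open>auto\<close>)+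
  qed
qed

lemma settled_decrease:
  assumes "settled D x y" "\<And>z. z \<noteq> code y \<Longrightarrow> D' z = D z"
    and "\<And>z. D z \<noteq> 0 \<Longrightarrow> D' z \<noteq> 0 \<and> D' z \<le> D z"
  shows "settled D' x y"
proof (cases "code x = code y")
  case True then show ?thesis by (simp add: settled_def)
next
  case False
  then have "D' (code x) = D (code x)" using assms(2) by blast
  then show ?thesis using assms(1) assms(3)[of "code y"] unfolding settled_def by linarith
qed

text \<open>By \<open>key_inj\<close> the only steps that become done are those into column
  \<open>y\<close> of row \<open>X'\<close> from row \<open>X\<close>, and they start in a column
  \<open>a \<le> y\<close>.\<close>

lemma table_ok_next_column:
  assumes ok: "table_ok D pr lb (done_before (key X X') y)"
    and X: "X \<in> vecs" "X' \<in> vecs" "\<And>i. i > 0 \<Longrightarrow> X i \<le> X' i"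
    and s: "\<And>a. a \<le> y \<Longrightarrow> edge (X(0 := a)) (X'(0 := y)) \<Longrightarrow> settled D (X(0 := a)) (X'(0 := y))"
  shows "table_ok D pr lb (done_before (key X X') (Suc y))"
proof -
  have "settled D x z" if st: "step c x z" and d: "done_before (key X X') (Suc y) x z" for c x z
  proof (cases "done_before (key X X') y x z")
    case True
    then show ?thesis using ok st unfolding table_ok_def by blast
  next
    case False
    with d have kz: "key x z = key X X'" "z 0 = y" by (auto simp: done_before_def)
    have eq: "x i = X i \<and> z i = X' i" if "i > 0" for i
      using key_inj[of x z X X' i] step_vecs[OF st] X step_le[OF st] kz that by blast
    have "x = X(0 := x 0)" "z = X'(0 := y)" using eq kz(2) by (auto simp: fun_eq_iff)
    moreover have "x 0 \<le> y" using step_le[OF st, of 0] kz by simp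
    ultimately show ?thesis using s[of "x 0"] st unfolding edge_def by metis
  qed
  then show ?thesis using ok unfolding table_ok_def by blast
qed

definition "unit_cost = search_cost + 100"

text \<open>Each movement of \<open>l\<close> pays for one unsuccessful search; one additional unit
  covers the search that succeeds.\<close>

lemma wp_advance:
  assumes X: "X \<in> vecs" "X' \<in> vecs" "\<And>i. i > 0 \<Longrightarrow> X i \<le> X' i"
    and rows: "\<exists>a\<le>n. arrs s ''lo'' = X(0 := a)" "\<exists>b\<le>n. arrs s ''hi'' = X'(0 := b)"
    and k: "vars s ''k'' = k" and ok: "vars s ''ok'' = 0" and ly: "vars s ''l'' \<le> vars s ''y''" "vars s ''y'' \<le> n"
    and no: "\<And>a b. a < vars s ''l'' \<Longrightarrow> vars s ''y'' \<le> b \<Longrightarrow> b \<le> n \<Longrightarrow> \<not> edge (X(0 := a)) (X'(0 := b))"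
    and Q: "\<And>s' t'. t' + unit_cost * vars s ''l'' \<le> t + unit_cost * vars s' ''l'' + unit_cost + 7 \<Longrightarrow>
      \<exists>a\<le>n. arrs s' ''lo'' = X(0 := a) \<Longrightarrow> \<exists>b\<le>n. arrs s' ''hi'' = X'(0 := b) \<Longrightarrow>
      vars s ''l'' \<le> vars s' ''l'' \<Longrightarrow> vars s' ''l'' \<le> vars s ''y'' \<Longrightarrow>
      (\<And>a b. a < vars s' ''l'' \<Longrightarrow> vars s ''y'' \<le> b \<Longrightarrow> b \<le> n \<Longrightarrow> \<not> edge (X(0 := a)) (X'(0 := b))) \<Longrightarrow>
      (vars s' ''l'' < vars s ''y'' \<Longrightarrow> step (vars s' ''c'') (X(0 := vars s' ''l'')) (X'(0 := vars s ''y''))) \<Longrightarrow>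
      (\<And>x. x \<notin> {''ok'', ''c'', ''l''} \<Longrightarrow> vars s' x = vars s x) \<Longrightarrow>
      (\<And>a. a \<notin> {''lo'', ''hi''} \<Longrightarrow> arrs s' a = arrs s a) \<Longrightarrow> Q s' t'"
  shows "wp advance_cmd Q s t"
proof -
  define y where "y = vars s ''y''"
  let ?I = "\<lambda>s' t'. (\<exists>a\<le>n. arrs s' ''lo'' = X(0 := a)) \<and> (\<exists>b\<le>n. arrs s' ''hi'' = X'(0 := b)) \<and>
     vars s ''l'' \<le> vars s' ''l'' \<and> vars s' ''l'' \<le> y \<and>
     (\<forall>a b. a < vars s' ''l'' \<and> y \<le> b \<and> b \<le> n \<longrightarrow> \<not> edge (X(0 := a)) (X'(0 := b))) \<and>
     t' + unit_cost * vars s ''l'' \<le> t + unit_cost * vars s' ''l'' + vars s' ''ok'' * unit_cost \<and>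
     (vars s' ''ok'' = 0 \<or> vars s' ''ok'' = 1 \<and> vars s' ''l'' < y \<and>
       step (vars s' ''c'') (X(0 := vars s' ''l'')) (X'(0 := y)))"
  \<comment> \<open>The \<open>7\<close> is the cost of the test that leaves the loop.\<close>
  have *: "wp advance_cmd (\<lambda>s' t'. ?I s' (t' - 7) \<and> 7 \<le> t' \<and> (vars s' ''ok'' = 0 \<longrightarrow> vars s' ''l'' = y)) s t"
    unfolding advance_cmd_def
  proof (rule wp_While[where I = ?I and \<mu> = "\<lambda>s'. y - vars s' ''l'' + (1 - vars s' ''ok'')"], goal_cases)
    case 1
    then show ?case using rows ok ly no by (simp add: y_def)
  next
    case (2 s' t')
    have v: "vars s' ''k'' = k" "vars s' ''y'' = y" using 2(3)[of "''k''"] 2(3)[of "''y''"] k by (simp_all add: y_def)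
    define l where "l = vars s' ''l''"
    have l: "l < y" "vars s' ''ok'' = 0" "vars s ''l'' \<le> l" using 2(1,2) v by (simp_all add: l_def)
    obtain a b where ab: "arrs s' ''lo'' = X(0 := a)" "arrs s' ''hi'' = X'(0 := b)" using 2(1) by blast
    have yn: "y \<le> n" "l \<le> n" using ly l by (simp_all add: y_def)
    have nol: "\<not> edge (X(0 := a)) (X'(0 := b))" if "a < l" "y \<le> b" "b \<le> n" for a b
      using 2(1) that by (simp add: l_def)
    \<comment> \<open>A failure for source \<open>l\<close> and target \<open>y\<close> rules out
      every later target, as a step into \<open>b \<ge> y\<close> would shrink to one into
      \<open>y\<close>. This is why \<open>l\<close> never moves back.\<close>
    have nol': "\<not> edge (X(0 := l)) (X'(0 := b))" if "\<not> edge (X(0 := l)) (X'(0 := y))" "y \<le> b" for b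
      using step_shrink[of _ X l X' b l y] that l(1) unfolding edge_def by blast
    have le: "X(0 := l) \<le> X'(0 := y)" using X(3) l by (intro row_le) simp_all
    have tt: "t' + unit_cost * vars s ''l'' \<le> t + unit_cost * l" using 2(1) l by (simp add: l_def)
    show ?case
      unfolding wp_Seq wp_Put
      apply (rule wp_search)
      subgoal using v by simp
      subgoal using ab X yn m_pos by (simp add: vecs_upd flip: l_def)
      subgoal using ab X yn m_pos v by (simp add: vecs_upd)
      subgoal using ab v le by (simp flip: l_def)
      subgoal premises p for s2 t2
      proof -
        have fr: "vars s2 ''l'' = l" "arrs s2 ''lo'' = X(0 := l)" "arrs s2 ''hi'' = X'(0 := y)"
          using p(3)[of "''l''"] p(4) ab v by (simp_all add: l_def)
        have ex: "\<exists>a\<le>n. X(0 := l) = X(0 := a)" "\<exists>b\<le>n. X'(0 := y) = X'(0 := b)" using yn by blast+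
        have t2: "t2 \<le> t' + 13 + search_cost" using p(1) by simp
        from p(2) show ?thesis
        proof (elim disjE conjE, goal_cases)
          case 1
          have "step (vars s2 ''c'') (X(0 := l)) (X'(0 := y))" using 1 ab v by (simp add: l_def)
          then show ?case using 1(1) l tt t2 by (simp add: unit_cost_def fr ex nol flip: l_def)
        next
          case 2
          have ne: "\<not> edge (X(0 := l)) (X'(0 := y))" using 2 ab v by (simp add: l_def)
          have "\<not> edge (X(0 := a)) (X'(0 := b))" if "a < Suc l" "y \<le> b" "b \<le> n" for a b
            using nol nol'[OF ne] that by (cases "a = l") simp_all
          then show ?case using 2(1) l tt t2 by (simp add: unit_cost_def fr ex flip: l_def)
        qed
      qed
      done
  next
    case (3 s' t')
    have v: "vars s' ''y'' = y" using 3(3)[of "''y''"] by (simp add: y_def)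
    have "vars s' ''ok'' = 0 \<Longrightarrow> vars s' ''l'' = y" using 3(1,2) v by simp
    then show ?case using 3(1) by simp
  qed
  show ?thesis
  proof (rule wp_unmodified[OF *], goal_cases)
    case (1 s' t')
    have t: "t' - 7 + unit_cost * vars s ''l'' \<le> t + unit_cost * vars s' ''l'' + vars s' ''ok'' * unit_cost" "7 \<le> t'"
      using 1(1) by blast+
    have u: "vars s' ''ok'' * unit_cost \<le> unit_cost" using 1(1) by auto
    show ?case
      apply (rule Q)
      subgoal using u t by linarith
      subgoal using 1(1) by blast
      subgoal using 1(1) by blast
      subgoal using 1(1) by blast
      subgoal using 1(1) by (simp add: y_def)
      subgoal using 1(1) by (simp add: y_def)
      subgoal using 1(1) by (auto simp: y_def)
      subgoal using 1(2) by simp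
      subgoal using 1(3) by simp
      done
  qed
qed

section \<open>Deque operations with amortised cost\<close>

lemma wp_pop_front:
  assumes d: "deque D (arrs s ''q'') (vars s ''h'') (vars s ''t'') (vars s ''bs'') (vars s ''l'') y w"
    and u: "20 \<le> u"
    and Q: "\<And>s' t'. t' + u * vars s ''h'' \<le> t + u * vars s' ''h'' + 10 \<Longrightarrow>
      deque D (arrs s ''q'') (vars s' ''h'') (vars s ''t'') (vars s ''bs'') (vars s ''l'') y w \<Longrightarrow>
      (vars s' ''h'' < vars s ''t'' \<Longrightarrow> vars s ''bs'' + vars s ''l'' \<le> arrs s ''q'' (vars s' ''h'')) \<Longrightarrow>
      (\<And>x. x \<noteq> ''h'' \<Longrightarrow> vars s' x = vars s x) \<Longrightarrow> arrs s' = arrs s \<Longrightarrow> Q s' t'"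
  shows "wp pop_front_cmd Q s t"
  unfolding pop_front_cmd_def
proof (rule wp_While[where \<mu> = "\<lambda>s'. vars s ''t'' - vars s' ''h''" and
      I = "\<lambda>s' t'. arrs s' = arrs s \<and> t' + u * vars s ''h'' \<le> t + u * vars s' ''h'' \<and>
       deque D (arrs s ''q'') (vars s' ''h'') (vars s ''t'') (vars s ''bs'') (vars s ''l'') y w"], goal_cases)
  case 1
  then show ?case using d by simp
next
  case (2 s' t')
  have v: "vars s' ''t'' = vars s ''t''" "vars s' ''bs'' = vars s ''bs''" "vars s' ''l'' = vars s ''l''"
    using 2(3) by simp_all
  have "deque D (arrs s ''q'') (Suc (vars s' ''h'')) (vars s ''t'') (vars s ''bs'') (vars s ''l'') y w"
    using 2(1,2) v by (intro deque_pop_front) simp_all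
  then show ?case using 2(1,2) u v by (simp add: diff_less_mono2)
next
  case (3 s' t')
  have v: "vars s' ''t'' = vars s ''t''" "vars s' ''bs'' = vars s ''bs''" "vars s' ''l'' = vars s ''l''"
    using 3(3) by simp_all
  show ?case
  proof (rule Q, goal_cases)
    case 3 then show ?case using \<open>\<not> bval _ _\<close> 3 v \<open>arrs s' = arrs s \<and> _\<close> by simp
  qed (use 3(1) 3(3) in simp_all)
qed

text \<open>The pointer \<open>t\<close> acts as a potential: every removal at the back lowers it
  and is paid for by \<open>u\<close>, while the append raises it once. Hence \<open>t\<close>
  enters the accounting with the opposite sign to \<open>h\<close> and \<open>l\<close>.\<close>

lemma wp_push:
  assumes d: "deque (arrs s ''D'') (arrs s ''q'') (vars s ''h'') (vars s ''t'') (vars s ''bs'') l (vars s ''y'') 0"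
    and u: "60 \<le> u"
    and Q: "\<And>s' t'. t' + u * vars s' ''t'' \<le> t + u * vars s ''t'' + 2 * u \<Longrightarrow>
      deque (arrs s ''D'') (arrs s' ''q'') (vars s ''h'') (vars s' ''t'') (vars s ''bs'') l (Suc (vars s ''y'')) 0 \<Longrightarrow>
      (\<And>x. x \<notin> {''t'', ''z''} \<Longrightarrow> vars s' x = vars s x) \<Longrightarrow>
      (\<And>a. a \<noteq> ''q'' \<Longrightarrow> arrs s' a = arrs s a) \<Longrightarrow> Q s' t'"
  shows "wp push_cmd Q s t"
proof (cases "arrs s ''D'' (vars s ''bs'' + vars s ''y'') = 0")
  case True
  then show ?thesis unfolding push_cmd_def
    using u d by simp (rule Q; simp add: deque_skip)
next
  case False
  let ?z = "vars s ''bs'' + vars s ''y''"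
  let ?s = "set_var ''z'' ?z s"
  have pb: "wp pop_back_cmd (\<lambda>s' t'. arrs s' = arrs s \<and> t' + u * vars s' ''t'' \<le> t + u * vars s ''t'' + 30 \<and>
      (\<forall>x. x \<noteq> ''t'' \<longrightarrow> vars s' x = vars ?s x) \<and>
      deque (arrs s ''D'') (arrs s ''q'') (vars s ''h'') (vars s' ''t'') (vars s ''bs'') l (vars s ''y'') (arrs s ''D'' ?z) \<and>
      (vars s ''h'' = vars s' ''t'' \<or> arrs s ''D'' (arrs s ''q'' (vars s' ''t'' - 1)) \<le> arrs s ''D'' ?z)) ?s (t + 8)"
    unfolding pop_back_cmd_def
  proof (rule wp_While[where \<mu> = "\<lambda>s'. vars s' ''t''" and
      I = "\<lambda>s' t'. arrs s' = arrs s \<and> t' + u * vars s' ''t'' \<le> t + u * vars s ''t'' + 8 \<and>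
       deque (arrs s ''D'') (arrs s ''q'') (vars s ''h'') (vars s' ''t'') (vars s ''bs'') l (vars s ''y'') (arrs s ''D'' ?z)"],
       goal_cases)
    case 1
    then show ?case using deque_append_intro[OF d] by simp
  next
    case (2 s' t')
    have v: "vars s' ''h'' = vars s ''h''" "vars s' ''z'' = ?z" using 2(3) by simp_all
    have "deque (arrs s ''D'') (arrs s ''q'') (vars s ''h'') (vars s' ''t'' - 1) (vars s ''bs'') l (vars s ''y'') (arrs s ''D'' ?z)"
      using 2(1,2) v False by (intro deque_pop_back) simp_all
    moreover obtain e where "vars s' ''t'' = Suc e" using 2(2) by (cases "vars s' ''t''") simp_all
    ultimately show ?case using 2(1) u by simp
  next
    case (3 s' t')
    have v: "vars s' ''h'' = vars s ''h''" "vars s' ''z'' = ?z" using 3(3) by simp_all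
    have "vars s ''h'' \<le> vars s' ''t''" using 3(1) dequeD(1) by blast
    then have "vars s ''h'' = vars s' ''t'' \<or> arrs s ''D'' (arrs s ''q'' (vars s' ''t'' - 1)) \<le> arrs s ''D'' ?z"
      using 3(1,2) v by auto
    then show ?case using 3(1,3) by simp
  qed
  have "wp pop_back_cmd (wp (Seq (Put ''q'' (V ''t'') (V ''z'')) (Assign ''t'' (Plus (V ''t'') (N 1)))) Q) ?s (t + 8)"
  proof (rule wp_mono[OF pb], elim conjE, goal_cases)
    case (1 s' t')
    have dq: "deque (arrs s ''D'') ((arrs s ''q'')(vars s' ''t'' := ?z)) (vars s ''h'') (Suc (vars s' ''t'')) (vars s ''bs'') l (Suc (vars s ''y'')) 0"
      using 1 False by (intro deque_push) simp_all
    have z: "vars s' ''z'' = ?z" using 1(3) by simp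
    show ?case
      apply simp
      apply (rule Q)
      subgoal using 1(2) u by simp
      subgoal using dq z 1(1) by simp
      subgoal using 1(3) by simp
      subgoal using 1(1) by simp
      done
  qed
  then show ?thesis unfolding push_cmd_def using False by (simp add: numeral_eq_Suc)
qed

section \<open>All steps into one column\<close>

text \<open>Entry \<open>0\<close> of \<open>lo\<close> and \<open>hi\<close> is overwritten before
  every search, so the two rows are fixed only up to that entry.\<close>

definition row_inv :: "(nat \<Rightarrow> nat) \<Rightarrow> (nat \<Rightarrow> nat) \<Rightarrow> store \<Rightarrow> bool" where
  "row_inv X X' s \<longleftrightarrow> X \<in> vecs \<and> X' \<in> vecs \<and> (\<forall>i>0. X i \<le> X' i) \<and>
     vars s ''k'' = k \<and> vars s ''bs'' = code (X(0 := 0)) \<and> vars s ''bt'' = code (X'(0 := 0)) \<and>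
     (\<exists>a\<le>n. arrs s ''lo'' = X(0 := a)) \<and> (\<exists>b\<le>n. arrs s ''hi'' = X'(0 := b)) \<and>
     table_ok (arrs s ''D'') (arrs s ''pr'') (arrs s ''lb'') (done_before (key X X') (vars s ''y''))"

lemma row_invD:
  assumes "row_inv X X' s"
  shows "X \<in> vecs" "X' \<in> vecs" "\<And>i. i > 0 \<Longrightarrow> X i \<le> X' i"
    "vars s ''k'' = k" "vars s ''bs'' = code (X(0 := 0))" "vars s ''bt'' = code (X'(0 := 0))"
    "\<exists>a\<le>n. arrs s ''lo'' = X(0 := a)" "\<exists>b\<le>n. arrs s ''hi'' = X'(0 := b)"
    "table_ok (arrs s ''D'') (arrs s ''pr'') (arrs s ''lb'') (done_before (key X X') (vars s ''y''))"
  using assms by (simp_all add: row_inv_def)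

lemma ex_row: "a \<le> n \<Longrightarrow> \<exists>a'\<le>n. X(0 := a) = X(0 := a')" by blast

lemma wp_same_column:
  assumes r: "row_inv X X' s" and y: "vars s ''y'' = y" "y \<le> n"
    and Q: "\<And>s' t'. t' \<le> t + search_cost + 80 \<Longrightarrow> row_inv X X' s' \<Longrightarrow>
      lowered (code (X'(0 := y))) (arrs s ''D'') (arrs s' ''D'') \<Longrightarrow>
      (edge (X(0 := y)) (X'(0 := y)) \<Longrightarrow> settled (arrs s' ''D'') (X(0 := y)) (X'(0 := y))) \<Longrightarrow>
      (\<And>x. x \<notin> {''ok'', ''c'', ''u'', ''v''} \<Longrightarrow> vars s' x = vars s x) \<Longrightarrow>
      (\<And>a. a \<notin> {''lo'', ''hi'', ''D'', ''pr'', ''lb''} \<Longrightarrow> arrs s' a = arrs s a) \<Longrightarrow> Q s' t'"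
  shows "wp same_column_cmd Q s t"
proof -
  note R = row_invD[OF r]
  obtain a b where ab: "arrs s ''lo'' = X(0 := a)" "arrs s ''hi'' = X'(0 := b)" using R by blast
  have le: "X(0 := y) \<le> X'(0 := y)" using R(3) by (intro row_le) simp_all
  have vv: "X(0 := y) \<in> vecs" "X'(0 := y) \<in> vecs" using R y m_pos by (simp_all add: vecs_upd)
  show ?thesis
    unfolding same_column_cmd_def wp_Seq wp_Put
    apply (rule wp_search)
    subgoal using R by simp
    subgoal using ab vv y by simp
    subgoal using ab vv y by simp
    subgoal using ab le y by simp
    subgoal premises p for s1 t1
    proof -
      have fr: "arrs s1 ''lo'' = X(0 := y)" "arrs s1 ''hi'' = X'(0 := y)"
        using p(4) ab y by simp_all
      have fr2: "arrs s1 x = arrs s x" if "x \<notin> {''lo'', ''hi''}" for x using p(4) that by simp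
      have fr3: "vars s1 x = vars s x" if "x \<notin> {''ok'', ''c''}" for x using p(3) that by simp
      have r1: "row_inv X X' s1" using r y(2) unfolding row_inv_def
        by (simp add: fr fr2 fr3 ex_row)
      have t1: "t1 \<le> t + 6 + search_cost" using p(1) by simp
      show ?thesis
      proof (cases "vars s1 ''ok'' = 0")
        case True
        then have ne: "\<not> edge (X(0 := y)) (X'(0 := y))" using p(2) ab y by simp
        show ?thesis using True
          apply simp
          apply (rule Q)
          subgoal using t1 by simp
          subgoal by (rule r1)
          subgoal by (simp add: fr2 lowered_refl)
          subgoal using ne by simp
          subgoal using fr3 by simp
          subgoal using fr2 by simp
          done
      next
        case False
        then have st: "step (vars s1 ''c'') (X(0 := y)) (X'(0 := y))" using p(2) ab y by simp
        show ?thesis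
          apply (simp add: False)
          apply (rule wp_relax[where X = X and X' = X' and y = y and x = "X(0 := y)"])
          subgoal using R by simp
          subgoal using R by simp
          subgoal using R by simp
          subgoal using R(9) y by (simp add: fr2)
          subgoal using R(5) y code_upd0[of X y] by (simp add: fr3)
          subgoal using R(6) by (simp add: fr3)
          subgoal using y by (simp add: fr3)
          subgoal using st by simp
          subgoal premises w for s2 t2
          proof -
            have v2: "vars s2 x = vars s1 x" if "x \<notin> {''u'', ''v''}" for x using w(6) that by simp
            have a2: "arrs s2 x = arrs s1 x" if "x \<notin> {''D'', ''pr'', ''lb''}" for x using w(7) that by simp
            show ?thesis
              apply (rule Q)
              subgoal using w(1) t1 by simp
              subgoal using r1 w(2) y unfolding row_inv_def by (simp add: v2 a2 fr3)
              subgoal using w(4,5) by (simp add: lowered_def fr2)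
              subgoal by (rule w(3))
              subgoal using fr3 v2 by simp
              subgoal using fr2 a2 by simp
              done
          qed
          done
      qed
    qed
    done
qed

definition column_inv :: "(nat \<Rightarrow> nat) \<Rightarrow> (nat \<Rightarrow> nat) \<Rightarrow> store \<Rightarrow> bool" where
  "column_inv X X' s \<longleftrightarrow> row_inv X X' s \<and> vars s ''l'' \<le> vars s ''y'' \<and>
     (\<forall>a b. a < vars s ''l'' \<and> vars s ''y'' \<le> b \<and> b \<le> n \<longrightarrow> \<not> edge (X(0 := a)) (X'(0 := b))) \<and>
     deque (arrs s ''D'') (arrs s ''q'') (vars s ''h'') (vars s ''t'') (vars s ''bs'') (vars s ''l'') (vars s ''y'') 0"

lemma row_code_le:
  assumes "row_inv X X' s"
  shows "code (X(0 := a)) \<le> code (X'(0 := a))"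
  using row_invD(3)[OF assms] by (intro code_mono row_le) simp_all

text \<open>One relaxation settles the whole window: the front of the deque has the least value
  among the reached columns from \<open>l\<close> on. If the deque is empty, every column of the
  window is unreached and nothing has to be settled.\<close>

lemma wp_window:
  assumes r: "column_inv X X' s" and y: "vars s ''y'' = y" "y \<le> n"
    and Q: "\<And>s' t'. t' + unit_cost * (vars s ''l'' + vars s ''h'') \<le>
        t + unit_cost * (vars s' ''l'' + vars s' ''h'') + 2 * unit_cost \<Longrightarrow> column_inv X X' s' \<Longrightarrow>
      lowered (code (X'(0 := y))) (arrs s ''D'') (arrs s' ''D'') \<Longrightarrow>
      (\<And>a. a < y \<Longrightarrow> edge (X(0 := a)) (X'(0 := y)) \<Longrightarrow> settled (arrs s' ''D'') (X(0 := a)) (X'(0 := y))) \<Longrightarrow>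
      (\<And>x. x \<notin> {''ok'', ''c'', ''l'', ''h'', ''u'', ''v''} \<Longrightarrow> vars s' x = vars s x) \<Longrightarrow>
      (\<And>a. a \<notin> {''lo'', ''hi'', ''D'', ''pr'', ''lb''} \<Longrightarrow> arrs s' a = arrs s a) \<Longrightarrow> Q s' t'"
  shows "wp window_cmd Q s t"
proof -
  have r0: "row_inv X X' s" using r by (simp add: column_inv_def)
  note R = row_invD[OF r0]
  let ?b = "code (X(0 := 0))"
  show ?thesis
    unfolding window_cmd_def wp_Seq wp_Assign
    apply (rule wp_advance[where X = X and X' = X'])
    subgoal using R by simp
    subgoal using R by simp
    subgoal using R by simp
    subgoal using R by simp
    subgoal using R by simp
    subgoal using R by simp
    subgoal by simp
    subgoal using r by (simp add: column_inv_def)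
    subgoal using y by simp
    subgoal using r by (simp add: column_inv_def)
    subgoal premises p for s1 t1
    proof -
      have v1: "vars s1 x = vars s x" if "x \<notin> {''ok'', ''c'', ''l''}" for x using p(8) that by simp
      have a1: "arrs s1 x = arrs s x" if "x \<notin> {''lo'', ''hi''}" for x using p(9) that by simp
      have le1: "vars s ''l'' \<le> vars s1 ''l''" "vars s1 ''l'' \<le> y" using p(4,5) y by simp_all
      have no1: "\<not> edge (X(0 := a)) (X'(0 := b))" if "a < vars s1 ''l''" "y \<le> b" "b \<le> n" for a b
        using p(6) that y by simp
      have st1: "step (vars s1 ''c'') (X(0 := vars s1 ''l'')) (X'(0 := y))" if "vars s1 ''l'' < y"
        using p(7) that y by simp
      have t1: "t1 + unit_cost * vars s ''l'' \<le> t + unit_cost * vars s1 ''l'' + unit_cost + 9"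
        using p(1) by simp
      have d1: "deque (arrs s ''D'') (arrs s1 ''q'') (vars s1 ''h'') (vars s1 ''t'') (vars s1 ''bs'') (vars s1 ''l'') y 0"
        using r y deque_advance[OF _ le1(1)] by (simp add: column_inv_def v1 a1)
      show ?thesis
        apply (rule wp_pop_front[OF d1, of unit_cost])
        subgoal by (simp add: unit_cost_def)
        subgoal premises p2 for s2 t2
        proof -
          have v2: "vars s2 x = vars s1 x" if "x \<noteq> ''h''" for x using p2(4) that by simp
          have v3: "vars s2 x = vars s x" if "x \<notin> {''ok'', ''c'', ''l'', ''h''}" for x using v1 v2 that by simp
          have a3: "arrs s2 x = arrs s x" if "x \<notin> {''lo'', ''hi''}" for x using p2(5) a1 that by simp
          have rows: "\<exists>a\<le>n. arrs s2 ''lo'' = X(0 := a)" "\<exists>b\<le>n. arrs s2 ''hi'' = X'(0 := b)"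
            using p(2,3) p2(5) by simp_all
          have r2: "row_inv X X' s2" using r0 rows unfolding row_inv_def by (simp add: v3 a3)
          have d2: "deque (arrs s ''D'') (arrs s ''q'') (vars s2 ''h'') (vars s ''t'') ?b (vars s1 ''l'') y 0"
            using p2(2) R by (simp add: v1 a1)
          have t2: "t2 + unit_cost * (vars s ''l'' + vars s ''h'') \<le>
              t + unit_cost * (vars s2 ''l'' + vars s2 ''h'') + unit_cost + 19"
            using t1 p2(1) v2[of "''l''"] v1[of "''h''"] by (simp add: algebra_simps)
          have l2: "vars s2 ''l'' = vars s1 ''l''" using v2 by simp
          have b: "?b + z = code (X(0 := z))" for z using code_upd0[of X z] by simp
          show ?thesis
          proof (cases "vars s2 ''h'' < vars s ''t''")
            case False
            have none: "settled (arrs s ''D'') (X(0 := a)) (X'(0 := y))"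
              if "a < y" "edge (X(0 := a)) (X'(0 := y))" for a
            proof -
              have "vars s1 ''l'' \<le> a" using no1[of a y] that y by (meson not_le order_refl)
              then have "arrs s ''D'' (?b + a) = 0" using deque_front[OF d2 _ that(1)] False by blast
              then show ?thesis by (simp add: settled_def b)
            qed
            show ?thesis using False
              apply (simp add: v3)
              apply (rule Q)
              subgoal using t2 by (simp add: unit_cost_def)
              subgoal using r2 d2 R le1 no1 y by (simp add: column_inv_def v3 a3 l2)
              subgoal by (simp add: a3 lowered_refl)
              subgoal using none by (simp add: a3)
              subgoal using v3 by simp
              subgoal using a3 by simp
              done
          next
            case True
            define f where "f = arrs s ''q'' (vars s2 ''h'')"
            have f: "?b + vars s1 ''l'' \<le> f" "f < ?b + y" "arrs s ''D'' f \<noteq> 0"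
              using p2(3) True R dequeD(2)[OF d2, of "vars s2 ''h''"] by (simp_all add: f_def v1 a1)
            define z where "z = f - ?b"
            have z: "f = code (X(0 := z))" "vars s1 ''l'' \<le> z" "z < y" using f b[of z] by (simp_all add: z_def)
            \<comment> \<open>The search succeeded for source column \<open>l\<close>; monotonicity
              carries its criterion over to the front column \<open>z \<ge> l\<close>, so no further
              check is made.\<close>
            have "step (vars s1 ''c'') (X(0 := vars s1 ''l'')) (X'(0 := y))" using st1 z by simp
            then have st: "step (vars s1 ''c'') (X(0 := z)) (X'(0 := y))"
              using z by (intro step_shrink[of "vars s1 ''c''" X "vars s1 ''l''" X' y z y]) simp_all
            show ?thesis
              apply (simp add: v3 True)
              apply (rule wp_relax[where X = X and X' = X' and y = y and x = "X(0 := z)"])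
              subgoal using R by simp
              subgoal using R by simp
              subgoal using R by simp
              subgoal using R(9) y by (simp add: a3)
              subgoal using z(1) by (simp add: a3 f_def)
              subgoal using R(6) by (simp add: v3)
              subgoal using y by (simp add: v3)
              subgoal using st by (simp add: v2)
              subgoal premises w for s3 t3
              proof -
                have v4: "vars s3 x = vars s2 x" if "x \<notin> {''u'', ''v''}" for x using w(6) that by simp
                have a4: "arrs s3 x = arrs s2 x" if "x \<notin> {''D'', ''pr'', ''lb''}" for x using w(7) that by simp
                have eqD: "arrs s3 ''D'' x = arrs s ''D'' x" if "x < ?b + y" for x
                proof -
                  have "x < code (X'(0 := y))" using that row_code_le[OF r0, of y] b[of y] by simp
                  then show ?thesis using w(4)[of x] by (simp add: a3)
                qed
                have d3: "deque (arrs s3 ''D'') (arrs s ''q'') (vars s2 ''h'') (vars s ''t'') ?b (vars s1 ''l'') y 0"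
                  using deque_cong[OF d2] eqD by blast
                have all: "settled (arrs s3 ''D'') (X(0 := a)) (X'(0 := y))"
                  if "a < y" "edge (X(0 := a)) (X'(0 := y))" for a
                proof (cases "arrs s3 ''D'' (?b + a) = 0")
                  case True then show ?thesis by (simp add: settled_def b)
                next
                  case False
                  have "vars s1 ''l'' \<le> a" using no1[of a y] that y by (meson not_le order_refl)
                  then have "arrs s3 ''D'' f \<le> arrs s3 ''D'' (?b + a)"
                    using deque_front[OF d3 _ that(1) False] by (simp add: f_def)
                  moreover have "arrs s3 ''D'' f \<noteq> 0" using eqD[OF f(2)] f(3) by simp
                  ultimately show ?thesis using w(3) by (auto simp: settled_def b z(1))
                qed
                show ?thesis
                  apply (rule Q)
                  subgoal using t2 w(1) by (simp add: v4 unit_cost_def)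
                  subgoal using r2 w(2) d3 R le1 no1 y by (simp add: column_inv_def row_inv_def v4 a4 v3 a3 l2)
                  subgoal using w(4,5) by (simp add: lowered_def a3)
                  subgoal using all by simp
                  subgoal using v3 v4 by simp
                  subgoal using a3 a4 by simp
                  done
              qed
              done
          qed
        qed
        done
    qed
    done
qed

lemma wp_column:
  assumes r: "column_inv X X' s" and y: "vars s ''y'' = y" "y \<le> n"
    and Q: "\<And>s' t'. t' + unit_cost * (vars s ''l'' + vars s ''h'' + vars s' ''t'') \<le>
        t + unit_cost * (vars s' ''l'' + vars s' ''h'' + vars s ''t'') + 6 * unit_cost \<Longrightarrow>
      column_inv X X' s' \<Longrightarrow> vars s' ''y'' = Suc y \<Longrightarrow> Q s' t'"
  shows "wp column_cmd Q s t"
proof -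
  have r0: "row_inv X X' s" using r by (simp add: column_inv_def)
  note R = row_invD[OF r0]
  have b: "vars s ''bs'' + z = code (X(0 := z))" for z using code_upd0[of X z] R by simp
  have far: "x \<noteq> code (X'(0 := y))" if "x < vars s ''bs'' + y" for x
    using that row_code_le[OF r0, of y] b[of y] by simp
  show ?thesis
    unfolding column_cmd_def wp_Seq
    apply (rule wp_same_column[OF r0 y])
    subgoal premises p for s1 t1
    proof -
      have v1: "vars s1 x = vars s x" if "x \<notin> {''ok'', ''c'', ''u'', ''v''}" for x using p(5) that by simp
      have a1: "arrs s1 x = arrs s x" if "x \<notin> {''lo'', ''hi'', ''D'', ''pr'', ''lb''}" for x using p(6) that by simp
      have d1: "deque (arrs s1 ''D'') (arrs s ''q'') (vars s ''h'') (vars s ''t'') (vars s ''bs'') (vars s ''l'') y 0"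
        by (rule deque_cong[of "arrs s ''D''"]) (use r y p(3) far in \<open>simp_all add: column_inv_def lowered_def\<close>)
      have c1: "column_inv X X' s1" using r p(2) d1 y by (simp add: column_inv_def v1 a1)
      have y1: "vars s1 ''y'' = y" using y v1 by simp
      show ?thesis
        apply (rule wp_window[OF c1 y1 y(2)])
        subgoal premises p2 for s2 t2
        proof -
          have v2: "vars s2 x = vars s1 x" if "x \<notin> {''ok'', ''c'', ''l'', ''h'', ''u'', ''v''}" for x using p2(5) that by simp
          have y2: "vars s2 ''y'' = y" using y1 v2 by simp
          have r2: "row_inv X X' s2" using p2(2) by (simp add: column_inv_def)
          have settled: "settled (arrs s2 ''D'') (X(0 := a)) (X'(0 := y))"
            if "a \<le> y" "edge (X(0 := a)) (X'(0 := y))" for a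
          proof (cases "a = y")
            case True
            then have "settled (arrs s1 ''D'') (X(0 := a)) (X'(0 := y))" using p(4) that by simp
            then show ?thesis by (rule settled_decrease) (use p2(3) in \<open>simp_all add: lowered_def\<close>)
          qed (use p2(4) that in simp)
          have ok: "table_ok (arrs s2 ''D'') (arrs s2 ''pr'') (arrs s2 ''lb'') (done_before (key X X') (Suc y))"
            using row_invD[OF r2] settled y2 by (intro table_ok_next_column) simp_all
          have d2: "deque (arrs s2 ''D'') (arrs s2 ''q'') (vars s2 ''h'') (vars s2 ''t'') (vars s2 ''bs'') (vars s2 ''l'') (vars s2 ''y'') 0"
            using p2(2) by (simp add: column_inv_def)
          show ?thesis
            apply (rule wp_push[OF d2, of unit_cost])
            subgoal by (simp add: unit_cost_def)
            subgoal premises p3 for s3 t3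
            proof -
              have v3: "vars s3 x = vars s2 x" if "x \<notin> {''t'', ''z''}" for x using p3(3) that by simp
              have a3: "arrs s3 x = arrs s2 x" if "x \<noteq> ''q''" for x using p3(4) that by simp
              have "t1 \<le> t + search_cost + 80" using p(1) .
              then have time: "t3 + 4 + unit_cost * (vars s ''l'' + vars s ''h'' + vars s3 ''t'') \<le>
                  t + unit_cost * (vars s2 ''l'' + vars s2 ''h'' + vars s ''t'') + 6 * unit_cost"
                using p2(1) p3(1) v1[of "''t''"] v1[of "''l''"] v1[of "''h''"] v2[of "''t''"]
                by (simp add: algebra_simps unit_cost_def)
              have "row_inv X X' (set_var ''y'' (Suc y) s3)"
                using r2 ok unfolding row_inv_def by (simp add: v3 a3)
              then have "column_inv X X' (set_var ''y'' (Suc y) s3)"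
                using p2(2) p3(2) y2 by (simp add: column_inv_def v3 a3)
              then show ?thesis using time y2
                by (simp add: v3) (rule Q; simp add: v3)
            qed
            done
        qed
        done
    qed
    done
qed

lemma table_ok_mono:
  assumes "table_ok D pr lb d" "\<And>c x y. step c x y \<Longrightarrow> d' x y \<Longrightarrow> d x y"
  shows "table_ok D pr lb d'"
  using assms unfolding table_ok_def by blast

lemma wp_process:
  assumes v: "vars s ''k'' = k" "vars s ''n'' = n" "vars s ''bs'' = code ((arrs s ''lo'')(0 := 0))"
      "vars s ''bt'' = code ((arrs s ''hi'')(0 := 0))"
    and X: "arrs s ''lo'' \<in> vecs" "arrs s ''hi'' \<in> vecs" "\<And>i. i > 0 \<Longrightarrow> arrs s ''lo'' i \<le> arrs s ''hi'' i"
    and ok: "table_ok (arrs s ''D'') (arrs s ''pr'') (arrs s ''lb'') (done_before (key (arrs s ''lo'') (arrs s ''hi'')) 0)"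
    and Q: "\<And>s' t' a b. t' \<le> t + 8 * unit_cost * Suc n + 20 \<Longrightarrow> a \<le> n \<Longrightarrow> b \<le> n \<Longrightarrow>
      arrs s' ''lo'' = (arrs s ''lo'')(0 := a) \<Longrightarrow> arrs s' ''hi'' = (arrs s ''hi'')(0 := b) \<Longrightarrow>
      table_ok (arrs s' ''D'') (arrs s' ''pr'') (arrs s' ''lb'') (done_before (Suc (key (arrs s ''lo'') (arrs s ''hi''))) 0) \<Longrightarrow>
      (\<And>x. x \<notin> {''ok'', ''c'', ''l'', ''u'', ''v'', ''h'', ''t'', ''z'', ''y''} \<Longrightarrow> vars s' x = vars s x) \<Longrightarrow>
      (\<And>a. a \<notin> {''lo'', ''hi'', ''D'', ''pr'', ''lb'', ''q''} \<Longrightarrow> arrs s' a = arrs s a) \<Longrightarrow> Q s' t'"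
  shows "wp process_cmd Q s t"
proof -
  define X X' where "X = arrs s ''lo''" and "X' = arrs s ''hi''"
  \<comment> \<open>Seven units per column instead of the six of \<open>wp_column\<close>: the
    seventh pays for the loop test.\<close>
  let ?I = "\<lambda>s' t'. column_inv X X' s' \<and> vars s' ''y'' \<le> Suc n \<and>
     t' + unit_cost * vars s' ''t'' \<le> t + 8 + unit_cost * (7 * vars s' ''y'' + vars s' ''l'' + vars s' ''h'')"
  have *: "wp process_cmd (\<lambda>s' t'. column_inv X X' s' \<and> vars s' ''y'' = Suc n \<and>
      t' + unit_cost * vars s' ''t'' \<le> t + 14 + unit_cost * (7 * Suc n + vars s' ''l'' + vars s' ''h'')) s t"
    unfolding process_cmd_def wp_Seq wp_Assign
  proof (rule wp_While[where I = ?I and \<mu> = "\<lambda>s'. Suc n - vars s' ''y''"], goal_cases)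
    case 1
    have "\<exists>a\<le>n. X = X(0 := a)" "\<exists>a\<le>n. X' = X'(0 := a)"
      using vecs_le[OF X(1), of 0] vecs_le[OF X(2), of 0]
      by (metis X_def fun_upd_triv, metis X'_def fun_upd_triv)
    then show ?case
      using v X ok by (simp add: column_inv_def row_inv_def deque_def flip: X_def X'_def)
  next
    case (2 s' t')
    have n: "vars s' ''n'' = n" using 2(3) v by simp
    have y: "vars s' ''y'' \<le> n" using 2(2) n by simp
    have c: "column_inv X X' s'" using 2(1) by simp
    show ?case
    proof (rule wp_column[OF c refl y], goal_cases)
      case (1 s2 t2)
      have "5 \<le> unit_cost" by (simp add: unit_cost_def)
      then show ?case using 1 2(1) y by (simp add: algebra_simps)
    qed
  next
    case (3 s' t')
    have n: "vars s' ''n'' = n" using 3(3) v by simp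
    have "vars s' ''y'' = Suc n" using 3(1,2) n by simp
    then show ?case using 3(1) by simp
  qed
  show ?thesis
  proof (rule wp_unmodified[OF *], goal_cases)
    case (1 s' t')
    have y: "vars s' ''y'' = Suc n" and c: "column_inv X X' s'" and
      t: "t' + unit_cost * vars s' ''t'' \<le> t + 14 + unit_cost * (7 * Suc n + vars s' ''l'' + vars s' ''h'')"
      using 1(1) by blast+
    have r: "row_inv X X' s'" using c by (simp add: column_inv_def)
    note R = row_invD[OF r]
    obtain a b where ab: "a \<le> n" "arrs s' ''lo'' = X(0 := a)" "b \<le> n" "arrs s' ''hi'' = X'(0 := b)"
      using R by blast
    \<comment> \<open>Here the potentials are cashed in: \<open>h \<le> t\<close> cancels the deque
      pointers, and \<open>l \<le> n + 1\<close> adds one more unit per column, which gives the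
      factor \<open>8\<close>.\<close>
    have "vars s' ''l'' \<le> Suc n" "vars s' ''h'' \<le> vars s' ''t''"
      using c y dequeD(1) by (auto simp: column_inv_def)
    then have "unit_cost * (7 * Suc n + vars s' ''l'' + vars s' ''h'') \<le> unit_cost * (8 * Suc n + vars s' ''t'')"
      by (intro mult_left_mono) simp_all
    with t have t2: "t' \<le> t + 8 * unit_cost * Suc n + 20" by (simp add: algebra_simps)
    \<comment> \<open>The final \<open>y = n + 1\<close> exceeds every column, so all steps between
      the two rows count as done.\<close>
    have "table_ok (arrs s' ''D'') (arrs s' ''pr'') (arrs s' ''lb'') (done_before (Suc (key X X')) 0)"
    proof (rule table_ok_mono[OF R(9)])
      fix c x z assume st: "step c x z" and "done_before (Suc (key X X')) 0 x z"
      then show "done_before (key X X') (vars s' ''y'') x z"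
        using vecs_le[of z 0] step_vecs[OF st] y by (auto simp: done_before_def)
    qed
    then show ?case
      using t2 ab unfolding X_def X'_def
      apply (intro Q[of t' a b s'])
      subgoal by simp
      subgoal by simp
      subgoal by simp
      subgoal by simp
      subgoal by simp
      subgoal by simp
      subgoal using 1(2) by simp
      subgoal using 1(3) by simp
      done
  qed
qed

subsection \<open>Enumerating all pairs of rows\<close>

definition pair_inv :: "store \<Rightarrow> bool" where
  "pair_inv s \<longleftrightarrow> vars s ''m'' = m \<and> vars s ''n'' = n \<and> (\<forall>i\<le>m. arrs s ''st'' i = Suc n ^ i) \<and>
     arrs s ''lo'' \<in> vecs \<and> arrs s ''hi'' \<in> vecs \<and> (\<forall>i>0. arrs s ''lo'' i \<le> arrs s ''hi'' i) \<and>
     vars s ''bs'' = code ((arrs s ''lo'')(0 := 0)) \<and> vars s ''bt'' = code ((arrs s ''hi'')(0 := 0)) \<and>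
     (\<forall>i. 0 < i \<and> i < m \<longrightarrow> arrs s ''off'' i = arrs s ''lo'' i * Suc n ^ i)"

abbreviation "digits s \<equiv> pair_sum (\<lambda>_. 1) (arrs s ''lo'') (arrs s ''hi'')"

abbreviation "skey s \<equiv> key (arrs s ''lo'') (arrs s ''hi'')"

lemma code_row_upd:
  assumes "Suc j < m"
  shows "code (x(Suc j := a, 0 := 0)) + x (Suc j) * Suc n ^ Suc j = code (x(0 := 0)) + a * Suc n ^ Suc j"
  using code_upd[of "Suc j" "x(0 := 0)" a] assms by (simp add: fun_upd_twist)

text \<open>The \<open>j\<close> digits carried over all have the value
  \<open>triangle n + n\<close>, one less than the base. Resetting them takes
  \<open>triangle (Suc n) ^ j - 1\<close> off the key and \<open>j * (triangle n + n)\<close> off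
  the digit sum; the additive form avoids truncated subtraction.\<close>

lemma wp_carry:
  assumes inv: "pair_inv s" and i: "vars s ''i'' = 1"
    and Q: "\<And>s' t' j. pair_inv s' \<Longrightarrow> vars s' ''i'' = Suc j \<Longrightarrow> j \<le> m - 1 \<Longrightarrow>
      (Suc j < m \<Longrightarrow> arrs s' ''lo'' (Suc j) < n) \<Longrightarrow>
      skey s' + triangle (Suc n) ^ j = Suc (skey s) \<Longrightarrow>
      digits s' + j * (triangle n + n) = digits s \<Longrightarrow>
      (j = m - 1 \<Longrightarrow> skey s' = 0) \<Longrightarrow>
      t' \<le> t + 40 * j + 8 \<Longrightarrow>
      (\<And>x. x \<notin> {''bs'', ''bt'', ''i''} \<Longrightarrow> vars s' x = vars s x) \<Longrightarrow>
      (\<And>a. a \<notin> {''off'', ''lo'', ''hi''} \<Longrightarrow> arrs s' a = arrs s a) \<Longrightarrow> Q s' t'"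
  shows "wp carry_cmd Q s t"
proof -
  let ?I = "\<lambda>s' t'. pair_inv s' \<and> (\<exists>j. vars s' ''i'' = Suc j \<and> j \<le> m - 1 \<and>
      skey s' + triangle (Suc n) ^ j = Suc (skey s) \<and>
      digits s' + j * (triangle n + n) = digits s \<and>
      (\<forall>i. 0 < i \<and> i \<le> j \<longrightarrow> arrs s' ''lo'' i = 0 \<and> arrs s' ''hi'' i = 0) \<and> t' \<le> t + 40 * j)"
  have T: "triangle (Suc n) = Suc (triangle n + n)" by (simp add: triangle_Suc)
  show ?thesis
    unfolding carry_cmd_def
  proof (rule wp_While[where I = ?I and \<mu> = "\<lambda>s'. m - vars s' ''i''"], goal_cases)
    case 1
    show ?case using inv i by (intro conjI exI[of _ 0]) simp_all
  next
    case (2 s' t')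
    then obtain j where j: "vars s' ''i'' = Suc j" "skey s' + triangle (Suc n) ^ j = Suc (skey s)"
        "digits s' + j * (triangle n + n) = digits s" "t' \<le> t + 40 * j"
        "\<And>i. 0 < i \<Longrightarrow> i \<le> j \<Longrightarrow> arrs s' ''lo'' i = 0 \<and> arrs s' ''hi'' i = 0" and p: "pair_inv s'"
      by blast
    define x y where "x = arrs s' ''lo''" and "y = arrs s' ''hi''"
    have P: "vars s' ''m'' = m" "vars s' ''n'' = n" "x \<in> vecs" "y \<in> vecs" "\<And>i. i > 0 \<Longrightarrow> x i \<le> y i"
      "vars s' ''bs'' = code (x(0 := 0))" "vars s' ''bt'' = code (y(0 := 0))"
      "\<And>i. 0 < i \<Longrightarrow> i < m \<Longrightarrow> arrs s' ''off'' i = x i * Suc n ^ i"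
      using p by (simp_all add: pair_inv_def x_def y_def)
    have jm: "Suc j < m" and xn: "x (Suc j) = n" using 2(2) j(1) P(1,2) by (simp_all add: x_def)
    have yn: "y (Suc j) = n" using P(5)[of "Suc j"] xn vecs_le[OF P(4), of "Suc j"] by simp
    have off: "arrs s' ''off'' (Suc j) = n * Suc n ^ Suc j" using P(8)[of "Suc j"] jm xn by simp
    have bs: "vars s' ''bs'' - n * Suc n ^ Suc j = code (x(Suc j := 0, 0 := 0))"
      using code_row_upd[OF jm, of x 0] P(6) xn by simp
    have bt: "vars s' ''bt'' - n * Suc n ^ Suc j = code (y(Suc j := 0, 0 := 0))"
      using code_row_upd[OF jm, of y 0] P(7) yn by simp
    let ?s = "set_var ''i'' (Suc (Suc j)) (set_arr ''hi'' (Suc j) 0 (set_arr ''lo'' (Suc j) 0 (set_arr ''off'' (Suc j) 0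
      (set_var ''bt'' (vars s' ''bt'' - n * Suc n ^ Suc j) (set_var ''bs'' (vars s' ''bs'' - n * Suc n ^ Suc j) s')))))"
    have p': "pair_inv ?s" using p bs bt jm unfolding pair_inv_def
      by (simp add: x_def y_def vecs_upd del: power_Suc)
    have up: "pair_sum g (x(Suc j := 0)) (y(Suc j := 0)) + (triangle n + n) * g j = pair_sum g x y" for g
      using pair_sum_upd[OF jm, of g x 0 y 0] xn yn by (simp add: triangle_def)
    have k': "skey ?s + triangle (Suc n) ^ Suc j = Suc (skey s)"
      using up[of "\<lambda>i. triangle (Suc n) ^ i"] j(2) by (simp add: T algebra_simps flip: x_def y_def)
    have d': "digits ?s + Suc j * (triangle n + n) = digits s"
      using up[of "\<lambda>_. 1"] j(3) by (simp add: algebra_simps flip: x_def y_def)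
    have z': "arrs ?s ''lo'' i = 0 \<and> arrs ?s ''hi'' i = 0" if "0 < i" "i \<le> Suc j" for i
      using j(5)[of i] that by (cases "i = Suc j") simp_all
    have "?I ?s (t' + 31)"
      using p' k' d' z' jm j(4) by (intro conjI exI[of _ "Suc j"]) (auto simp del: power_Suc mult_Suc)
    moreover have "m - Suc (Suc j) < m - Suc j" using jm by simp
    ultimately show ?case using j(1) off
      by (simp del: power_Suc mult_Suc add: numeral_eq_Suc)
  next
    case (3 s' t')
    then obtain j where j: "vars s' ''i'' = Suc j" "j \<le> m - 1" "skey s' + triangle (Suc n) ^ j = Suc (skey s)"
        "digits s' + j * (triangle n + n) = digits s" "t' \<le> t + 40 * j"
        "\<And>i. 0 < i \<Longrightarrow> i \<le> j \<Longrightarrow> arrs s' ''lo'' i = 0 \<and> arrs s' ''hi'' i = 0" and p: "pair_inv s'"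
      by blast
    have "skey s' = 0" if "j = m - 1"
      using j(6) that unfolding pair_sum_def by (intro sum.neutral) (simp add: triangle_def)
    moreover have "arrs s' ''lo'' (Suc j) < n" if "Suc j < m"
    proof -
      have "arrs s' ''lo'' (Suc j) \<noteq> n" using 3(2) that j(1) p by (simp add: pair_inv_def)
      moreover have "arrs s' ''lo'' (Suc j) \<le> n" using p vecs_le by (simp add: pair_inv_def)
      ultimately show ?thesis by simp
    qed
    ultimately show ?case
      using j p 3(3,4) by (intro Q[of s' j]) simp_all
  qed
qed

text \<open>The potential of the odometer is its digit sum: a carry over \<open>j\<close> digits
  costs \<open>O(j)\<close> and releases at least \<open>j\<close>. The final overflow is charged
  directly as \<open>40 * m\<close>.\<close>

lemma wp_next_pair:
  assumes inv: "pair_inv s" and go: "vars s ''go'' = 1"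
    and Q: "\<And>s' t'.
      (vars s' ''go'' = 1 \<and> pair_inv s' \<and> skey s' = Suc (skey s) \<and> t' + 40 * digits s' \<le> t + 40 * digits s + 120) \<or>
      (vars s' ''go'' = 0 \<and> Suc (skey s) = triangle (Suc n) ^ (m - 1) \<and> t' \<le> t + 40 * m + 120) \<Longrightarrow>
      (\<And>x. x \<notin> {''bs'', ''bt'', ''i'', ''go''} \<Longrightarrow> vars s' x = vars s x) \<Longrightarrow>
      (\<And>a. a \<notin> {''off'', ''lo'', ''hi''} \<Longrightarrow> arrs s' a = arrs s a) \<Longrightarrow> Q s' t'"
  shows "wp next_pair_cmd Q s t"
proof -
  have p0: "pair_inv (set_var ''i'' 1 s)" using inv by (simp add: pair_inv_def)
  show ?thesis
    unfolding next_pair_cmd_def wp_Seq wp_Assign aval.simps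
  proof (rule wp_carry[OF p0], goal_cases)
    case 1 show ?case by simp
  next
    case (2 s1 t1 j)
    have v1: "vars s1 x = vars s x" if "x \<notin> {''bs'', ''bt'', ''i''}" for x using 2(9) that by simp
    have a1: "arrs s1 x = arrs s x" if "x \<notin> {''off'', ''lo'', ''hi''}" for x using 2(10) that by simp
    have j: "vars s1 ''i'' = Suc j" "j \<le> m - 1" and p: "pair_inv s1" by fact+
    have k1: "skey s1 + triangle (Suc n) ^ j = Suc (skey s)" using 2(5) by simp
    have d1: "digits s1 + j * (triangle n + n) = digits s" using 2(6) by simp
    have t1: "t1 \<le> t + 40 * j + 10" using 2(8) by simp
    define x y where "x = arrs s1 ''lo''" and "y = arrs s1 ''hi''"
    have P: "vars s1 ''m'' = m" "vars s1 ''n'' = n" "x \<in> vecs" "y \<in> vecs" "\<And>i. i > 0 \<Longrightarrow> x i \<le> y i"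
      "vars s1 ''bs'' = code (x(0 := 0))" "vars s1 ''bt'' = code (y(0 := 0))"
      "\<And>i. 0 < i \<Longrightarrow> i < m \<Longrightarrow> arrs s1 ''off'' i = x i * Suc n ^ i"
      "\<And>i. i \<le> m \<Longrightarrow> arrs s1 ''st'' i = Suc n ^ i"
      using p by (simp_all add: pair_inv_def x_def y_def)
    show ?case
    proof (cases "Suc j < m")
      case False
      then have jm: "j = m - 1" using j(2) by simp
      then have e: "Suc (skey s) = triangle (Suc n) ^ (m - 1)" using k1 2(7) by simp
      show ?thesis using False
        apply (simp add: j(1) P(1))
        apply (rule Q)
        subgoal using t1 e jm by simp
        subgoal using v1 by simp
        subgoal using a1 by simp
        done
    next
      case True
      have xn: "x (Suc j) < n" using 2(4) True by (simp add: x_def)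
      \<comment> \<open>An entry below \<open>n\<close> exists, so \<open>n > 0\<close> and each
        carried digit releases at least one unit. For \<open>n = 0\<close> every carry runs to the
        overflow and belongs to the other case.\<close>
      have "j * 1 \<le> j * (triangle n + n)" using xn by (intro mult_left_mono) simp_all
      then have jd: "j + digits s1 \<le> digits s" using d1 by linarith
      have off: "arrs s1 ''off'' (Suc j) = x (Suc j) * Suc n ^ Suc j" using P(8) True by simp
      have st: "arrs s1 ''st'' (Suc j) = Suc n ^ Suc j" using P(9)[of "Suc j"] True by simp
      show ?thesis
      proof (cases "x (Suc j) < y (Suc j)")
        case lt: True
        let ?a = "Suc (x (Suc j))"
        let ?s = "set_var ''bs'' (vars s1 ''bs'' + Suc n ^ Suc j) (set_arr ''off'' (Suc j) (arrs s1 ''off'' (Suc j) + Suc n ^ Suc j)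
          (set_arr ''lo'' (Suc j) ?a s1))"
        have le: "(x(Suc j := ?a)) i \<le> y i" if "i > 0" for i using P(5)[OF that] lt by simp
        have xv: "x(Suc j := ?a) \<in> vecs" using vecs_upd P(3) True xn by simp
        have bs: "vars s1 ''bs'' + Suc n ^ Suc j = code (x(Suc j := ?a, 0 := 0))"
          using code_row_upd[OF True, of x ?a] P(6) by (simp add: algebra_simps)
        have p': "pair_inv ?s" using p le xv bs off unfolding pair_inv_def
          by (simp del: power_Suc flip: x_def y_def)
        have up: "pair_sum g (x(Suc j := ?a)) y = pair_sum g x y + g j" for g
          using pair_sum_upd[OF True, of g x ?a y "y (Suc j)"] by (simp add: algebra_simps)
        have k': "skey ?s = Suc (skey s)" "digits ?s = Suc (digits s1)"
          using up[of "\<lambda>i. triangle (Suc n) ^ i"] up[of "\<lambda>_. 1"] k1 by (simp_all flip: x_def y_def)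
        have gos: "vars ?s ''go'' = 1" using v1 go by simp
        have "Q ?s (t1 + 26)"
          apply (rule Q)
          subgoal using gos p' k' jd t1 by (intro disjI1 conjI) linarith+
          subgoal using v1 by simp
          subgoal using a1 by simp
          done
        then show ?thesis using True lt st
          by (simp add: j(1) P(1) numeral_eq_Suc del: power_Suc flip: x_def y_def)
      next
        case ge: False
        then have eq: "y (Suc j) = x (Suc j)" using P(5)[of "Suc j"] by simp
        let ?b = "Suc (x (Suc j))"
        let ?s = "set_var ''bt'' (vars s1 ''bt'' + Suc n ^ Suc j) (set_arr ''hi'' (Suc j) ?b
          (set_arr ''lo'' (Suc j) 0 (set_arr ''off'' (Suc j) 0
          (set_var ''bs'' (vars s1 ''bs'' - arrs s1 ''off'' (Suc j)) s1))))"
        have le: "(x(Suc j := 0)) i \<le> (y(Suc j := ?b)) i" if "i > 0" for i using P(5)[OF that] by simp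
        have xv: "x(Suc j := 0) \<in> vecs" "y(Suc j := ?b) \<in> vecs" using vecs_upd P(3,4) True xn by simp_all
        have bs: "vars s1 ''bs'' - arrs s1 ''off'' (Suc j) = code (x(Suc j := 0, 0 := 0))"
          using code_row_upd[OF True, of x 0] P(6) off by simp
        have bt: "vars s1 ''bt'' + Suc n ^ Suc j = code (y(Suc j := ?b, 0 := 0))"
          using code_row_upd[OF True, of y ?b] P(7) eq by (simp add: algebra_simps)
        have p': "pair_inv ?s" using p le xv bs bt unfolding pair_inv_def
          by (simp del: power_Suc flip: x_def y_def)
        have up: "pair_sum g (x(Suc j := 0)) (y(Suc j := ?b)) = pair_sum g x y + g j" for g
          using pair_sum_upd[OF True, of g x 0 y ?b] eq by (simp add: algebra_simps triangle_Suc)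
        have k': "skey ?s = Suc (skey s)" "digits ?s = Suc (digits s1)"
          using up[of "\<lambda>i. triangle (Suc n) ^ i"] up[of "\<lambda>_. 1"] k1 by (simp_all flip: x_def y_def)
        have gos: "vars ?s ''go'' = 1" using v1 go by simp
        have "Q ?s (t1 + 30)"
          apply (rule Q)
          subgoal using gos p' k' jd t1 by (intro disjI1 conjI) linarith+
          subgoal using v1 by simp
          subgoal using a1 by simp
          done
        then show ?thesis using True ge st eq
          by (simp add: j(1) P(1) numeral_eq_Suc del: power_Suc flip: x_def y_def)
      qed
    qed
  qed
qed

definition "pair_cost = 8 * unit_cost * Suc n + 200"

lemma wp_search_all:
  assumes inv: "pair_inv s" and k: "vars s ''k'' = k" and D: "arrs s ''D'' = (\<lambda>_. 0)(0 := 1)"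
    and zero: "arrs s ''lo'' = (\<lambda>_. 0)" "arrs s ''hi'' = (\<lambda>_. 0)"
    and Q: "\<And>s' t'. table_ok (arrs s' ''D'') (arrs s' ''pr'') (arrs s' ''lb'') (\<lambda>_ _. True) \<Longrightarrow>
      t' \<le> t + (if k = 0 then 0 else triangle (Suc n) ^ (m - 1) * pair_cost) + 40 * m + 300 \<Longrightarrow>
      vars s' ''m'' = m \<Longrightarrow> arrs s' ''st'' = arrs s ''st'' \<Longrightarrow> arrs s' ''label'' = arrs s ''label'' \<Longrightarrow>
      vars s' ''found'' = vars s ''found'' \<Longrightarrow> Q s' t'"
  shows "wp search_all_cmd Q s t"
proof -
  have code0: "x = (\<lambda>_. 0)" if "x \<in> vecs" "code x = 0" for x
    using code_inj[OF that(1) zero_vecs] that(2) code_zero by simp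
  have ok0: "table_ok (arrs s ''D'') (arrs s ''pr'') (arrs s ''lb'') d" if "\<And>c x y. step c x y \<Longrightarrow> \<not> d x y" for d
    using that code0 unfolding table_ok_def D by (auto split: if_splits)
  show ?thesis
  proof (cases "k = 0")
    case True
    have "table_ok (arrs s ''D'') (arrs s ''pr'') (arrs s ''lb'') (\<lambda>_ _. True)"
    proof (rule ok0)
      show "\<not> True" if "step c x y" for c x y using that True unfolding step_def by linarith
    qed
    then have "Q s (t + 4)"
      using inv by (intro Q) (simp_all add: pair_inv_def)
    moreover have "vars s ''k'' = 0" using k True by linarith
    ultimately show ?thesis unfolding search_all_cmd_def by (simp add: numeral_eq_Suc)
  next
    case False
    let ?I = "\<lambda>s' t'. (vars s' ''go'' = 1 \<and> pair_inv s' \<and>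
        table_ok (arrs s' ''D'') (arrs s' ''pr'') (arrs s' ''lb'') (done_before (skey s') 0) \<and>
        t' + 40 * digits s' \<le> t + 10 + skey s' * pair_cost) \<or>
      (vars s' ''go'' = 0 \<and> vars s' ''m'' = m \<and>
        table_ok (arrs s' ''D'') (arrs s' ''pr'') (arrs s' ''lb'') (\<lambda>_ _. True) \<and>
        t' \<le> t + 10 + triangle (Suc n) ^ (m - 1) * pair_cost + 40 * m)"
    have lt: "skey s' < triangle (Suc n) ^ (m - 1)" if "pair_inv s'" for s'
      using that by (intro key_less) (simp_all add: pair_inv_def)
    have "wp (While (Equal (V ''go'') (N 1)) (Seq process_cmd next_pair_cmd)) Q (set_var ''go'' 1 s) (t + 5)"
    \<comment> \<open>While \<open>go\<close> is set, \<open>key\<close> grows by one per round and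
      stays below the number of row pairs; the outer \<open>Suc\<close> lets clearing
      \<open>go\<close> decrease the measure too.\<close>
    proof (rule wp_While[where I = ?I and \<mu> = "\<lambda>s'. if vars s' ''go'' = 0 then 0 else Suc (triangle (Suc n) ^ (m - 1) - skey s')"],
        goal_cases)
      case 1
      have z: "pair_sum g (\<lambda>_. 0) (\<lambda>_. 0) = 0" for g by (simp add: pair_sum_def triangle_def)
      have "table_ok (arrs s ''D'') (arrs s ''pr'') (arrs s ''lb'') (done_before 0 0)"
        by (rule ok0) (simp add: done_before_def)
      then show ?case using inv zero z by (simp add: pair_inv_def)
    next
      case (2 s' t')
      have go: "vars s' ''go'' = 1" using 2(2) by simp
      then have p: "pair_inv s'" and ok: "table_ok (arrs s' ''D'') (arrs s' ''pr'') (arrs s' ''lb'') (done_before (skey s') 0)"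
        and t': "t' + 40 * digits s' \<le> t + 10 + skey s' * pair_cost" using 2(1) by auto
      have k': "vars s' ''k'' = k" using 2(3) k by simp
      show ?case
        unfolding wp_Seq
      proof (rule wp_process, goal_cases)
        case (9 s1 t1 a b)
        have v1: "vars s1 x = vars s' x" if "x \<notin> {''ok'', ''c'', ''l'', ''u'', ''v'', ''h'', ''t'', ''z'', ''y''}" for x
          using 9(7) that by simp
        have a1: "arrs s1 x = arrs s' x" if "x \<notin> {''lo'', ''hi'', ''D'', ''pr'', ''lb'', ''q''}" for x
          using 9(8) that by simp
        have p1: "pair_inv s1" using p 9(2,3) m_pos unfolding pair_inv_def
          by (simp add: 9(4,5) v1 a1 vecs_upd)
        have go1: "vars s1 ''go'' = 1" using go v1 by simp
        have key1: "skey s1 = skey s'" "digits s1 = digits s'" using 9(4,5) by simp_all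
        have t1: "t1 \<le> t' + 5 + 8 * unit_cost * Suc n + 20" using 9(1) by simp
        show ?case
        proof (rule wp_next_pair[OF p1 go1], goal_cases)
          case (1 s2 t2)
          have a2: "arrs s2 x = arrs s1 x" if "x \<notin> {''off'', ''lo'', ''hi''}" for x using 1(3) that by simp
          have v2: "vars s2 x = vars s1 x" if "x \<notin> {''bs'', ''bt'', ''i'', ''go''}" for x using 1(2) that by simp
          from 1(1) show ?case
          proof (elim disjE conjE, goal_cases)
            case 1
            have "t2 + 40 * digits s2 \<le> t + 10 + skey s2 * pair_cost"
              using 1(4) t1 t' unfolding 1(3) key1 by (simp add: pair_cost_def)
            moreover have "triangle (Suc n) ^ (m - 1) - skey s2 < triangle (Suc n) ^ (m - 1) - skey s'"
              using lt[OF p] 1(3) key1 by (simp add: diff_less_mono2)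
            ultimately show ?case using 1(1-3) 9(6) go by (simp add: a2 key1)
          next
            case 2
            have "table_ok (arrs s2 ''D'') (arrs s2 ''pr'') (arrs s2 ''lb'') (\<lambda>_ _. True)"
              unfolding a2[of "''D''", simplified] a2[of "''pr''", simplified] a2[of "''lb''", simplified]
            proof (rule table_ok_mono[OF 9(6)])
              fix c x y assume st: "step c x y"
              have "key x y < triangle (Suc n) ^ (m - 1)"
                using step_vecs[OF st] step_le[OF st] by (intro key_less) simp_all
              then show "done_before (Suc (skey s')) 0 x y" using 2(2) key1 by (simp add: done_before_def)
            qed
            moreover have "t2 \<le> t + 10 + triangle (Suc n) ^ (m - 1) * pair_cost + 40 * m"
              using 2(3) t1 t' unfolding 2(2)[symmetric] key1 by (simp add: pair_cost_def)
            moreover have "vars s2 ''m'' = m" using v2 p1 by (simp add: pair_inv_def)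
            ultimately show ?case using 2(1) go by simp
          qed
        qed
      qed (use p k' ok in \<open>simp_all add: pair_inv_def\<close>)
    next
      case (3 s' t')
      have "vars s' ''go'' \<noteq> 1" using 3(2) by simp
      then have I: "vars s' ''m'' = m" "table_ok (arrs s' ''D'') (arrs s' ''pr'') (arrs s' ''lb'') (\<lambda>_ _. True)"
        "t' \<le> t + 10 + triangle (Suc n) ^ (m - 1) * pair_cost + 40 * m" using 3(1) by auto
      show ?case
        using I 3(3,4) False by (intro Q) simp_all
    qed
    then show ?thesis unfolding search_all_cmd_def using k False by (simp add: numeral_eq_Suc)
  qed
qed

subsection \<open>Writing the output\<close>

lemma wp_strides:
  assumes v: "vars s ''m'' = m" "vars s ''n'' = n"
    and Q: "\<And>s' t'. (\<And>i. i \<le> m \<Longrightarrow> arrs s' ''st'' i = Suc n ^ i) \<Longrightarrow> t' \<le> t + m * (15 * Suc n + 30) + 10 \<Longrightarrow>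
      (\<And>x. x \<notin> {''i'', ''a'', ''j''} \<Longrightarrow> vars s' x = vars s x) \<Longrightarrow>
      (\<And>a. a \<noteq> ''st'' \<Longrightarrow> arrs s' a = arrs s a) \<Longrightarrow> Q s' t'"
  shows "wp strides_cmd Q s t"
proof -
  let ?I = "\<lambda>s' t'. vars s' ''i'' \<le> m \<and> (\<forall>e\<le>vars s' ''i''. arrs s' ''st'' e = Suc n ^ e) \<and>
     t' \<le> t + 5 + vars s' ''i'' * (15 * Suc n + 30)"
  have *: "wp strides_cmd (\<lambda>s' t'. (\<forall>e\<le>m. arrs s' ''st'' e = Suc n ^ e) \<and> t' \<le> t + 8 + m * (15 * Suc n + 30)) s t"
    unfolding strides_cmd_def wp_Seq wp_Put wp_Assign
  proof (rule wp_While[where I = ?I and \<mu> = "\<lambda>s'. m - vars s' ''i''"], goal_cases)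
    case 1
    show ?case by simp
  next
    case (2 s' t')
    define i where "i = vars s' ''i''"
    have v': "vars s' ''m'' = m" "vars s' ''n'' = n" using 2(3) v by simp_all
    have i: "i < m" "\<And>e. e \<le> i \<Longrightarrow> arrs s' ''st'' e = Suc n ^ e" "t' \<le> t + 5 + i * (15 * Suc n + 30)"
      using 2(1,2) v' by (simp_all add: i_def)
    show ?case
    proof (simp, rule wp_While[where I = "\<lambda>s1 t1. vars s1 ''j'' \<le> Suc n \<and> vars s1 ''a'' = vars s1 ''j'' * Suc n ^ i \<and>
          arrs s1 = arrs s' \<and> t1 \<le> t' + 7 + 15 * vars s1 ''j''" and \<mu> = "\<lambda>s1. Suc n - vars s1 ''j''"], goal_cases)
      case 1
      show ?case by simp
    next
      case (2 s1 t1)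
      have "vars s1 ''n'' = n" "vars s1 ''i'' = i" using 2(3) v' by (simp_all add: i_def)
      then show ?case using 2(1,2) i(2)[of i] by simp
    next
      case (3 s1 t1)
      have v1: "vars s1 ''n'' = n" "vars s1 ''i'' = i" using 3(3) v' by (simp_all add: i_def)
      then have j: "vars s1 ''j'' = Suc n" using 3(1,2) by simp
      have "((arrs s' ''st'')(Suc i := Suc n * Suc n ^ i)) e = Suc n ^ e" if "e \<le> Suc i" for e
        using i(2)[of e] that by (cases "e = Suc i") simp_all
      then show ?case using 3(1) v1 j i(1,3) by (simp add: diff_less_mono2 flip: i_def)
    qed
  next
    case (3 s' t')
    have "vars s' ''m'' = m" using 3(3) v by simp
    then have "vars s' ''i'' = m" using 3(1,2) by simp
    then show ?case using 3(1) by simp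
  qed
  show ?thesis
    by (rule wp_unmodified[OF *], rule Q) simp_all
qed

lemma wp_emit:
  assumes "\<And>s'. arc_set s' = insert (aval u s, arrs s ''nx'' (vars s ''i'')) (arc_set s) \<Longrightarrow>
      (\<And>x. x \<noteq> ''arcs'' \<Longrightarrow> vars s' x = vars s x) \<Longrightarrow>
      (\<And>a. a \<notin> {''tail'', ''head''} \<Longrightarrow> arrs s' a = arrs s a) \<Longrightarrow> Q s' (t + acost u + 10)"
  shows "wp (emit_cmd u) Q s t"
  unfolding emit_cmd_def using assms[OF arc_set_emit] by (simp add: numeral_eq_Suc)

lemma wp_split_step:
  fixes \<delta> :: "nat \<Rightarrow> nat"
  assumes v: "vars s ''m'' = m" "vars s ''d'' = (\<Sum>e<m. \<delta> e * Suc n ^ e)"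
    and st: "\<And>i. i \<le> m \<Longrightarrow> arrs s ''st'' i = Suc n ^ i" and \<delta>: "\<And>e. e < m \<Longrightarrow> \<delta> e \<le> n"
    and Q: "\<And>s' t'. (\<And>e. e < m \<Longrightarrow> arrs s' ''nx'' e = (if \<delta> e = 0 then arrs s ''nx'' e else vars s ''w'')) \<Longrightarrow>
      arc_set s' = arc_set s \<union> {(vars s ''w'', arrs s ''nx'' e) | e. e < m \<and> \<delta> e \<noteq> 0} \<Longrightarrow>
      t' \<le> t + 40 * m + 20 * (\<Sum>e<m. \<delta> e) + 10 \<Longrightarrow>
      (\<And>x. x \<notin> {''i'', ''arcs'', ''d''} \<Longrightarrow> vars s' x = vars s x) \<Longrightarrow>
      (\<And>a. a \<notin> {''tail'', ''head'', ''nx''} \<Longrightarrow> arrs s' a = arrs s a) \<Longrightarrow> Q s' t'"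
  shows "wp split_step_cmd Q s t"
proof -
  let ?I = "\<lambda>s' t'. vars s' ''i'' \<le> m \<and> vars s' ''d'' = (\<Sum>e<vars s' ''i''. \<delta> e * Suc n ^ e) \<and>
     (\<forall>e<m. arrs s' ''nx'' e = (if \<delta> e = 0 \<or> e < vars s' ''i'' then arrs s ''nx'' e else vars s ''w'')) \<and>
     arc_set s' = arc_set s \<union> {(vars s ''w'', arrs s ''nx'' e) | e. vars s' ''i'' \<le> e \<and> e < m \<and> \<delta> e \<noteq> 0} \<and>
     t' + 40 * vars s' ''i'' + 20 * (\<Sum>e<vars s' ''i''. \<delta> e) \<le> t + 5 + 40 * m + 20 * (\<Sum>e<m. \<delta> e)"
  show ?thesis
    unfolding split_step_cmd_def wp_Seq wp_Assign
  proof (rule wp_While[where I = ?I and \<mu> = "\<lambda>s'. vars s' ''i''"], goal_cases)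
    case 1
    have "arc_set (set_var ''i'' m s) = arc_set s" by (rule arc_set_cong) simp_all
    then show ?case using v by (simp cong: conj_cong)
  next
    case (2 s' t')
    then obtain i where i: "vars s' ''i'' = Suc i" by (cases "vars s' ''i''") simp_all
    have im: "i < m" using 2(1) i by simp
    have st': "arrs s' ''st'' i = Suc n ^ i" using 2(4) st im by simp
    have w': "vars s' ''w'' = vars s ''w''" using 2(3) by simp
    let ?rest = "\<Sum>e<i. \<delta> e * Suc n ^ e"
    have d: "vars s' ''d'' = ?rest + \<delta> i * Suc n ^ i" using 2(1) i by simp
    \<comment> \<open>With all higher digits removed, what lies below place \<open>i\<close> is less
      than \<open>Suc n ^ i\<close>. So comparing \<open>d\<close> with \<open>st[i]\<close> tells
      whether digit \<open>i\<close> is nonzero, and subtraction stops exactly when it is used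
      up.\<close>
    have rest: "?rest < Suc n ^ i" using \<delta> im by (intro positional_less) (simp add: less_Suc_eq_le)
    have nx: "arrs s' ''nx'' e = (if \<delta> e = 0 \<or> e < Suc i then arrs s ''nx'' e else vars s ''w'')" if "e < m" for e
      using 2(1) that i by simp
    have arcs: "arc_set s' = arc_set s \<union> {(vars s ''w'', arrs s ''nx'' e) | e. Suc i \<le> e \<and> e < m \<and> \<delta> e \<noteq> 0}"
      using 2(1) i by simp
    have t': "t' + 40 * Suc i + 20 * ((\<Sum>e<i. \<delta> e) + \<delta> i) \<le> t + 5 + 40 * m + 20 * (\<Sum>e<m. \<delta> e)"
      using 2(1) i by simp
    show ?case
    proof (cases "\<delta> i = 0")
      case True
      have "{(vars s ''w'', arrs s ''nx'' e) | e. Suc i \<le> e \<and> e < m \<and> \<delta> e \<noteq> 0} =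
          {(vars s ''w'', arrs s ''nx'' e) | e. i \<le> e \<and> e < m \<and> \<delta> e \<noteq> 0}"
      proof -
        have "(Suc i \<le> e \<and> e < m \<and> \<delta> e \<noteq> 0) = (i \<le> e \<and> e < m \<and> \<delta> e \<noteq> 0)" for e
          using True by (cases "e = i") auto
        then show ?thesis by simp
      qed
      moreover have "arc_set (set_var ''i'' i s') = arc_set s'" by (rule arc_set_cong) simp_all
      moreover have "arrs s' ''nx'' e = (if \<delta> e = 0 \<or> e < i then arrs s ''nx'' e else vars s ''w'')" if "e < m" for e
        using nx[OF that] True by (cases "e = i") auto
      ultimately show ?thesis
        using True d rest st' arcs t' im by (simp add: i)
    next
      case False
      have "Suc n ^ i \<le> \<delta> i * Suc n ^ i" using False by simp
      then have nless: "\<not> vars s' ''d'' < Suc n ^ i" using d by linarith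
      have nxi: "arrs s' ''nx'' i = arrs s ''nx'' i" using nx[OF im] by simp
      have "{(vars s ''w'', arrs s ''nx'' e) | e. i \<le> e \<and> e < m \<and> \<delta> e \<noteq> 0} =
        insert (vars s ''w'', arrs s ''nx'' i) {(vars s ''w'', arrs s ''nx'' e) | e. Suc i \<le> e \<and> e < m \<and> \<delta> e \<noteq> 0}"
      proof -
        have "{e. i \<le> e \<and> e < m \<and> \<delta> e \<noteq> 0} = insert i {e. Suc i \<le> e \<and> e < m \<and> \<delta> e \<noteq> 0}"
          using False im by (auto simp: Suc_le_eq)
        then show ?thesis unfolding setcompr_eq_image by simp
      qed
      then have arcs': "insert (vars s ''w'', arrs s ''nx'' i) (arc_set s') =
          arc_set s \<union> {(vars s ''w'', arrs s ''nx'' e) | e. i \<le> e \<and> e < m \<and> \<delta> e \<noteq> 0}" using arcs by simp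
      show ?thesis
        apply (simp add: i st' nless)
        apply (rule wp_emit)
        subgoal premises p for s1
        proof -
          have v1: "vars s1 x = ((vars s')(''i'' := i)) x" if "x \<noteq> ''arcs''" for x using p(2) that by simp
          have a1: "arrs s1 x = arrs s' x" if "x \<notin> {''tail'', ''head''}" for x using p(3) that by simp
          have e1: "arc_set s1 = insert (vars s ''w'', arrs s ''nx'' i) (arc_set s')"
            using p(1) nxi w' arc_set_cong[of "set_var ''i'' i s'" s'] by simp
          have nx1: "((arrs s' ''nx'')(i := vars s ''w'')) e = (if \<delta> e = 0 \<or> e < i then arrs s ''nx'' e else vars s ''w'')"
            if "e < m" for e using nx[OF that] False by (cases "e = i") auto
          let ?s2 = "set_arr ''nx'' i (vars s ''w'') s1"
          have arc2: "arc_set ?s2 = arc_set s1" by (rule arc_set_cong) simp_all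
          show ?thesis
            apply (simp add: v1 w')
            apply (rule wp_While[where I = "\<lambda>s3 t3. (\<exists>x. vars s3 ''d'' = ?rest + x * Suc n ^ i \<and> x \<le> \<delta> i \<and>
                t3 + 20 * x \<le> t' + 35 + 20 * \<delta> i) \<and> arc_set s3 = arc_set s1" and \<mu> = "\<lambda>s3. vars s3 ''d''"])
            subgoal using d arc2 by (auto simp: v1)
            subgoal premises p3 for s3 t3
            proof -
              have v3: "vars s3 ''i'' = i" "arrs s3 ''st'' i = Suc n ^ i" using p3(3,4) v1 a1 st' by simp_all
              obtain x where x: "vars s3 ''d'' = ?rest + x * Suc n ^ i" "x \<le> \<delta> i" "t3 + 20 * x \<le> t' + 35 + 20 * \<delta> i"
                using p3(1) by blast
              obtain z where z: "x = Suc z" using p3(2) x(1) rest v3 by (cases x) simp_all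
              have "?rest + Suc z * Suc n ^ i - Suc n ^ i = ?rest + z * Suc n ^ i" by simp
              moreover have "arc_set (set_var ''d'' (?rest + z * Suc n ^ i) s3) = arc_set s1"
                using p3(1) arc_set_cong[of "set_var ''d'' (?rest + z * Suc n ^ i) s3" s3] by simp
              ultimately show ?thesis using x z v3 by auto
            qed
            subgoal premises p3 for s3 t3
            proof -
              have v3: "vars s3 ''i'' = i" "arrs s3 ''st'' i = Suc n ^ i" "arrs s3 ''nx'' = (arrs s' ''nx'')(i := vars s ''w'')"
                using p3(3,4) v1 a1 st' by simp_all
              obtain x where x: "vars s3 ''d'' = ?rest + x * Suc n ^ i" "t3 + 20 * x \<le> t' + 35 + 20 * \<delta> i"
                using p3(1) by blast
              have "x = 0" using p3(2) x(1) v3 by (cases x) simp_all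
              moreover have "arc_set s3 = arc_set s1" using p3(1) by blast
              moreover have "arrs s3 ''nx'' e = (if \<delta> e = 0 \<or> e < i then arrs s ''nx'' e else vars s ''w'')"
                if "e < m" for e using nx1[OF that] by (simp only: v3(3))
              ultimately show ?thesis using x arcs' e1 im t' by (simp add: v3(1,2) i)
            qed
            done
        qed
        done
    qed
  next
    case (3 s' t')
    have i: "vars s' ''i'' = 0" using 3(2) by simp
    show ?case
      apply (rule Q)
      subgoal using 3(1) i by simp
      subgoal using 3(1) i by simp
      subgoal using 3(1) i by simp
      subgoal using 3(3) by simp
      subgoal using 3(4) by simp
      done
  qed
qed

section \<open>Tracing the shortest path back\<close>

definition walk :: "(nat \<Rightarrow> nat) \<Rightarrow> (nat \<Rightarrow> nat \<Rightarrow> nat) \<Rightarrow> nat \<Rightarrow> bool" where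
  "walk lab p r \<longleftrightarrow> p 0 = (\<lambda>_. 0) \<and> p r = corner \<and> (\<forall>j<r. step (lab (j + 2)) (p j) (p (Suc j)))"

text \<open>The condition \<open>u < v\<close> is what later makes the diagram acyclic; the sink,
  numbered \<open>1\<close>, is the exception to it.\<close>

definition arcs_ok :: "(nat \<Rightarrow> nat \<Rightarrow> nat) \<Rightarrow> nat \<Rightarrow> nat \<Rightarrow> (nat \<times> nat) set \<Rightarrow> bool" where
  "arcs_ok p r j A \<longleftrightarrow> (\<forall>e<m. successively (\<lambda>u v. (u, v) \<in> A) (route p r e j @ [1])) \<and>
     (\<forall>(u, v)\<in>A. j + 2 \<le> u \<and> u < r + 2 \<and> (v = 1 \<or> u < v \<and> v < r + 2))"

text \<open>A sequence that advances in step \<open>j\<close> has its route extended by one node in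
  front, and one arc to the old head joins it on; the routes of the others do not change. The old
  heads are what \<open>nx\<close> stores.\<close>

lemma arcs_ok_step:
  assumes ok: "arcs_ok p r (Suc j) A" and j: "j < r"
    and A': "A' = A \<union> {(j + 2, hd (route p r e (Suc j) @ [1])) | e. e < m \<and> p j e < p (Suc j) e}"
  shows "arcs_ok p r j A'"
proof -
  have "successively (\<lambda>u v. (u, v) \<in> A') (route p r e j @ [1])" if e: "e < m" for e
  proof -
    have s: "successively (\<lambda>u v. (u, v) \<in> A') (route p r e (Suc j) @ [1])"
      using ok e A' successively_superset[of A _ A'] unfolding arcs_ok_def by blast
    have "(j + 2, hd (route p r e (Suc j) @ [1])) \<in> A'" if "p j e < p (Suc j) e"
      using e that A' by blast
    with s show ?thesis by (simp add: route_Suc[OF j] successively_Cons)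
  qed
  moreover have "j + 2 \<le> u \<and> u < r + 2 \<and> (v = 1 \<or> u < v \<and> v < r + 2)" if uv: "(u, v) \<in> A'" for u v
  proof (cases "(u, v) \<in> A")
    case True then show ?thesis using ok unfolding arcs_ok_def by fastforce
  next
    case False
    then obtain e where "u = j + 2" "v = hd (route p r e (Suc j) @ [1])" using uv A' by blast
    then show ?thesis using hd_route[of p r e "Suc j"] j by auto
  qed
  ultimately show ?thesis unfolding arcs_ok_def by blast
qed

definition table_walk :: "(nat \<Rightarrow> nat) \<Rightarrow> (nat \<Rightarrow> nat) \<Rightarrow> (nat \<Rightarrow> nat) \<Rightarrow> (nat \<Rightarrow> nat \<Rightarrow> nat) \<Rightarrow> nat \<Rightarrow> bool" where
  "table_walk D pr lb p r \<longleftrightarrow> p 0 = (\<lambda>_. 0) \<and> p r = corner \<and>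
    (\<forall>j<r. step (lb (code (p (Suc j)))) (p j) (p (Suc j)) \<and> pr (code (p (Suc j))) = code (p j)) \<and>
    (\<forall>j\<le>r. D (code (p j)) = Suc j)"

lemma wp_trace:
  assumes w: "table_walk (arrs s ''D'') (arrs s ''pr'') (arrs s ''lb'') p r"
    and v: "vars s ''m'' = m" "vars s ''f'' = code corner"
    and st: "\<And>i. i \<le> m \<Longrightarrow> arrs s ''st'' i = Suc n ^ i"
    and nx: "\<And>e. e < m \<Longrightarrow> arrs s ''nx'' e = 1" and arcs: "arc_set s = {}"
    and Q: "\<And>s' t'. t' \<le> t + 20 * (m * n) + r * (40 * m + 60) + 10 \<Longrightarrow>
      (\<And>e. e < m \<Longrightarrow> arrs s' ''nx'' e = hd (route p r e 0 @ [1])) \<Longrightarrow> arcs_ok p r 0 (arc_set s') \<Longrightarrow>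
      walk (arrs s' ''label'') p r \<Longrightarrow>
      (\<And>x. x \<notin> {''w'', ''d'', ''f'', ''i'', ''arcs''} \<Longrightarrow> vars s' x = vars s x) \<Longrightarrow>
      (\<And>a. a \<notin> {''label'', ''tail'', ''head'', ''nx''} \<Longrightarrow> arrs s' a = arrs s a) \<Longrightarrow> Q s' t'"
  shows "wp trace_cmd Q s t"
proof -
  have W: "p 0 = (\<lambda>_. 0)" "p r = corner" "\<And>j. j < r \<Longrightarrow> step (arrs s ''lb'' (code (p (Suc j)))) (p j) (p (Suc j))"
    "\<And>j. j < r \<Longrightarrow> arrs s ''pr'' (code (p (Suc j))) = code (p j)" "\<And>j. j \<le> r \<Longrightarrow> arrs s ''D'' (code (p j)) = Suc j"
    using w by (simp_all add: table_walk_def)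
  \<comment> \<open>The digit sums of the steps add up to the coordinate sum of the last vector,
    which bounds all digit extractions together.\<close>
  have sum_corner: "(\<Sum>e<m. p r e) = m * n" by (simp add: W(2) corner_def)
  let ?I = "\<lambda>s' t'. \<exists>j\<le>r. vars s' ''f'' = code (p j) \<and>
     (\<forall>e<m. arrs s' ''nx'' e = hd (route p r e j @ [1])) \<and> arcs_ok p r j (arc_set s') \<and>
     (\<forall>e. j \<le> e \<and> e < r \<longrightarrow> arrs s' ''label'' (e + 2) = arrs s ''lb'' (code (p (Suc e)))) \<and>
     t' + 20 * (\<Sum>e<m. p j e) + j * (40 * m + 60) \<le> t + 20 * (m * n) + r * (40 * m + 60)"
  show ?thesis
    unfolding trace_cmd_def
  proof (rule wp_While[where I = ?I and \<mu> = "\<lambda>s'. arrs s ''D'' (vars s' ''f'')"], goal_cases)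
    case 1
    show ?case using v nx arcs sum_corner W(2)
      by (intro exI[of _ r]) (simp add: route_end arcs_ok_def)
  next
    case (2 s' t')
    from 2(1) obtain j' where j': "j' \<le> r" "vars s' ''f'' = code (p j')"
      "\<And>e. e < m \<Longrightarrow> arrs s' ''nx'' e = hd (route p r e j' @ [1])" "arcs_ok p r j' (arc_set s')"
      "\<And>e. j' \<le> e \<Longrightarrow> e < r \<Longrightarrow> arrs s' ''label'' (e + 2) = arrs s ''lb'' (code (p (Suc e)))"
      "t' + 20 * (\<Sum>e<m. p j' e) + j' * (40 * m + 60) \<le> t + 20 * (m * n) + r * (40 * m + 60)"
      by blast
    have "code (p j') > 0" using 2(2) j'(2) by simp
    then obtain j where jj: "j' = Suc j" using W(1) code_zero by (cases j') auto
    have jr: "j < r" using j'(1) jj by simp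
    have v': "vars s' ''m'' = m" using 2(3) v by simp
    have a': "arrs s' ''D'' = arrs s ''D''" "arrs s' ''pr'' = arrs s ''pr''" "arrs s' ''lb'' = arrs s ''lb''"
      "arrs s' ''st'' = arrs s ''st''" using 2(4) by simp_all
    define \<delta> where "\<delta> e = p (Suc j) e - p j e" for e
    have le: "p j e \<le> p (Suc j) e" for e using step_le[OF W(3)[OF jr]] .
    have "code (p (Suc j)) = (\<Sum>e<m. \<delta> e * Suc n ^ e + p j e * Suc n ^ e)"
      unfolding code_def by (intro sum.cong) (simp_all add: \<delta>_def le flip: add_mult_distrib)
    then have d: "code (p (Suc j)) - code (p j) = (\<Sum>e<m. \<delta> e * Suc n ^ e)"
      by (simp add: sum.distrib code_def)
    have "(\<Sum>e<m. p (Suc j) e) = (\<Sum>e<m. \<delta> e + p j e)" by (intro sum.cong) (simp_all add: \<delta>_def le)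
    then have sd: "(\<Sum>e<m. p (Suc j) e) = (\<Sum>e<m. \<delta> e) + (\<Sum>e<m. p j e)" by (simp add: sum.distrib)
    have \<delta>n: "\<delta> e \<le> n" for e
      using vecs_le[of "p (Suc j)" e] step_vecs[OF W(3)[OF jr]] by (simp add: \<delta>_def le_diff_conv)
    have \<delta>0: "\<delta> e = 0 \<longleftrightarrow> \<not> p j e < p (Suc j) e" for e using le[of e] by (auto simp: \<delta>_def)
    have Dj: "arrs s ''D'' (code (p (Suc j))) = j + 2" "arrs s ''D'' (code (p j)) = Suc j" using W(5) jr by simp_all
    have f: "vars s' ''f'' = code (p (Suc j))" using j'(2) jj by simp
    show ?case
      apply (simp add: a' f Dj W(4)[OF jr] d)
      apply (rule wp_split_step[where \<delta> = \<delta>])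
      subgoal using v' by simp
      subgoal by simp
      subgoal using st a' by simp
      subgoal using \<delta>n by simp
      subgoal premises q for s1 t1
      proof -
        have f1: "vars s1 ''f'' = code (p j)" using q(4) by simp
        have l1: "arrs s1 ''label'' = (arrs s' ''label'')(j + 2 := arrs s ''lb'' (code (p (Suc j))))" using q(5) by simp
        have nx1: "arrs s1 ''nx'' e = hd (route p r e j @ [1])" if "e < m" for e
          using q(1)[OF that] j'(3)[OF that] jj by (simp add: route_Suc[OF jr] \<delta>0)
        have "arc_set s1 = arc_set s' \<union> {(j + 2, arrs s' ''nx'' e) | e. e < m \<and> \<delta> e \<noteq> 0}"
          using q(2) by (simp add: arc_set_def)
        also have "{(j + 2, arrs s' ''nx'' e) | e. e < m \<and> \<delta> e \<noteq> 0} =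
            {(j + 2, hd (route p r e (Suc j) @ [1])) | e. e < m \<and> p j e < p (Suc j) e}"
          unfolding setcompr_eq_image using j'(3) jj by (intro image_cong) (auto simp: \<delta>0)
        finally have arcs1: "arcs_ok p r j (arc_set s1)" using arcs_ok_step[OF _ jr] j'(4) jj by simp
        have lab: "arrs s1 ''label'' (e + 2) = arrs s ''lb'' (code (p (Suc e)))" if "j \<le> e" "e < r" for e
          using j'(5)[of e] that jj by (cases "e = j") (simp_all add: l1)
        have time: "t1 + 20 * (\<Sum>e<m. p j e) + j * (40 * m + 60) \<le> t + 20 * (m * n) + r * (40 * m + 60)"
          using q(3) j'(6) sd by (simp add: jj)
        show ?thesis
          using f1 nx1 arcs1 lab time jr Dj by (auto intro!: exI[of _ j])
      qed
      done
  next
    case (3 s' t')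
    from 3(1) obtain j where j: "j \<le> r" "vars s' ''f'' = code (p j)"
      "\<And>e. e < m \<Longrightarrow> arrs s' ''nx'' e = hd (route p r e j @ [1])" "arcs_ok p r j (arc_set s')"
      "\<And>e. j \<le> e \<Longrightarrow> e < r \<Longrightarrow> arrs s' ''label'' (e + 2) = arrs s ''lb'' (code (p (Suc e)))"
      "t' + 20 * (\<Sum>e<m. p j e) + j * (40 * m + 60) \<le> t + 20 * (m * n) + r * (40 * m + 60)"
      by blast
    have "code (p j) = code (p 0)" using 3(2) j(2) W(1) code_zero by simp
    then have "j = 0" using W(5)[of j] W(5)[of 0] j(1) by simp
    have lab: "walk (arrs s' ''label'') p r"
      unfolding walk_def using W j(5) \<open>j = 0\<close> by simp
    show ?case
      apply (rule Q)
      subgoal using j(6) by simp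
      subgoal using j(3) \<open>j = 0\<close> by simp
      subgoal using j(4) \<open>j = 0\<close> by simp
      subgoal by (rule lab)
      subgoal using 3(3) by simp
      subgoal using 3(4) by simp
      done
  qed
qed

definition output_ok :: "(nat \<Rightarrow> nat \<Rightarrow> nat) \<Rightarrow> nat \<Rightarrow> store \<Rightarrow> bool" where
  "output_ok p r s \<longleftrightarrow> found s \<and> vars s ''nodes'' = r + 2 \<and> walk (arrs s ''label'') p r \<and>
     (\<forall>e<m. successively (\<lambda>u v. (u, v) \<in> arc_set s) (0 # route p r e 0 @ [1])) \<and>
     (\<forall>(u, v)\<in>arc_set s. u < r + 2 \<and> u \<noteq> 1 \<and> v \<noteq> 0 \<and> v < r + 2 \<and> (v = 1 \<or> u < v))"

lemma wp_output:
  assumes ok: "table_ok (arrs s ''D'') (arrs s ''pr'') (arrs s ''lb'') (\<lambda>_ _. True)"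
    and v: "vars s ''m'' = m" "vars s ''found'' = 0"
    and st: "\<And>i. i \<le> m \<Longrightarrow> arrs s ''st'' i = Suc n ^ i"
    and Q: "\<And>s' t'. t' \<le> t + 200 * (m * Suc n ^ m) \<Longrightarrow>
      (if arrs s ''D'' (code corner) = 0 then \<not> found s'
       else \<exists>p. output_ok p (arrs s ''D'' (code corner) - 1) s') \<Longrightarrow> Q s' t'"
  shows "wp output_cmd Q s t"
proof -
  have f: "arrs s ''st'' m - Suc 0 = code corner" using st[of m] code_corner by simp
  have big: "1 \<le> m * Suc n ^ m" using m_pos by (simp add: Suc_le_eq)
  show ?thesis
  proof (cases "arrs s ''D'' (code corner) = 0")
    case True
    then show ?thesis unfolding output_cmd_def using v f
      by simp (rule Q; use big in \<open>simp add: found_def\<close>)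
  next
    case False
    define r where "r = arrs s ''D'' (code corner) - 1"
    obtain p where w: "table_walk (arrs s ''D'') (arrs s ''pr'') (arrs s ''lb'') p r"
      using table_path[OF ok corner_vecs False] unfolding table_walk_def r_def by blast
    have W: "p 0 = (\<lambda>_. 0)" "p r = corner" "\<And>j. j < r \<Longrightarrow> p j \<le> p (Suc j)" "\<And>j. j \<le> r \<Longrightarrow> arrs s ''D'' (code (p j)) = Suc j"
      using w by (simp_all add: table_walk_def step_def)
    \<comment> \<open>The values \<open>D\<close> along the path are distinct, so the codes strictly
      increase. Thus \<open>r \<le> code corner\<close>, and \<open>O(m)\<close> work per step stays
      within \<open>m * Suc n ^ m\<close>.\<close>
    have "j \<le> code (p j)" if "j \<le> r" for j
      using that
    proof (induction j)
      case (Suc j)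
      have "code (p j) \<le> code (p (Suc j))" using W(3) Suc.prems by (intro code_mono) simp
      moreover have "code (p j) \<noteq> code (p (Suc j))" using W(4)[of j] W(4)[of "Suc j"] Suc.prems by auto
      ultimately show ?case using Suc by simp
    qed simp
    then have "r \<le> code corner" using W(2) by (metis order_refl)
    then have rN: "Suc r \<le> Suc n ^ m" using code_corner by simp
    have D: "arrs s ''D'' (code corner) = Suc r" using False by (simp add: r_def)
    have mr: "m * Suc r \<le> m * Suc n ^ m" using rN by (rule mult_left_mono) simp
    have mn: "m * n \<le> m * Suc n ^ m"
    proof (rule mult_left_mono)
      show "n \<le> Suc n ^ m" using self_le_power[of "Suc n" m] m_pos by simp
    qed simp
    show ?thesis
      unfolding output_cmd_def
      apply (simp add: v f D)
      apply (rule wp_While[where I = "\<lambda>s1 t1. vars s1 ''i'' \<le> m \<and> (\<forall>e<vars s1 ''i''. arrs s1 ''nx'' e = 1) \<and>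
          t1 \<le> t + 30 + 20 * vars s1 ''i''" and \<mu> = "\<lambda>s1. m - vars s1 ''i''"])
      subgoal by simp
      subgoal premises q for s1 t1
      proof -
        have "vars s1 ''m'' = m" using q(3) v by simp
        then show ?thesis using q(1,2) by (simp add: less_Suc_eq diff_less_mono2)
      qed
      subgoal premises q for s1 t1
      proof -
        have v1: "vars s1 ''m'' = m" "vars s1 ''f'' = code corner" "vars s1 ''arcs'' = 0" "vars s1 ''nodes'' = r + 2"
          "vars s1 ''found'' = 1" using q(3) v by simp_all
        have a1: "arrs s1 x = arrs s x" if "x \<noteq> ''nx''" for x using q(4) that by simp
        have im: "vars s1 ''i'' = m" using q(1,2) v1 by simp
        show ?thesis
          unfolding wp_Seq
          apply (rule wp_trace[where p = p and r = r])
          subgoal using w by (simp add: a1)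
          subgoal by (rule v1)
          subgoal by (rule v1)
          subgoal using st by (simp add: a1)
          subgoal using q(1) im by simp
          subgoal using v1 by (simp add: arc_set_def)
          subgoal premises q2 for s2 t2
          proof -
            have v2: "vars s2 x = vars s1 x" if "x \<notin> {''w'', ''d'', ''f'', ''i'', ''arcs''}" for x using q2(5) that by simp
            let ?I = "\<lambda>s3 t3. vars s3 ''i'' \<le> m \<and>
              arc_set s3 = arc_set s2 \<union> {(0, hd (route p r e 0 @ [1])) | e. e < vars s3 ''i''} \<and>
              t3 \<le> t2 + 2 + 20 * vars s3 ''i''"
            show ?thesis
              apply simp
              apply (rule wp_While[where I = ?I and \<mu> = "\<lambda>s3. m - vars s3 ''i''"])
              subgoal using arc_set_cong[of "set_var ''i'' 0 s2" s2] by simp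
              subgoal premises q3 for s3 t3
              proof -
                define i where "i = vars s3 ''i''"
                have nx3: "arrs s3 ''nx'' = arrs s2 ''nx''" using q3(4) by simp
                have "vars s3 ''m'' = m" using q3(3) v2 v1 by simp
                then have im: "i < m" using q3(2) by (simp add: i_def)
                have A: "arc_set s3 = arc_set s2 \<union> {(0, hd (route p r e 0 @ [1])) | e. e < i}" "t3 \<le> t2 + 2 + 20 * i"
                  using q3(1) by (simp_all add: i_def)
                show ?thesis
                  apply simp
                  apply (rule wp_emit)
                  subgoal premises q4 for s4
                  proof -
                    have i4: "vars s4 ''i'' = i" using q4(2) by (simp add: i_def)
                    have "{e. e < Suc i} = insert i {e. e < i}" by auto
                    then have "{(0, hd (route p r e 0 @ [1])) | e. e < Suc i} =
                        insert (0, hd (route p r i 0 @ [1])) {(0::nat, hd (route p r e 0 @ [1])) | e. e < i}"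
                      unfolding setcompr_eq_image by simp
                    then have "arc_set s4 = arc_set s2 \<union> {(0, hd (route p r e 0 @ [1])) | e. e < Suc i}"
                      using q4(1) A nx3 q2(2)[OF im] by (simp flip: i_def)
                    then show ?thesis using i4 A(2) im arc_set_cong[of "set_var ''i'' (Suc i) s4" s4]
                      by (simp add: diff_less_mono2 flip: i_def)
                  qed
                  done
              qed
              subgoal premises q3 for s3 t3
              proof -
                have v3: "vars s3 x = vars s2 x" if "x \<notin> {''i'', ''arcs''}" for x using q3(3) that by simp
                have a3: "arrs s3 x = arrs s2 x" if "x \<notin> {''tail'', ''head''}" for x using q3(4) that by simp
                have "vars s3 ''m'' = m" using v3 v2 v1 by simp
                then have i3: "vars s3 ''i'' = m" using q3(1,2) by simp
                have A: "arc_set s3 = arc_set s2 \<union> {(0, hd (route p r e 0 @ [1])) | e. e < m}"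
                  using q3(1) i3 by simp
                have "successively (\<lambda>u v. (u, v) \<in> arc_set s3) (0 # route p r e 0 @ [1])" if e: "e < m" for e
                proof -
                  have "successively (\<lambda>u v. (u, v) \<in> arc_set s3) (route p r e 0 @ [1])"
                    using q2(3) e A successively_superset[of "arc_set s2" _ "arc_set s3"]
                    unfolding arcs_ok_def by blast
                  moreover have "(0, hd (route p r e 0 @ [1])) \<in> arc_set s3" using A e by blast
                  ultimately show ?thesis by (simp add: successively_Cons)
                qed
                moreover have "u < r + 2 \<and> u \<noteq> 1 \<and> v \<noteq> 0 \<and> v < r + 2 \<and> (v = 1 \<or> u < v)" if uv: "(u, v) \<in> arc_set s3" for u v
                proof (cases "(u, v) \<in> arc_set s2")
                  case True then show ?thesis using q2(3) unfolding arcs_ok_def by fastforce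
                next
                  case False
                  then obtain e where "u = 0" "v = hd (route p r e 0 @ [1])" using uv A by blast
                  then show ?thesis using hd_route[of p r e 0] by auto
                qed
                ultimately have out: "output_ok p r s3"
                  unfolding output_ok_def using q2(4) v1 by (auto simp: found_def v3 v2 a3)
                have t3: "t3 \<le> t2 + 2 + 20 * m" using q3(1) i3 by simp
                have t2: "t2 \<le> t1 + 20 * (m * n) + r * (40 * m + 60) + 13" using q2(1) by simp
                have t1: "t1 \<le> t + 30 + 20 * m" using q(1) im by simp
                have "r * (40 * m + 60) \<le> 100 * (m * r)" using m_pos by (cases m) (simp_all add: algebra_simps)
                moreover have "m * r + m = m * Suc r" by simp
                ultimately have "t3 + 3 \<le> t + 200 * (m * Suc n ^ m)"
                  using t3 t1 t2 mr mn big by linarith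
                moreover have "\<exists>p. output_ok p r s3" using out by blast
                ultimately show ?thesis by (intro Q) (simp_all add: D)
              qed
              done
          qed
          done
      qed
      done
  qed
qed

subsection \<open>Flow diagrams as paths\<close>

lemma length_\<tau>: "i < m \<Longrightarrow> length (\<tau>s ! i) = n" using lengths by simp

text \<open>The filter is the one used in \<open>route\<close>, so segments and nodes correspond
  position by position.\<close>

definition pieces :: "(nat \<Rightarrow> nat \<Rightarrow> nat) \<Rightarrow> nat \<Rightarrow> nat \<Rightarrow> 's list list" where
  "pieces p r i = map (\<lambda>e. take (p (Suc e) i - p e i) (drop (p e i) (\<tau>s ! i)))
     (filter (\<lambda>e. p e i < p (Suc e) i) [0..<r])"

lemma concat_pieces:
  assumes "p 0 = (\<lambda>_. 0)" "\<And>j. j < r \<Longrightarrow> p j i \<le> p (Suc j) i" "i < m"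
  shows "concat (pieces p r i) = take (p r i) (\<tau>s ! i)"
  using assms(2)
proof (induction r)
  case 0
  then show ?case using assms(1) by (simp add: pieces_def)
next
  case (Suc r)
  have "concat (pieces p r i) = take (p r i) (\<tau>s ! i)" using Suc by simp
  moreover have "take (p (Suc r) i) (\<tau>s ! i) = take (p r i) (\<tau>s ! i) @ take (p (Suc r) i - p r i) (drop (p r i) (\<tau>s ! i))"
    using Suc.prems[of r] by (simp flip: take_add)
  ultimately show ?case using Suc.prems[of r] by (auto simp: pieces_def)
qed

lemma located_piece:
  assumes "p 0 = (\<lambda>_. 0)" "\<And>j. j < r \<Longrightarrow> p j i \<le> p (Suc j) i" "i < m" "p r i \<le> n"
    and j: "j < length (pieces p r i)" and e: "route p r i 0 ! j = e + 2"
  shows "e < r" "p e i < p (Suc e) i"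
    "located i (pieces p r i) j = (i, p e i, take (p (Suc e) i - p e i) (drop (p e i) (\<tau>s ! i)))"
proof -
  let ?F = "filter (\<lambda>e. p e i < p (Suc e) i) [0..<r]"
  have jl: "j < length ?F" using j by (simp add: pieces_def)
  have ej: "?F ! j = e" using e jl by (simp add: route_def)
  note T = take_filter_upt[OF jl, unfolded ej]
  show er: "e < r" "p e i < p (Suc e) i" using T by simp_all
  have "take j (pieces p r i) = pieces p e i" using T by (simp add: pieces_def take_map)
  moreover have "concat (pieces p e i) = take (p e i) (\<tau>s ! i)"
    using assms(1-3) er by (intro concat_pieces) simp_all
  moreover have "p e i \<le> p r i" using assms(2) less_imp_le[OF er(1)]
  proof (induction r)
    case (Suc r)
    then show ?case by (cases "e = Suc r") (auto intro: le_trans)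
  qed simp
  ultimately show "located i (pieces p r i) j = (i, p e i, take (p (Suc e) i - p e i) (drop (p e i) (\<tau>s ! i)))"
    using assms(3,4) ej jl length_\<tau> by (simp add: located_def pieces_def)
qed

lemma output_valid:
  assumes out: "output_ok p r s"
  shows "valid_flow_diagram \<tau>s Cs (output_diagram s)" "size_of (output_diagram s) = r + 2"
proof -
  let ?F = "output_diagram s"
  have O: "vars s ''nodes'' = r + 2" "p 0 = (\<lambda>_. 0)" "p r = corner"
      "\<And>j. j < r \<Longrightarrow> step (arrs s ''label'' (j + 2)) (p j) (p (Suc j))"
      "\<And>e. e < m \<Longrightarrow> successively (\<lambda>u v. (u, v) \<in> arc_set s) (0 # route p r e 0 @ [1])"
      "\<And>u v. (u, v) \<in> arc_set s \<Longrightarrow> u < r + 2 \<and> u \<noteq> 1 \<and> v \<noteq> 0 \<and> v < r + 2 \<and> (v = 1 \<or> u < v)"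
    using out by (auto simp: output_ok_def walk_def)
  have F: "nodes ?F = {..<r + 2}" "arcs ?F = arc_set s" "source ?F = 0" "sink ?F = 1" "label ?F = arrs s ''label''"
    using O(1) by (simp_all add: output_diagram_def arc_set_def)
  show "size_of ?F = r + 2" by (simp add: size_of_def F)
  have inner: "\<exists>e<r. v = e + 2" if "v \<in> inner_nodes ?F" for v
    using that by (intro exI[of _ "v - 2"]) (auto simp: inner_nodes_def F)
  have le: "p j i \<le> p (Suc j) i" if "j < r" for i j using step_le O(4) that by blast
  have pr: "p r i = n" if "i < m" for i using O(3) that by (simp add: corner_def)
  have "acyclic (arc_set s)"
  \<comment> \<open>Ranking the sink, whose number is \<open>1\<close>, as \<open>r + 2\<close>
    places it after all inner nodes, so every arc goes up.\<close>
  proof (rule acyclic_subset[OF wf_acyclic[OF wf_measure]])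
    show "arc_set s \<subseteq> measure (\<lambda>v. if v = 1 then r + 2 else v)" using O(6) by fastforce
  qed
  moreover have "arrs s ''label'' v < k" if "v \<in> inner_nodes ?F" for v
    using inner[OF that] O(4) unfolding step_def by blast
  moreover have "arc_set s \<subseteq> {..<r + 2} \<times> {..<r + 2}" using O(6) by auto
  moreover have "(u, 0) \<notin> arc_set s" "(1, u) \<notin> arc_set s" for u using O(6) by blast+
  ultimately have "is_flow_diagram Cs ?F"
    unfolding is_flow_diagram_def F by simp
  moreover have "valid_for \<tau>s Cs ?F"
    unfolding valid_for_def
  proof (intro exI[of _ "pieces p r"] exI[of _ "\<lambda>i. route p r i 0"] conjI allI impI ballI)
    fix i assume i: "i < m"
    show "segmentation (\<tau>s ! i) (pieces p r i)"
    proof -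
      have "concat (pieces p r i) = \<tau>s ! i"
        using concat_pieces[of p r i] O(2) le i pr[OF i] length_\<tau>[OF i] by simp
      moreover have "[] \<notin> set (pieces p r i)"
      proof -
        have "p (Suc e) i \<le> n" if "e < r" for e using O(4)[OF that] step_vecs vecs_le by blast
        then show ?thesis using length_\<tau>[OF i] by (force simp: pieces_def)
      qed
      ultimately show ?thesis by (simp add: segmentation_def)
    qed
    show "length (route p r i 0) = length (pieces p r i)" by (simp add: route_def pieces_def)
    show "st_path ?F (route p r i 0)" unfolding st_path_def F using O(5)[OF i] .
  next
    fix v assume "v \<in> inner_nodes ?F"
    then obtain e where e: "e < r" "v = e + 2" using inner by blast
    have "{located i (pieces p r i) j | i j. i < m \<and> j < length (pieces p r i) \<and> route p r i 0 ! j = v} =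
        checked_set \<tau>s (p e) (p (Suc e))" (is "?L = ?R")
    proof (intro equalityI subsetI)
      fix \<sigma> assume "\<sigma> \<in> ?L"
      then obtain i j where ij: "i < m" "j < length (pieces p r i)" "route p r i 0 ! j = e + 2" "\<sigma> = located i (pieces p r i) j"
        using e(2) by blast
      have "\<sigma> = (i, p e i, take (p (Suc e) i - p e i) (drop (p e i) (\<tau>s ! i)))" "p e i < p (Suc e) i"
        using located_piece[OF O(2) le ij(1) _ ij(2,3)] pr[OF ij(1)] ij(4) by simp_all
      then show "\<sigma> \<in> ?R" using ij(1) unfolding checked_set_def by blast
    next
      fix \<sigma> assume "\<sigma> \<in> ?R"
      then obtain i where i: "i < m" "p e i < p (Suc e) i"
        "\<sigma> = (i, p e i, take (p (Suc e) i - p e i) (drop (p e i) (\<tau>s ! i)))" unfolding checked_set_def by blast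
      have "e + 2 \<in> set (route p r i 0)" using e(1) i(2) by (simp add: route_def)
      then obtain j where j: "j < length (route p r i 0)" "route p r i 0 ! j = e + 2" by (auto simp: in_set_conv_nth)
      then have jl: "j < length (pieces p r i)" by (simp add: route_def pieces_def)
      have "located i (pieces p r i) j = \<sigma>"
        using located_piece(3)[OF O(2) le i(1) _ jl j(2)] pr[OF i(1)] i(3) by simp
      then show "\<sigma> \<in> ?L" using i(1) jl j(2) e(2) by blast
    qed
    then show "(Cs ! label ?F v) {located i (pieces p r i) j | i j. i < m \<and> j < length (pieces p r i) \<and> route p r i 0 ! j = v}"
      using O(4)[OF e(1)] e(2) by (simp add: F step_def)
  qed
  ultimately show "valid_flow_diagram \<tau>s Cs ?F" by (simp add: valid_flow_diagram_def)
qed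

text \<open>If inner nodes are added in topological order, the segments at the nodes added so far
  form a prefix of every sequence, and the vectors of prefix lengths form the walk. Unvisited nodes
  give steps that stay in place, so the number of steps is exactly the number of inner
  nodes.\<close>

lemma valid_reach:
  assumes valid: "valid_flow_diagram \<tau>s Cs F"
  shows "size_of F \<ge> 2 \<and> reach (size_of F - 2) corner"
proof -
  have fd: "finite (nodes F)" "arcs F \<subseteq> nodes F \<times> nodes F" "acyclic (arcs F)" "source F \<in> nodes F" "sink F \<in> nodes F"
      "source F \<noteq> sink F" "\<And>u. (u, source F) \<notin> arcs F" "\<And>u. (sink F, u) \<notin> arcs F"
      "\<And>v. v \<in> inner_nodes F \<Longrightarrow> label F v < k"
    using valid by (auto simp: valid_flow_diagram_def is_flow_diagram_def)
  obtain ws vs where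
      seg: "\<And>i. i < m \<Longrightarrow> segmentation (\<tau>s ! i) (ws i)" and len: "\<And>i. i < m \<Longrightarrow> length (vs i) = length (ws i)"
      and path: "\<And>i. i < m \<Longrightarrow> st_path F (vs i)"
      and crit: "\<And>v. v \<in> inner_nodes F \<Longrightarrow>
        (Cs ! label F v) {located i (ws i) j | i j. i < m \<and> j < length (ws i) \<and> vs i ! j = v}"
    using valid unfolding valid_flow_diagram_def valid_for_def by blast
  have wsn: "ws i ! j \<noteq> []" if "i < m" "j < length (ws i)" for i j
    using seg[OF that(1)] that(2) unfolding segmentation_def by (metis nth_mem)
  have cw: "concat (ws i) = \<tau>s ! i" if "i < m" for i using seg[OF that] by (simp add: segmentation_def)
  have arc: "(vs i ! j, vs i ! Suc j) \<in> arcs F" if "i < m" "Suc j < length (ws i)" for i j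
    using successively_nth[OF path[OF that(1), unfolded st_path_def], of "Suc j"] that(2) len[OF that(1)]
    by (simp add: nth_append)
  have inner: "vs i ! j \<in> inner_nodes F" if "i < m" "j < length (ws i)" for i j
  proof -
    let ?xs = "source F # vs i @ [sink F]"
    have "(?xs ! j, ?xs ! Suc j) \<in> arcs F" "(?xs ! Suc j, ?xs ! Suc (Suc j)) \<in> arcs F"
      using successively_nth[OF path[OF that(1), unfolded st_path_def], of j]
        successively_nth[OF path[OF that(1), unfolded st_path_def], of "Suc j"] that(2) len[OF that(1)] by simp_all
    moreover have "?xs ! Suc j = vs i ! j" using that(2) len[OF that(1)] by (simp add: nth_append)
    ultimately have "(?xs ! j, vs i ! j) \<in> arcs F" "(vs i ! j, ?xs ! Suc (Suc j)) \<in> arcs F" by simp_all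
    then have "vs i ! j \<noteq> source F" "vs i ! j \<noteq> sink F" "vs i ! j \<in> nodes F" using fd(2,7,8) by auto
    then show ?thesis by (simp add: inner_nodes_def)
  qed
  \<comment> \<open>The total length of the segments of sequence \<open>i\<close> at nodes in
    \<open>U\<close>; for \<open>U\<close> closed under inner predecessors it is the length of a
    prefix.\<close>
  define x where "x U i = (if i < m then \<Sum>j<length (ws i). if vs i ! j \<in> U then length (ws i ! j) else 0 else 0)" for U i
  have total: "(\<Sum>j<length (ws i). length (ws i ! j)) = n" if "i < m" for i
    using length_concat_take[of "length (ws i)" "ws i"] cw[OF that] length_\<tau>[OF that] by simp
  have x_mono: "x U \<le> x U'" if "U \<subseteq> U'" for U U'
    using that by (auto simp: x_def le_fun_def intro!: sum_mono)
  have x_all: "x (inner_nodes F) = corner"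
  proof
    fix i show "x (inner_nodes F) i = corner i"
    proof (cases "i < m")
      case True
      have "x (inner_nodes F) i = (\<Sum>j<length (ws i). length (ws i ! j))"
        unfolding x_def using True inner by (simp add: if_P)
      then show ?thesis using total True by (simp add: corner_def)
    qed (simp add: x_def corner_def)
  qed
  have x_vecs: "x U \<in> vecs" for U
  proof -
    have "x U i \<le> n" if "i < m" for i
    proof -
      have "x U i \<le> (\<Sum>j<length (ws i). length (ws i ! j))" using that by (auto simp: x_def intro!: sum_mono)
      then show ?thesis using total that by simp
    qed
    then show ?thesis by (auto simp: vecs_def x_def)
  qed
  have fin: "finite (inner_nodes F)" using fd(1) by (simp add: inner_nodes_def)
  have wf: "wf ((arcs F)\<inverse>)"
    using fd(1-3) by (intro finite_acyclic_wf_converse) (auto intro: finite_subset)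
  \<comment> \<open>No topological order is constructed: induction over predecessor-closed sets
    \<open>U\<close> removes a last node each time.\<close>
  have main: "reach (card U) (x U)"
    if "U \<subseteq> inner_nodes F" "\<And>u v. v \<in> U \<Longrightarrow> u \<in> inner_nodes F \<Longrightarrow> (u, v) \<in> arcs F \<Longrightarrow> u \<in> U" for U
    using that
  proof (induction "card U" arbitrary: U)
    case 0
    then have "U = {}" using fin finite_subset by (metis card_0_eq)
    then have "x U = (\<lambda>_. 0)" by (auto simp: x_def)
    then show ?case using 0 reach_zero by simp
  next
    case (Suc d)
    have finU: "finite U" using Suc.prems(1) fin finite_subset by blast
    have "U \<noteq> {}" using Suc.hyps(2) by auto
    \<comment> \<open>A minimal element of \<open>U\<close> for the converse of the arcs has no
      successor in \<open>U\<close>, so removing it keeps the set closed.\<close>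
    then obtain v where v: "v \<in> U" "\<And>u. (v, u) \<in> arcs F \<Longrightarrow> u \<notin> U"
      using wf unfolding wf_eq_minimal by (metis converse_iff ex_in_conv)
    let ?U = "U - {v}"
    have "reach (card ?U) (x ?U)"
      using Suc.prems Suc.hyps(2) v finU by (intro Suc.hyps(1)) auto
    moreover have "card ?U = d" using Suc.hyps(2) v(1) finU by simp
    moreover have "edge (x ?U) (x U)"
    proof -
      have down: "vs i ! j' \<in> U" if "i < m" "j < length (ws i)" "vs i ! j \<in> U" "j' \<le> j" for i j j'
        using that(4,3,2)
      proof (induction j rule: dec_induct)
        case (step j)
        have "vs i ! j \<in> U"
          using Suc.prems(2)[OF step.prems(1) inner arc] that(1) step.prems(2) by simp
        then show ?case using step.IH step.prems(2) by simp
      qed simp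
      have pos: "x ?U i = length (concat (take j (ws i))) \<and> x U i = length (concat (take (Suc j) (ws i)))"
        if i: "i < m" and j: "j < length (ws i)" and vj: "vs i ! j = v" for i j
      proof -
        have above: "vs i ! j' \<notin> U" if "j < j'" "j' < length (ws i)" for j'
        proof
          assume "vs i ! j' \<in> U"
          then have "vs i ! Suc j \<in> U" using down[OF i that(2), of "Suc j"] that(1) by simp
          moreover have "(v, vs i ! Suc j) \<in> arcs F" using arc[OF i, of j] vj that by simp
          ultimately show False using v(2) by blast
        qed
        have U: "vs i ! j' \<in> U \<longleftrightarrow> j' \<le> j" if "j' < length (ws i)" for j'
          using above[of j'] down[OF i j, of j'] that v(1) vj by (cases "j' \<le> j") auto
        have ne: "vs i ! j' \<noteq> v" if "j' < j" for j'
        proof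
          assume "vs i ! j' = v"
          moreover have "vs i ! Suc j' \<in> U" using U[of "Suc j'"] that j by simp
          moreover have "(vs i ! j', vs i ! Suc j') \<in> arcs F" using arc[OF i, of j'] that j by simp
          ultimately show False using v(2) by blast
        qed
        have U': "vs i ! j' \<in> ?U \<longleftrightarrow> j' < j" if "j' < length (ws i)" for j'
          using U[OF that] ne[of j'] vj by (cases "j' = j") auto
        have sm: "(\<Sum>e<length (ws i). if e < l then length (ws i ! e) else 0) = (\<Sum>e<l. length (ws i ! e))"
          if "l \<le> length (ws i)" for l
        proof -
          have "{..<length (ws i)} \<inter> {e. e < l} = {..<l}" using that by auto
          then show ?thesis by (simp add: sum.If_cases)
        qed
        have "x ?U i = (\<Sum>e<length (ws i). if e < j then length (ws i ! e) else 0)"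
          unfolding x_def if_P[OF i] by (intro sum.cong refl) (simp add: U' del: Diff_iff)
        moreover have "x U i = (\<Sum>e<length (ws i). if e < Suc j then length (ws i ! e) else 0)"
          unfolding x_def if_P[OF i] by (intro sum.cong refl) (simp add: U less_Suc_eq_le)
        ultimately show ?thesis using sm[of j] sm[of "Suc j"] length_concat_take[of j "ws i"]
            length_concat_take[of "Suc j" "ws i"] j by simp
      qed
      have seg_eq: "(i, x ?U i, take (x U i - x ?U i) (drop (x ?U i) (\<tau>s ! i))) = located i (ws i) j \<and> x ?U i < x U i"
        if i: "i < m" and j: "j < length (ws i)" and vj: "vs i ! j = v" for i j
      proof -
        have "\<tau>s ! i = concat (take j (ws i) @ ws i ! j # drop (Suc j) (ws i))"
          using cw[OF i] id_take_nth_drop[OF j] by simp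
        then have "\<tau>s ! i = concat (take j (ws i)) @ ws i ! j @ concat (drop (Suc j) (ws i))" by simp
        moreover have "length (concat (take (Suc j) (ws i))) = length (concat (take j (ws i))) + length (ws i ! j)"
          using j by (simp add: take_Suc_conv_app_nth)
        ultimately show ?thesis using pos[OF i j vj] wsn[OF i j] by (simp add: located_def)
      qed
      have "checked_set \<tau>s (x ?U) (x U) = {located i (ws i) j | i j. i < m \<and> j < length (ws i) \<and> vs i ! j = v}" (is "?L = ?R")
      proof (intro equalityI subsetI)
        fix \<sigma> assume "\<sigma> \<in> ?L"
        then obtain i where i: "i < m" "x ?U i < x U i" "\<sigma> = (i, x ?U i, take (x U i - x ?U i) (drop (x ?U i) (\<tau>s ! i)))"
          unfolding checked_set_def by blast
        have "\<exists>j<length (ws i). vs i ! j = v"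
        proof (rule ccontr)
          assume "\<not> ?thesis"
          then have "x ?U i = x U i" unfolding x_def using i(1) by (auto intro!: sum.cong)
          then show False using i(2) by simp
        qed
        then obtain j where j: "j < length (ws i)" "vs i ! j = v" by blast
        then have "\<sigma> = located i (ws i) j" using seg_eq[OF i(1) j] i(3) by simp
        then show "\<sigma> \<in> ?R" using i(1) j by blast
      next
        fix \<sigma> assume "\<sigma> \<in> ?R"
        then obtain i j where ij: "i < m" "j < length (ws i)" "vs i ! j = v" "\<sigma> = located i (ws i) j" by blast
        then have "\<sigma> = (i, x ?U i, take (x U i - x ?U i) (drop (x ?U i) (\<tau>s ! i)))" "x ?U i < x U i"
          using seg_eq[OF ij(1-3)] by simp_all
        then show "\<sigma> \<in> ?L" using ij(1) unfolding checked_set_def by blast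
      qed
      then have "step (label F v) (x ?U) (x U)"
        unfolding step_def using fd(9) crit v(1) Suc.prems(1) x_vecs x_mono[of ?U U] by auto
      then show ?thesis unfolding edge_def by blast
    qed
    ultimately show ?case using Suc.hyps(2) reach_step by metis
  qed
  have "reach (card (inner_nodes F)) (x (inner_nodes F))" by (rule main) simp_all
  moreover have "card (inner_nodes F) = size_of F - 2"
    using fd(1,4-6) by (simp add: inner_nodes_def size_of_def card_Diff_subset)
  moreover have "card {source F, sink F} \<le> card (nodes F)" using fd(1,4,5) by (intro card_mono) auto
  ultimately show ?thesis using x_all fd(6) by (simp add: size_of_def)
qed

section \<open>Correct answer and total running time\<close>

lemma correct_answerI:
  assumes ok: "table_ok D pr lb (\<lambda>_ _. True)"
    and out: "if D (code corner) = 0 then \<not> found s else \<exists>p. output_ok p (D (code corner) - 1) s"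
  shows "correct_answer \<tau>s Cs s"
proof (cases "D (code corner) = 0")
  case True
  then have "\<not> valid_flow_diagram \<tau>s Cs F" for F
    using valid_reach table_complete[OF ok] by blast
  then show ?thesis using out True by (simp add: correct_answer_def)
next
  case False
  then obtain p where p: "output_ok p (D (code corner) - 1) s" using out by auto
  have "size_of (output_diagram s) \<le> size_of F" if "valid_flow_diagram \<tau>s Cs F" for F
    using valid_reach[OF that] table_complete[OF ok, of "size_of F - 2" corner] output_valid(2)[OF p] by linarith
  then have "minimum_flow_diagram \<tau>s Cs (output_diagram s)"
    using output_valid(1)[OF p] by (simp add: minimum_flow_diagram_def)
  moreover have "found s" using p by (simp add: output_ok_def)
  ultimately show ?thesis using output_valid(1)[OF p] by (auto simp: correct_answer_def)
qed

text \<open>The exponent is \<open>2 * (m - 1) + 1\<close>: at most \<open>(n + 1) ^ 2\<close>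
  digits for each row coordinate, and one factor for the columns. Because \<open>q \<ge> 1\<close>
  and \<open>k > 0\<close>, the overhead of the searches is absorbed:
  \<open>unit_cost \<le> 141 * (k * q)\<close>, and \<open>8 * 141 + 200 \<le> 1400\<close>.\<close>

lemma pair_total:
  assumes "k > 0"
  shows "triangle (Suc n) ^ (m - 1) * pair_cost \<le> 1400 * (k * (n + 1) ^ (2 * m - 1) * q)"
proof -
  have kq: "1 \<le> k * q" "k \<le> k * q" using assms cost_pos by (simp_all add: Suc_le_eq)
  moreover have "k * (q + 20) = k * q + 20 * k" by (simp add: algebra_simps)
  ultimately have "unit_cost \<le> 141 * (k * q)" unfolding unit_cost_def search_cost_def by linarith
  then have "unit_cost * Suc n \<le> 141 * (k * q) * Suc n" by (rule mult_right_mono) simp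
  moreover have "1 * 1 \<le> k * q * Suc n" using kq by (intro mult_mono) simp_all
  ultimately have "pair_cost \<le> 1400 * (k * q * Suc n)" by (simp add: pair_cost_def algebra_simps)
  moreover have "triangle (Suc n) ^ (m - 1) \<le> (Suc n * Suc n) ^ (m - 1)"
    using triangle_le_square by (rule power_mono) simp
  ultimately have "triangle (Suc n) ^ (m - 1) * pair_cost \<le> (Suc n * Suc n) ^ (m - 1) * (1400 * (k * q * Suc n))"
    by (intro mult_mono) simp_all
  also have "\<dots> = 1400 * (k * ((Suc n * Suc n) ^ (m - 1) * Suc n) * q)"
    by (simp only: ac_simps)
  also have "(Suc n * Suc n) ^ (m - 1) * Suc n = (n + 1) ^ (2 * m - 1)"
  proof -
    have "2 * m - 1 = Suc (2 * (m - 1))" using m_pos by (cases m) simp_all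
    then show ?thesis by (simp add: power_mult power2_eq_square)
  qed
  finally show ?thesis .
qed

lemma flow_program_correct:
  "\<exists>t s'. exec \<tau>s Cs q flow_program (input_store m n k) t s' \<and> correct_answer \<tau>s Cs s' \<and>
     t \<le> 2000 * (k * (n + 1) ^ (2 * m - 1) * q + m * (n + 1) ^ m)"
proof -
  let ?s = "input_store m n k"
  have "wp flow_program (\<lambda>s' t. correct_answer \<tau>s Cs s' \<and>
      t \<le> 2000 * (k * (n + 1) ^ (2 * m - 1) * q + m * (n + 1) ^ m)) ?s 0"
    unfolding flow_program_def wp_Seq
    apply (rule wp_strides)
    subgoal by (simp add: input_store_def)
    subgoal by (simp add: input_store_def)
    subgoal premises p for s1 t1
    proof -
      let ?s1 = "set_arr ''D'' 0 1 s1"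
      have a1: "arrs s1 x = (\<lambda>_. 0)" if "x \<noteq> ''st''" for x using p(4) that by (simp add: input_store_def)
      have v1: "vars s1 ''m'' = m" "vars s1 ''n'' = n" "vars s1 ''k'' = k" "vars s1 ''bs'' = 0" "vars s1 ''bt'' = 0"
        "vars s1 ''found'' = 0" using p(3) by (simp_all add: input_store_def)
      have upd0: "(\<lambda>_. 0)(0 := 0) = (\<lambda>_::nat. 0::nat)" by auto
      have inv: "pair_inv ?s1"
        unfolding pair_inv_def using p(1) v1 zero_vecs code_zero by (simp add: a1 upd0)
      show ?thesis
        unfolding wp_Put aval.simps acost.simps
        apply (rule wp_search_all[OF inv])
        subgoal using v1 by simp
        subgoal by (simp add: a1)
        subgoal by (simp add: a1)
        subgoal by (simp add: a1)
        subgoal premises p2 for s2 t2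
          apply (rule wp_output[OF p2(1)])
          subgoal using p2(3) .
          subgoal using p2(6) v1 by simp
          subgoal using p2(4) p(1) by simp
          subgoal premises p3 for s3 t3
          proof (rule conjI)
            show "correct_answer \<tau>s Cs s3" using correct_answerI[OF p2(1) p3(2)] .
            let ?mN = "m * Suc n ^ m"
            \<comment> \<open>Computing the powers takes time \<open>O(m * (n + 1))\<close>, which
              the second term covers since \<open>m \<ge> 1\<close>.\<close>
            have "Suc n ^ 1 \<le> Suc n ^ m" using m_pos by (intro power_increasing) linarith+
            then have "m * Suc n \<le> ?mN" by (intro mult_left_mono) simp_all
            moreover have "m \<le> m * Suc n" by simp
            ultimately have mN: "m * Suc n \<le> ?mN" "m \<le> ?mN" "1 \<le> ?mN" using m_pos by linarith+
            have "t1 \<le> 15 * (m * Suc n) + 30 * m + 10" using p(2) by (simp add: algebra_simps)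
            moreover have "t2 \<le> t1 + 3 + 1400 * (k * (n + 1) ^ (2 * m - 1) * q) + 40 * m + 300"
              using p2(2) pair_total by (cases "k = 0") simp_all
            ultimately show "t3 \<le> 2000 * (k * (n + 1) ^ (2 * m - 1) * q + m * (n + 1) ^ m)"
              using p3(1) mN unfolding Suc_eq_plus1 add_mult_distrib2 by linarith
          qed
          done
        done
    qed
    done
  then show ?thesis unfolding wp_def by auto
qed

end

theorem theorem5:
  "\<exists>(prog :: com) (K :: nat).
     \<forall>(T :: nat \<Rightarrow> nat \<Rightarrow> nat) (\<tau>s :: 's list list) (Cs :: 's criterion list)
        (m :: nat) (n :: nat) (k :: nat).
       m \<ge> 1 \<and> length \<tau>s = m \<and> (\<forall>\<tau>\<in>set \<tau>s. length \<tau> = n) \<and>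
       length Cs = k \<and> (\<forall>C\<in>set Cs. monotone_decreasing \<tau>s C) \<and>
       T m n \<ge> 1 \<longrightarrow>
       (\<exists>t s'. exec \<tau>s Cs (T m n) prog (input_store m n k) t s' \<and>
          correct_answer \<tau>s Cs s' \<and>
          t \<le> K * (k * (n + 1) ^ (2 * m - 1) * T m n + m * (n + 1) ^ m))"
proof (rule exI[of _ "flow_program"], rule exI[of _ 2000], intro allI impI)
  fix T :: "nat \<Rightarrow> nat \<Rightarrow> nat" and \<tau>s :: "'s list list" and Cs :: "'s criterion list" and m n k :: nat
  assume A: "m \<ge> 1 \<and> length \<tau>s = m \<and> (\<forall>\<tau>\<in>set \<tau>s. length \<tau> = n) \<and>
       length Cs = k \<and> (\<forall>C\<in>set Cs. monotone_decreasing \<tau>s C) \<and> T m n \<ge> 1"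
  then interpret flow_input \<tau>s Cs n "T m n" by unfold_locales auto
  show "\<exists>t s'. exec \<tau>s Cs (T m n) flow_program (input_store m n k) t s' \<and>
          correct_answer \<tau>s Cs s' \<and>
          t \<le> 2000 * (k * (n + 1) ^ (2 * m - 1) * T m n + m * (n + 1) ^ m)"
    using flow_program_correct A by simp
qed

end
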